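(* For each $n$, let $d=d(n)$ with $d\to\infty$ as $n\to\infty$. Let $\mathcal P$ be a strongly monotone property, and let $H_0=([m],E_0)$ be a graph with $\mathcal P(H_0)=0$ such that adding an edge $e$ to $H_0$ results in a graph $H_1=([m],E_0\cup\{e\})$ with $\mathcal P(H_1)=1$. (The objects $\mathcal P,H_0,m$ and $\theta\ge0$ may depend on $n$.) (1) Suppose $\log\lfloor d/m\rfloor\le n$. If $$\theta<\operatorname{atanh}\bigg(\sqrt{\frac{\log\lfloor d/m\rfloor}{n}}\bigg),$$ then $\liminf_{n\to\infty}R_n(\mathcal P,\theta)=1$. (2) Furthermore, there is a sufficiently large constant $C$ such that $\liminf_{n\to\infty}R_n(\mathcal P,\theta)=1$ whenever $\log\lfloor d/m\rfloor\ge Cn$.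
   Context: Graphs are finite and simple; $\mathcal G_d$ is the set of graphs with vertex set $[d]=\{1,\dots,d\}$. A binary graph property $\mathcal P$ assigns a value in $\{0,1\}$ to graphs; it is evaluated also on graphs with fewer than $d$ vertices and does not depend on the labelling of the vertices. Write $G'\subseteq G$ if $V(G')\subseteq V(G)$ and $E(G')\subseteq E(G)$. $\mathcal P$ is strongly monotone if $\mathcal P(G')\le\mathcal P(G)$ for any two graphs $G'\subseteq G$. $\mathcal G_i(\mathcal P)=\{G\in\mathcal G_d:\mathcal P(G)=i\}$, $i=0,1$. Convention: $\operatorname{atanh}(1)=\infty$. Model: for $\theta\ge0$ and a graph $G$ on $[d]$, $\mathbb P_{\theta,G}(\boldsymbol X=\boldsymbol x)=Z_{\theta,G}^{-1}\exp\big(\theta\sum_{(u,v)\in E(G)}x_ux_v\big)$ for $\boldsymbol x\in\{\pm1\}^d$, with $Z_{\theta,G}$ the normalizing constant; $\mathbb P^{\otimes n}_{\theta,G}$ is the law of $n$ i.i.d. observations. Minimax risk: $R_n(\mathcal P,\theta)=\inf_\psi\big[\sup_{G\in\mathcal G_0(\mathcal P)}\mathbb P^{\otimes n}_{\theta,G}(\psi=1)+\sup_{G\in\mathcal G_1(\mathcal P)}\mathbb P^{\otimes n}_{\theta,G}(\psi=0)\big]$, the infimum being over all measurable $\{0,1\}$-valued tests $\psi$ of the $n$ observations.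
   Formalization: The formal statement additionally assumes that the null class G_0(P) of graphs on [d] is nonempty for each n ≥ 1; without this the claim fails, e.g. P(G)=1 iff G has more than m=2 vertices or an edge, where G_0(P) is empty and the risk is 0. *)

theory Defs
  imports "HOL-Probability.Probability"
begin

section \<open>Graphs and graph properties\<close>

text \<open>A graph is a pair of a vertex set and a set of two-element vertex sets. Natural numbers as
  labels suffice, since properties are required to be independent of the labelling.\<close>

type_synonym ugraph = "nat set \<times> nat set set"

abbreviation verts :: "ugraph \<Rightarrow> nat set" where "verts \<equiv> fst"
abbreviation edges :: "ugraph \<Rightarrow> nat set set" where "edges \<equiv> snd"

definition simple_graph :: "ugraph \<Rightarrow> bool" where
  "simple_graph G \<longleftrightarrow> finite (verts G) \<and> (\<forall>e\<in>edges G. e \<subseteq> verts G \<and> card e = 2)"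

definition graphs_on :: "nat \<Rightarrow> ugraph set" where
  "graphs_on d = {G. simple_graph G \<and> verts G = {1..d}}"

definition subgraph :: "ugraph \<Rightarrow> ugraph \<Rightarrow> bool" where
  "subgraph G' G \<longleftrightarrow> verts G' \<subseteq> verts G \<and> edges G' \<subseteq> edges G"

definition relabel :: "(nat \<Rightarrow> nat) \<Rightarrow> ugraph \<Rightarrow> ugraph" where
  "relabel f G = (f ` verts G, (\<lambda>e. f ` e) ` edges G)"

text \<open>The values 0 and 1 of a binary property are represented by the truth values, with
  \<open>False \<le> True\<close>.\<close>

definition graph_property :: "(ugraph \<Rightarrow> bool) \<Rightarrow> bool" where
  "graph_property P \<longleftrightarrow>
     (\<forall>G f. simple_graph G \<and> inj_on f (verts G) \<longrightarrow> P (relabel f G) = P G)"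

definition strongly_monotone :: "(ugraph \<Rightarrow> bool) \<Rightarrow> bool" where
  "strongly_monotone P \<longleftrightarrow>
     (\<forall>G' G. simple_graph G' \<and> simple_graph G \<and> subgraph G' G \<longrightarrow> P G' \<le> P G)"

definition null_graphs :: "(ugraph \<Rightarrow> bool) \<Rightarrow> nat \<Rightarrow> ugraph set" where
  "null_graphs P d = {G \<in> graphs_on d. \<not> P G}"

definition alt_graphs :: "(ugraph \<Rightarrow> bool) \<Rightarrow> nat \<Rightarrow> ugraph set" where
  "alt_graphs P d = {G \<in> graphs_on d. P G}"

section \<open>The ferromagnetic Ising model and the minimax risk\<close>

definition spins :: "nat \<Rightarrow> (nat \<Rightarrow> real) set" where
  "spins d = {1..d} \<rightarrow>\<^sub>E {-1, 1}"

text \<open>For an edge \<open>e = {u, v}\<close> the product over \<open>e\<close> is \<open>x u * x v\<close>.\<close>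

definition ising_weight :: "real \<Rightarrow> ugraph \<Rightarrow> (nat \<Rightarrow> real) \<Rightarrow> real" where
  "ising_weight \<theta> G x = exp (\<theta> * (\<Sum>e\<in>edges G. \<Prod>v\<in>e. x v))"

definition ising_Z :: "nat \<Rightarrow> real \<Rightarrow> ugraph \<Rightarrow> real" where
  "ising_Z d \<theta> G = (\<Sum>x\<in>spins d. ising_weight \<theta> G x)"

definition ising :: "nat \<Rightarrow> real \<Rightarrow> ugraph \<Rightarrow> (nat \<Rightarrow> real) measure" where
  "ising d \<theta> G = point_measure (spins d) (\<lambda>x. ennreal (ising_weight \<theta> G x / ising_Z d \<theta> G))"

definition ising_sample :: "nat \<Rightarrow> nat \<Rightarrow> real \<Rightarrow> ugraph \<Rightarrow> (nat \<Rightarrow> nat \<Rightarrow> real) measure" where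
  "ising_sample n d \<theta> G = (\<Pi>\<^sub>M i\<in>{1..n}. ising d \<theta> G)"

text \<open>The sigma-algebra of the observations depends neither on the parameter nor on the graph.\<close>

definition tests :: "nat \<Rightarrow> nat \<Rightarrow> ((nat \<Rightarrow> nat \<Rightarrow> real) \<Rightarrow> bool) set" where
  "tests n d = (\<Pi>\<^sub>M i\<in>{1..n}. count_space (spins d)) \<rightarrow>\<^sub>M count_space UNIV"

definition minimax_risk :: "nat \<Rightarrow> nat \<Rightarrow> (ugraph \<Rightarrow> bool) \<Rightarrow> real \<Rightarrow> ennreal" where
  "minimax_risk n d P \<theta> =
     (INF \<psi>\<in>tests n d.
        (SUP G\<in>null_graphs P d.
           emeasure (ising_sample n d \<theta> G) {x \<in> space (ising_sample n d \<theta> G). \<psi> x}) +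
        (SUP G\<in>alt_graphs P d.
           emeasure (ising_sample n d \<theta> G) {x \<in> space (ising_sample n d \<theta> G). \<not> \<psi> x}))"

section \<open>The asymptotic setting\<close>

definition atanh_ext :: "real \<Rightarrow> ereal" where
  "atanh_ext x = (if x = 1 then \<infinity> else ereal (artanh x))"

definition critical_edge :: "(ugraph \<Rightarrow> bool) \<Rightarrow> nat \<Rightarrow> nat set set \<Rightarrow> nat set \<Rightarrow> bool" where
  "critical_edge P m E e \<longleftrightarrow>
     simple_graph ({1..m}, E) \<and> e \<subseteq> {1..m} \<and> card e = 2 \<and> e \<notin> E \<and>
     \<not> P ({1..m}, E) \<and> P ({1..m}, insert e E)"

text \<open>Sample sizes start at 1. The null class has to be assumed nonempty for the testing problem
  to make sense: strong monotonicity compares graphs on different vertex sets, so a property may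
  fail for a graph on \<open>m\<close> vertices and yet hold for every graph on \<open>d > m\<close> vertices.\<close>

definition testing_setting ::
  "(nat \<Rightarrow> nat) \<Rightarrow> (nat \<Rightarrow> ugraph \<Rightarrow> bool) \<Rightarrow> (nat \<Rightarrow> nat) \<Rightarrow> (nat \<Rightarrow> nat set set) \<Rightarrow>
   (nat \<Rightarrow> nat set) \<Rightarrow> (nat \<Rightarrow> real) \<Rightarrow> bool" where
  "testing_setting d P m E e \<theta> \<longleftrightarrow>
     filterlim d at_top sequentially \<and>
     (\<forall>n\<ge>1. graph_property (P n) \<and> strongly_monotone (P n) \<and> null_graphs (P n) (d n) \<noteq> {} \<and>
            critical_edge (P n) (m n) (E n) (e n) \<and> 0 \<le> \<theta> n)"

end

theory Submission
  imports Defs "HOL-Real_Asymp.Real_Asymp"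
begin

text \<open>A lower bound on the minimax risk needs one graph \<open>F\<close> and many edges whose toggling changes the value of
the property, such that the uniform mixture of the laws of the toggled graphs is close in total variation
to the law of \<open>F\<close>: no test then beats guessing (\<open>testing_lower_bound\<close>; it is immaterial on which side
of the property \<open>F\<close> lies). Toggling the edge \<open>e\<close> multiplies the density of one observation by
\<open>(1 \<plusminus> t * x\<^sub>e) / (1 \<plusminus> t * \<rho>\<^sub>e)\<close>, where \<open>t = tanh \<theta>\<close>, \<open>x\<^sub>e\<close> is the product of the two spins and \<open>\<rho>\<^sub>e\<close> its
mean. With \<open>N = d div m\<close>, both hypotheses of the theorem yield \<open>n * t\<^sup>2 \<le> ln N\<close> and \<open>N \<ge> 2\<close>, and the risk has
to be shown to tend to 1 as \<open>d\<close> and \<open>n\<close> grow. The work lies in finding \<open>F\<close> and the edges for an arbitrary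
monotone property, and the argument depends on the size of \<open>N\<close>.

If \<open>N\<close> is large (\<open>risk_complete_blocks\<close>), take \<open>N\<close> disjoint complete graphs on \<open>m\<close> vertices, each of
which has the property, and let \<open>F\<close> be a maximal subgraph of their union that fails it. Every block misses
an edge, and by maximality adding a missing edge produces the property. The \<open>N\<close> likelihood ratios are
independent with mean 1. Their second moment is at most \<open>(1 + t\<^sup>2) ^ n\<close>, which may be of order \<open>N\<close>, so
their average need not have a small variance; but their moment of order \<open>3/2\<close> is at most \<open>N\<close> to the power
\<open>0.48 < 1/2\<close>, and truncation at level \<open>N\<close> gives a law of large numbers.

If \<open>N\<close> stays bounded (\<open>risk_few_blocks\<close>), then \<open>t\<close> tends to 0, the blocks are too few, and critical edges
have to be found elsewhere. The complete graph is filled up in stages. At every moment the graph consists of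
a complete core, of a bounded number of peripheral vertices that are joined to prescribed parts of the core,
and of isolated vertices. A cyclic group of bounded but large order acts freely on the vertices that
are in use and preserves every stage. Somewhere the property appears, and it appears while an orbit of edges between
peripheral vertices is added; transitivity of the action on the orbit rules out that a single edge of the
orbit is responsible, so that many edges of the orbit are critical
(\<open>free_cyclic_action.orbit_critical_edges\<close>). If the core is bounded, then a complete graph of bounded
size has the property and the first case applies with many blocks. If the core is large, two disjoint edges
between peripheral vertices are nearly uncorrelated (\<open>core_covariance_small\<close>) and the chi-square distance of
the mixture from the law of \<open>F\<close> is small.

The reason for the small correlation is this. Given the core, the peripheral spins are independent, with mean
\<open>tanh\<close> of the local field, up to a negligible effect of the edges among them. So it is enough that the product
of two such means hardly fluctuates. When \<open>\<theta>\<close> times the size of the core is large, the core spins are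
all aligned, by an entropy bound for the complete graph and Griffiths' second inequality. When it is
bounded, the core behaves like a Curie-Weiss model, whose log-weights are uniformly concave in the
\<^emph>\<open>square\<close> of the magnetization (\<open>cw_log_concave\<close>). Hence the absolute magnetization
concentrates at a single value, at all temperatures including the critical one.\<close>

section \<open>Gibbs expectations and Griffiths' inequalities\<close>

abbreviation chi :: "nat set \<Rightarrow> (nat \<Rightarrow> real) \<Rightarrow> real" where
  "chi A x \<equiv> (\<Prod>v\<in>A. x v)"

definition pairs :: "nat set \<Rightarrow> nat set set" where
  "pairs A = {e. e \<subseteq> A \<and> card e = 2}"

definition gibbs :: "nat \<Rightarrow> real \<Rightarrow> nat set set \<Rightarrow> (nat \<Rightarrow> real) \<Rightarrow> real" where
  "gibbs d \<theta> F x = ising_weight \<theta> ({1..d}, F) x / ising_Z d \<theta> ({1..d}, F)"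

definition gexp :: "nat \<Rightarrow> real \<Rightarrow> nat set set \<Rightarrow> ((nat \<Rightarrow> real) \<Rightarrow> real) \<Rightarrow> real" where
  "gexp d \<theta> F f = (\<Sum>x\<in>spins d. gibbs d \<theta> F x * f x)"

lemma finite_spins [simp]: "finite (spins d)"
  unfolding spins_def by (intro finite_PiE) auto

lemma card_spins: "card (spins d) = 2 ^ d"
  unfolding spins_def by (simp add: card_PiE numeral_2_eq_2)

lemma spins_value: "x \<in> spins d \<Longrightarrow> v \<in> {1..d} \<Longrightarrow> x v = 1 \<or> x v = -1"
  unfolding spins_def by (auto simp: PiE_iff)

lemma spins_outside: "x \<in> spins d \<Longrightarrow> v \<notin> {1..d} \<Longrightarrow> x v = undefined"
  unfolding spins_def by (auto simp: PiE_iff extensional_def)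

lemma spins_eqI:
  assumes "x \<in> spins d" "y \<in> spins d" "\<And>v. v \<in> {1..d} \<Longrightarrow> x v = y v"
  shows "x = y"
  using assms unfolding spins_def by (metis PiE_ext)

lemma spins_sq: "x \<in> spins d \<Longrightarrow> v \<in> {1..d} \<Longrightarrow> x v * x v = 1"
  using spins_value[of x d v] by auto

lemma spins_upd: "x \<in> spins d \<Longrightarrow> v \<in> {1..d} \<Longrightarrow> a \<in> {-1, 1} \<Longrightarrow> x(v := a) \<in> spins d"
  unfolding spins_def by (auto simp: PiE_iff extensional_def)

lemma spins_nonempty [simp]: "spins d \<noteq> {}"
  using card_spins[of d] by auto

lemma chi_value:
  assumes "x \<in> spins d" "A \<subseteq> {1..d}"
  shows "chi A x = 1 \<or> chi A x = -1"
proof -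
  have "finite A" using assms(2) finite_subset by blast
  then show ?thesis using assms
  proof (induction A)
    case (insert a A)
    then show ?case using spins_value[of x d a] by auto
  qed simp
qed

lemma chi_sq: "x \<in> spins d \<Longrightarrow> A \<subseteq> {1..d} \<Longrightarrow> chi A x * chi A x = 1"
  using chi_value[of x d A] by auto

lemma chi_abs: "x \<in> spins d \<Longrightarrow> A \<subseteq> {1..d} \<Longrightarrow> \<bar>chi A x\<bar> = 1"
  using chi_value[of x d A] by auto

text \<open>Squares of spins are 1, so monomials multiply like sets under symmetric difference.\<close>

lemma chi_symdiff:
  assumes x: "x \<in> spins d" and A: "A \<subseteq> {1..d}" and B: "B \<subseteq> {1..d}"
  shows "chi A x * chi B x = chi ((A - B) \<union> (B - A)) x"
proof -
  have fin: "finite A" "finite B" using A B finite_subset by blast+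
  have "chi A x = chi (A - B) x * chi (A \<inter> B) x"
    using fin by (metis Diff_Diff_Int Diff_subset prod.subset_diff mult.commute)
  moreover have "chi B x = chi (B - A) x * chi (A \<inter> B) x"
    using fin by (metis Diff_Diff_Int Diff_subset prod.subset_diff mult.commute Int_commute)
  moreover have "chi (A \<inter> B) x * chi (A \<inter> B) x = 1"
    using A by (intro chi_sq[OF x]) auto
  ultimately have "chi A x * chi B x = chi (A - B) x * chi (B - A) x"
    by (simp add: algebra_simps)
  also have "\<dots> = chi ((A - B) \<union> (B - A)) x"
    using fin by (subst prod.union_disjoint) auto
  finally show ?thesis .
qed

lemma finite_pairs: "finite A \<Longrightarrow> finite (pairs A)"
  unfolding pairs_def by (rule finite_subset[of _ "Pow A"]) auto

lemma finite_edge_set: "F \<subseteq> pairs {1..d} \<Longrightarrow> finite F"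
  using finite_pairs finite_subset by blast

lemma pairs_mono: "A \<subseteq> B \<Longrightarrow> pairs A \<subseteq> pairs B"
  unfolding pairs_def by auto

lemma pairs_subset: "F \<subseteq> pairs A \<Longrightarrow> e \<in> F \<Longrightarrow> e \<subseteq> A"
  unfolding pairs_def by auto

lemma gibbs_weight: "ising_weight \<theta> (V, F) x = exp (\<theta> * (\<Sum>e\<in>F. chi e x))"
  by (simp add: ising_weight_def)

lemma ising_Z_pos: "0 < ising_Z d \<theta> G"
  unfolding ising_Z_def ising_weight_def by (intro sum_pos) auto

lemma gibbs_pos: "0 < gibbs d \<theta> F x"
  unfolding gibbs_def using ising_Z_pos by (simp add: ising_weight_def)

lemma gibbs_nonneg [simp]: "0 \<le> gibbs d \<theta> F x"
  using gibbs_pos less_imp_le by blast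

lemma sum_gibbs: "(\<Sum>x\<in>spins d. gibbs d \<theta> F x) = 1"
  unfolding gibbs_def sum_divide_distrib[symmetric]
  using ising_Z_pos[of d \<theta> "({1..d}, F)"] by (simp add: ising_Z_def)

lemma gexp_cong: "(\<And>x. x \<in> spins d \<Longrightarrow> f x = g x) \<Longrightarrow> gexp d \<theta> F f = gexp d \<theta> F g"
  unfolding gexp_def by (intro sum.cong) auto

lemma gexp_const [simp]: "gexp d \<theta> F (\<lambda>x. c) = c"
  unfolding gexp_def sum_distrib_right[symmetric] by (simp add: sum_gibbs)

lemma gexp_add: "gexp d \<theta> F (\<lambda>x. f x + g x) = gexp d \<theta> F f + gexp d \<theta> F g"
  unfolding gexp_def by (simp add: ring_distribs sum.distrib)

lemma gexp_diff: "gexp d \<theta> F (\<lambda>x. f x - g x) = gexp d \<theta> F f - gexp d \<theta> F g"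
  unfolding gexp_def by (simp add: ring_distribs sum_subtractf)

lemma gexp_cmult: "gexp d \<theta> F (\<lambda>x. c * f x) = c * gexp d \<theta> F f"
  unfolding gexp_def sum_distrib_left by (simp add: mult_ac)

lemma gexp_multc: "gexp d \<theta> F (\<lambda>x. f x * c) = gexp d \<theta> F f * c"
  unfolding gexp_def sum_distrib_right by (simp add: mult_ac)

lemma gexp_divide: "gexp d \<theta> F (\<lambda>x. f x / c) = gexp d \<theta> F f / c"
  using gexp_multc[of d \<theta> F f "inverse c"] by (simp add: field_simps)

lemma gexp_sum: "gexp d \<theta> F (\<lambda>x. \<Sum>i\<in>I. f i x) = (\<Sum>i\<in>I. gexp d \<theta> F (f i))"
  unfolding gexp_def by (simp add: sum_distrib_left) (rule sum.swap)

lemma gexp_mono: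
  "(\<And>x. x \<in> spins d \<Longrightarrow> f x \<le> g x) \<Longrightarrow> gexp d \<theta> F f \<le> gexp d \<theta> F g"
  unfolding gexp_def by (intro sum_mono mult_left_mono) auto

lemma gexp_nonneg: "(\<And>x. x \<in> spins d \<Longrightarrow> 0 \<le> f x) \<Longrightarrow> 0 \<le> gexp d \<theta> F f"
  using gexp_mono[of d "\<lambda>_. 0" f] by simp

lemma gexp_abs: "\<bar>gexp d \<theta> F f\<bar> \<le> gexp d \<theta> F (\<lambda>x. \<bar>f x\<bar>)"
  unfolding gexp_def by (rule order_trans[OF sum_abs]) (simp add: abs_mult)

lemma gexp_abs_le1:
  assumes "\<And>x. x \<in> spins d \<Longrightarrow> \<bar>f x\<bar> \<le> 1" shows "\<bar>gexp d \<theta> F f\<bar> \<le> 1"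
proof -
  have "gexp d \<theta> F (\<lambda>x. \<bar>f x\<bar>) \<le> gexp d \<theta> F (\<lambda>x. 1)" by (intro gexp_mono assms)
  with gexp_abs[of d \<theta> F f] show ?thesis by simp
qed

lemma gexp_abs_le_sqrt: "gexp d \<theta> F (\<lambda>x. \<bar>f x\<bar>) \<le> sqrt (gexp d \<theta> F (\<lambda>x. (f x)\<^sup>2))"
proof -
  have "(\<Sum>x\<in>spins d. sqrt (gibbs d \<theta> F x) * (sqrt (gibbs d \<theta> F x) * \<bar>f x\<bar>))\<^sup>2
      \<le> (\<Sum>x\<in>spins d. (sqrt (gibbs d \<theta> F x))\<^sup>2) * (\<Sum>x\<in>spins d. (sqrt (gibbs d \<theta> F x) * \<bar>f x\<bar>)\<^sup>2)"
    by (rule Cauchy_Schwarz_ineq_sum)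
  then have "(gexp d \<theta> F (\<lambda>x. \<bar>f x\<bar>))\<^sup>2 \<le> gexp d \<theta> F (\<lambda>x. (f x)\<^sup>2)"
    by (simp add: gexp_def power_mult_distrib mult.assoc[symmetric] sum_gibbs)
  then show ?thesis by (rule real_le_rsqrt)
qed

text \<open>The factor contributed by the additional edges is a density of the larger model with respect to the smaller
one, up to normalization.\<close>

lemma gexp_tilt:
  assumes F: "F \<subseteq> pairs {1..d}" and D: "D \<subseteq> pairs {1..d}" "F \<inter> D = {}"
  shows "gexp d \<theta> (F \<union> D) f =
    gexp d \<theta> F (\<lambda>x. exp (\<theta> * (\<Sum>e\<in>D. chi e x)) * f x)
      / gexp d \<theta> F (\<lambda>x. exp (\<theta> * (\<Sum>e\<in>D. chi e x)))"
proof -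
  let ?w = "\<lambda>F x. ising_weight \<theta> ({1..d}, F) x" and ?Z = "\<lambda>F. ising_Z d \<theta> ({1..d}, F)"
  let ?h = "\<lambda>x. exp (\<theta> * (\<Sum>e\<in>D. chi e x))"
  have fin: "finite F" "finite D" using F D finite_edge_set by auto
  have w: "?w (F \<union> D) x = ?w F x * ?h x" for x
    using fin D by (simp add: gibbs_weight sum.union_disjoint ring_distribs exp_add)
  have E: "?Z F * gexp d \<theta> F k = (\<Sum>x\<in>spins d. ?w F x * k x)" for k
    using ising_Z_pos[of d \<theta> "({1..d}, F)"]
    unfolding gexp_def gibbs_def sum_distrib_left by (intro sum.cong) auto
  have Z: "?Z (F \<union> D) = ?Z F * gexp d \<theta> F ?h"
    unfolding E unfolding ising_Z_def w ..
  have "gexp d \<theta> (F \<union> D) f = (\<Sum>x\<in>spins d. ?w F x * (?h x * f x)) / ?Z (F \<union> D)"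
    unfolding gexp_def gibbs_def w sum_divide_distrib by (intro sum.cong) auto
  also have "\<dots> = gexp d \<theta> F (\<lambda>x. ?h x * f x) / gexp d \<theta> F ?h"
    unfolding Z E[symmetric] using ising_Z_pos[of d \<theta> "({1..d}, F)"] by simp
  finally show ?thesis .
qed

text \<open>Every function of a sign is affine. For nonnegative couplings this turns the exponential weights into products of
affine factors with nonnegative coefficients; it is the source of the parameter \<open>tanh \<theta>\<close>.\<close>

lemma exp_edge:
  assumes "x \<in> spins d" "e \<subseteq> {1..d}"
  shows "exp (a * chi e x) = cosh a * (1 + tanh a * chi e x)"
proof -
  have "cosh a * (1 + tanh a * c) = cosh a + sinh a * c" for c
    by (simp add: tanh_def ring_distribs)
  from this[of 1] this[of "-1"]
  have "cosh a * (1 + tanh a) = cosh a + sinh a" "cosh a * (1 - tanh a) = cosh a - sinh a" by simp_all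
  moreover have "exp a = cosh a + sinh a" "exp (- a) = cosh a - sinh a"
    by (simp_all add: cosh_plus_sinh cosh_minus_sinh)
  ultimately show ?thesis using chi_value[OF assms] by (elim disjE) simp_all
qed

text \<open>Flipping one of the spins in a nonempty monomial reverses its sign, so the sum vanishes.\<close>

lemma spins_sum_chi_nonneg:
  assumes A: "A \<subseteq> {1..d}" shows "0 \<le> (\<Sum>x\<in>spins d. chi A x)"
proof (cases "A = {}")
  case False
  then obtain v where v: "v \<in> A" by auto
  have fin: "finite A" using A finite_subset by blast
  have "(\<Sum>x\<in>spins d. chi A x) = (\<Sum>x\<in>spins d. chi A (x(v := - x v)))"
  proof (rule sum.reindex_bij_witness[of _ "\<lambda>x. x(v := - x v)" "\<lambda>x. x(v := - x v)"])
    show flip: "x(v := - x v) \<in> spins d" if "x \<in> spins d" for x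
      using spins_value[OF that, of v] v A by (intro spins_upd that) auto
    show "x(v := - x v) \<in> spins d" if "x \<in> spins d" for x by (rule flip[OF that])
  qed simp_all
  also have "\<dots> = (\<Sum>x\<in>spins d. - chi A x)"
  proof (rule sum.cong)
    fix x
    show "chi A (x(v := - x v)) = - chi A x"
    proof -
      have "chi (A - {v}) (x(v := - x v)) = chi (A - {v}) x" by (intro prod.cong) auto
      then show ?thesis
        using prod.remove[OF fin v, of "x(v := - x v)"] prod.remove[OF fin v, of x] by simp
    qed
  qed simp
  finally show ?thesis by (simp add: sum_negf)
qed (simp add: card_spins)

text \<open>Expanding the product gives a nonnegative combination of monomials, each of which has a nonnegative sum; the
induction carries out the expansion one factor at a time.\<close>

lemma griffiths_product:
  assumes "finite F" "\<And>e. e \<in> F \<Longrightarrow> e \<subseteq> {1..d}" "\<And>e. e \<in> F \<Longrightarrow> 0 \<le> a e" "A \<subseteq> {1..d}"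
  shows "0 \<le> (\<Sum>x\<in>spins d. chi A x * (\<Prod>e\<in>F. 1 + a e * chi e x))"
  using assms
proof (induction F arbitrary: A)
  case empty
  then show ?case by (simp add: spins_sum_chi_nonneg)
next
  case (insert e F)
  let ?S = "(A - e) \<union> (e - A)"
  have "(\<Sum>x\<in>spins d. chi A x * (\<Prod>e\<in>insert e F. 1 + a e * chi e x))
     = (\<Sum>x\<in>spins d. chi A x * (\<Prod>e\<in>F. 1 + a e * chi e x)
          + a e * (chi ?S x * (\<Prod>e\<in>F. 1 + a e * chi e x)))"
  proof (rule sum.cong)
    fix x assume x: "x \<in> spins d"
    show "chi A x * (\<Prod>e\<in>insert e F. 1 + a e * chi e x)
      = chi A x * (\<Prod>e\<in>F. 1 + a e * chi e x) + a e * (chi ?S x * (\<Prod>e\<in>F. 1 + a e * chi e x))"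
      using insert.hyps chi_symdiff[OF x, of A e, symmetric] insert.prems
      by (simp add: algebra_simps)
  qed simp
  also have "\<dots> = (\<Sum>x\<in>spins d. chi A x * (\<Prod>e\<in>F. 1 + a e * chi e x))
       + a e * (\<Sum>x\<in>spins d. chi ?S x * (\<Prod>e\<in>F. 1 + a e * chi e x))"
    by (simp add: sum.distrib sum_distrib_left)
  also have "\<dots> \<ge> 0"
  proof -
    have "?S \<subseteq> {1..d}" using insert.prems by auto
    then have "0 \<le> (\<Sum>x\<in>spins d. chi ?S x * (\<Prod>e\<in>F. 1 + a e * chi e x))"
      using insert by blast
    moreover have "0 \<le> (\<Sum>x\<in>spins d. chi A x * (\<Prod>e\<in>F. 1 + a e * chi e x))"
      using insert by blast
    ultimately show ?thesis using insert.prems by simp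
  qed
  finally show ?case .
qed

lemma griffiths_couplings:
  assumes F: "F \<subseteq> pairs {1..d}" and J: "\<And>e. e \<in> F \<Longrightarrow> 0 \<le> J e" and A: "A \<subseteq> {1..d}"
  shows "0 \<le> (\<Sum>x\<in>spins d. exp (\<Sum>e\<in>F. J e * chi e x) * chi A x)"
proof -
  have fin: "finite F" using F finite_edge_set by blast
  have sub: "e \<subseteq> {1..d}" if "e \<in> F" for e using F that pairs_subset by blast
  have "(\<Sum>x\<in>spins d. exp (\<Sum>e\<in>F. J e * chi e x) * chi A x)
    = (\<Sum>x\<in>spins d. (\<Prod>e\<in>F. cosh (J e)) * (chi A x * (\<Prod>e\<in>F. 1 + tanh (J e) * chi e x)))"
  proof (rule sum.cong)
    fix x assume x: "x \<in> spins d"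
    have "exp (\<Sum>e\<in>F. J e * chi e x) = (\<Prod>e\<in>F. cosh (J e) * (1 + tanh (J e) * chi e x))"
      using fin sub exp_edge[OF x] by (simp add: exp_sum)
    then show "exp (\<Sum>e\<in>F. J e * chi e x) * chi A x
      = (\<Prod>e\<in>F. cosh (J e)) * (chi A x * (\<Prod>e\<in>F. 1 + tanh (J e) * chi e x))"
      by (simp add: prod.distrib)
  qed simp
  also have "\<dots> = (\<Prod>e\<in>F. cosh (J e)) * (\<Sum>x\<in>spins d. chi A x * (\<Prod>e\<in>F. 1 + tanh (J e) * chi e x))"
    by (simp add: sum_distrib_left)
  also have "\<dots> \<ge> 0"
    using fin sub A J by (intro mult_nonneg_nonneg prod_nonneg griffiths_product) auto
  finally show ?thesis .
qed

lemma griffiths_first: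
  assumes "F \<subseteq> pairs {1..d}" "0 \<le> \<theta>" "A \<subseteq> {1..d}"
  shows "0 \<le> gexp d \<theta> F (chi A)"
proof -
  have "gexp d \<theta> F (chi A) = (\<Sum>x\<in>spins d. exp (\<Sum>e\<in>F. \<theta> * chi e x) * chi A x) / ising_Z d \<theta> ({1..d}, F)"
    by (simp add: gexp_def gibbs_def gibbs_weight sum_divide_distrib sum_distrib_left)
  then show ?thesis
    using griffiths_couplings[OF assms(1) _ assms(3), of "\<lambda>_. \<theta>"] assms(2) ising_Z_pos[of d \<theta> "({1..d}, F)"]
    by simp
qed

text \<open>The second Griffiths inequality, by duplication: in two independent copies \<open>x\<close> and \<open>y\<close>, substitute
\<open>y = x * z\<close>. For fixed \<open>z\<close> the joint weight is again a ferromagnetic weight in \<open>x\<close>, now with the couplings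
\<open>\<theta> * (1 + z\<^sub>e) \<ge> 0\<close>, so that the nonnegativity of the sums of monomials applies.\<close>

lemma griffiths_second:
  assumes F: "F \<subseteq> pairs {1..d}" and \<theta>: "0 \<le> \<theta>" and A: "A \<subseteq> {1..d}" and B: "B \<subseteq> {1..d}"
  shows "gexp d \<theta> F (chi A) * gexp d \<theta> F (chi B) \<le> gexp d \<theta> F (\<lambda>x. chi A x * chi B x)"
proof -
  let ?w = "\<lambda>x. exp (\<Sum>e\<in>F. \<theta> * chi e x)" and ?Z = "ising_Z d \<theta> ({1..d}, F)"
  let ?m = "\<lambda>x z v. if v \<in> {1..d} then x v * z v else undefined"
  have fin: "finite F" using F finite_edge_set by blast
  have sub: "e \<subseteq> {1..d}" if "e \<in> F" for e using F that pairs_subset by blast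
  have m_spins: "?m x z \<in> spins d" if "x \<in> spins d" "z \<in> spins d" for x z
    using that spins_value[of x d] spins_value[of z d]
    unfolding spins_def by (fastforce simp: PiE_iff extensional_def)
  have m_chi: "chi D (?m x z) = chi D x * chi D z" if "D \<subseteq> {1..d}" for D x z
  proof -
    have "chi D (?m x z) = chi D (\<lambda>v. x v * z v)" using that by (intro prod.cong) auto
    then show ?thesis by (simp add: prod.distrib)
  qed
  have m_inv: "?m x (?m x z) = z" if "x \<in> spins d" "z \<in> spins d" for x z
    using that spins_sq[of x d] spins_outside[of z d] by (auto simp: fun_eq_iff mult.assoc[symmetric])
  have Zpos: "0 < ?Z" by (rule ising_Z_pos)
  have Zsum: "?Z = (\<Sum>x\<in>spins d. ?w x)" by (simp add: ising_Z_def gibbs_weight sum_distrib_left)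
  have E: "gexp d \<theta> F f = (\<Sum>x\<in>spins d. ?w x * f x) / ?Z" for f
    by (simp add: gexp_def gibbs_def gibbs_weight sum_divide_distrib sum_distrib_left)
  have "(\<Sum>x\<in>spins d. ?w x * (chi A x * chi B x)) * ?Z
      - (\<Sum>x\<in>spins d. ?w x * chi A x) * (\<Sum>x\<in>spins d. ?w x * chi B x)
     = (\<Sum>x\<in>spins d. \<Sum>y\<in>spins d. ?w x * ?w y * (chi A x * chi B x - chi A x * chi B y))"
    unfolding Zsum sum_product sum_subtractf[symmetric]
    by (intro sum.cong refl) (simp add: algebra_simps)
  also have "\<dots> = (\<Sum>x\<in>spins d. \<Sum>z\<in>spins d.
       ?w x * ?w (?m x z) * (chi A x * chi B x - chi A x * chi B (?m x z)))"
  proof (rule sum.cong[OF refl])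
    fix x assume x: "x \<in> spins d"
    show "(\<Sum>y\<in>spins d. ?w x * ?w y * (chi A x * chi B x - chi A x * chi B y))
      = (\<Sum>z\<in>spins d. ?w x * ?w (?m x z) * (chi A x * chi B x - chi A x * chi B (?m x z)))"
      by (rule sum.reindex_bij_witness[of _ "?m x" "?m x"])
         (use x in \<open>simp_all only: m_spins m_inv\<close>)
  qed
  also have "\<dots> = (\<Sum>z\<in>spins d. \<Sum>x\<in>spins d.
       ?w x * ?w (?m x z) * (chi A x * chi B x - chi A x * chi B (?m x z)))"
    by (rule sum.swap)
  also have "\<dots> \<ge> 0"
  proof (rule sum_nonneg)
    fix z assume z: "z \<in> spins d"
    let ?S = "(A - B) \<union> (B - A)"
    have "(\<Sum>x\<in>spins d. ?w x * ?w (?m x z) * (chi A x * chi B x - chi A x * chi B (?m x z)))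
      = (\<Sum>x\<in>spins d. (1 - chi B z) * (exp (\<Sum>e\<in>F. (\<theta> * (1 + chi e z)) * chi e x) * chi ?S x))"
    proof (rule sum.cong[OF refl])
      fix x assume x: "x \<in> spins d"
      have "?w x * ?w (?m x z) = exp (\<Sum>e\<in>F. (\<theta> * (1 + chi e z)) * chi e x)"
        unfolding exp_add[symmetric] sum.distrib[symmetric]
        by (rule arg_cong[where f = exp], rule sum.cong[OF refl], subst m_chi)
           (auto simp: algebra_simps dest!: sub)
      moreover have "chi A x * chi B x - chi A x * chi B (?m x z) = (1 - chi B z) * chi ?S x"
        unfolding m_chi[OF B] chi_symdiff[OF x A B, symmetric] by (simp add: algebra_simps)
      ultimately show "?w x * ?w (?m x z) * (chi A x * chi B x - chi A x * chi B (?m x z))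
        = (1 - chi B z) * (exp (\<Sum>e\<in>F. (\<theta> * (1 + chi e z)) * chi e x) * chi ?S x)" by simp
    qed
    also have "\<dots> = (1 - chi B z) * (\<Sum>x\<in>spins d. exp (\<Sum>e\<in>F. (\<theta> * (1 + chi e z)) * chi e x) * chi ?S x)"
      by (simp add: sum_distrib_left)
    also have "\<dots> \<ge> 0"
    proof (rule mult_nonneg_nonneg)
      show "0 \<le> 1 - chi B z" using chi_value[OF z B] by auto
      show "0 \<le> (\<Sum>x\<in>spins d. exp (\<Sum>e\<in>F. (\<theta> * (1 + chi e z)) * chi e x) * chi ?S x)"
      proof (rule griffiths_couplings[OF F])
        show "0 \<le> \<theta> * (1 + chi e z)" if "e \<in> F" for e
          using chi_value[OF z sub[OF that]] \<theta> by auto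
        show "?S \<subseteq> {1..d}" using A B by auto
      qed
    qed
    finally show "0 \<le> (\<Sum>x\<in>spins d. ?w x * ?w (?m x z) * (chi A x * chi B x - chi A x * chi B (?m x z)))" .
  qed
  finally have "(\<Sum>x\<in>spins d. ?w x * chi A x) * (\<Sum>x\<in>spins d. ?w x * chi B x)
      \<le> (\<Sum>x\<in>spins d. ?w x * (chi A x * chi B x)) * ?Z" by simp
  then show ?thesis unfolding E using Zpos by (simp add: field_simps)
qed

lemma gexp_insert:
  assumes F: "F \<subseteq> pairs {1..d}" and e: "e \<in> pairs {1..d}" "e \<notin> F"
  shows "gexp d \<theta> (insert e F) f =
    gexp d \<theta> F (\<lambda>x. (1 + tanh \<theta> * chi e x) * f x) / (1 + tanh \<theta> * gexp d \<theta> F (chi e))"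
proof -
  have sub: "e \<subseteq> {1..d}" using e by (simp add: pairs_def)
  have "gexp d \<theta> (F \<union> {e}) f = gexp d \<theta> F (\<lambda>x. exp (\<theta> * (\<Sum>e\<in>{e}. chi e x)) * f x)
      / gexp d \<theta> F (\<lambda>x. exp (\<theta> * (\<Sum>e\<in>{e}. chi e x)))"
    by (rule gexp_tilt) (use F e in auto)
  also have "gexp d \<theta> F (\<lambda>x. exp (\<theta> * (\<Sum>e\<in>{e}. chi e x)) * f x)
     = gexp d \<theta> F (\<lambda>x. cosh \<theta> * ((1 + tanh \<theta> * chi e x) * f x))"
    by (rule gexp_cong) (simp add: exp_edge[OF _ sub])
  also have "\<dots> = cosh \<theta> * gexp d \<theta> F (\<lambda>x. (1 + tanh \<theta> * chi e x) * f x)"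
    by (rule gexp_cmult)
  also have "gexp d \<theta> F (\<lambda>x. exp (\<theta> * (\<Sum>e\<in>{e}. chi e x)))
     = gexp d \<theta> F (\<lambda>x. cosh \<theta> * (1 + tanh \<theta> * chi e x))"
    by (rule gexp_cong) (simp add: exp_edge[OF _ sub])
  also have "\<dots> = cosh \<theta> * (1 + tanh \<theta> * gexp d \<theta> F (chi e))"
    by (simp add: gexp_cmult gexp_add)
  finally show ?thesis by simp
qed

text \<open>The derivative of a correlation in the coupling of an edge is a covariance, which is nonnegative by the second
Griffiths inequality; here the coupling jumps from 0 to \<open>\<theta>\<close>.\<close>

lemma gexp_edge_mono:
  assumes "F' \<subseteq> pairs {1..d}" "F \<subseteq> F'" and \<theta>: "0 \<le> \<theta>" and A: "A \<subseteq> {1..d}"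
  shows "gexp d \<theta> F (chi A) \<le> gexp d \<theta> F' (chi A)"
proof -
  have "finite (F' - F)" using assms finite_edge_set by blast
  moreover have "gexp d \<theta> F (chi A) \<le> gexp d \<theta> (F \<union> D) (chi A)" if "finite D" "D \<subseteq> F' - F" for D
    using that
  proof (induction D)
    case (insert e D)
    let ?E = "F \<union> D"
    have E: "?E \<subseteq> pairs {1..d}" and e: "e \<in> pairs {1..d}" "e \<notin> ?E"
      using insert assms by auto
    then have sub: "e \<subseteq> {1..d}" by (simp add: pairs_def)
    have g: "gexp d \<theta> ?E (chi A) * gexp d \<theta> ?E (chi e) \<le> gexp d \<theta> ?E (\<lambda>x. chi A x * chi e x)"
      by (rule griffiths_second[OF E \<theta> A sub])
    have r: "0 \<le> gexp d \<theta> ?E (chi e)" by (rule griffiths_first[OF E \<theta> sub])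
    have t: "0 \<le> tanh \<theta>" using \<theta> by simp
    have "gexp d \<theta> (insert e ?E) (chi A) =
      (gexp d \<theta> ?E (chi A) + tanh \<theta> * gexp d \<theta> ?E (\<lambda>x. chi A x * chi e x)) / (1 + tanh \<theta> * gexp d \<theta> ?E (chi e))"
      unfolding gexp_insert[OF E e]
      by (simp add: ring_distribs gexp_add gexp_cmult mult_ac)
    moreover have "gexp d \<theta> ?E (chi A) * (1 + tanh \<theta> * gexp d \<theta> ?E (chi e))
      \<le> gexp d \<theta> ?E (chi A) + tanh \<theta> * gexp d \<theta> ?E (\<lambda>x. chi A x * chi e x)"
      using mult_left_mono[OF g t] by (simp add: algebra_simps)
    moreover have "0 < 1 + tanh \<theta> * gexp d \<theta> ?E (chi e)"
      using mult_nonneg_nonneg[OF t r] by linarith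
    ultimately have "gexp d \<theta> ?E (chi A) \<le> gexp d \<theta> (insert e ?E) (chi A)"
      by (simp add: pos_le_divide_eq)
    then show ?case using insert by auto
  qed simp
  ultimately have "gexp d \<theta> F (chi A) \<le> gexp d \<theta> (F \<union> (F' - F)) (chi A)" by blast
  then show ?thesis using assms by (simp add: Un_absorb1)
qed

section \<open>Testing against the toggling of single edges\<close>

definition samples :: "nat \<Rightarrow> nat \<Rightarrow> (nat \<Rightarrow> nat \<Rightarrow> real) set" where
  "samples n d = {1..n} \<rightarrow>\<^sub>E spins d"

definition sprob :: "nat \<Rightarrow> nat \<Rightarrow> real \<Rightarrow> nat set set \<Rightarrow> (nat \<Rightarrow> nat \<Rightarrow> real) \<Rightarrow> real" where
  "sprob n d \<theta> F X = (\<Prod>i\<in>{1..n}. gibbs d \<theta> F (X i))"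

definition sexp :: "nat \<Rightarrow> nat \<Rightarrow> real \<Rightarrow> nat set set \<Rightarrow> ((nat \<Rightarrow> nat \<Rightarrow> real) \<Rightarrow> real) \<Rightarrow> real" where
  "sexp n d \<theta> F f = (\<Sum>X\<in>samples n d. sprob n d \<theta> F X * f X)"

lemma finite_samples [simp]: "finite (samples n d)"
  unfolding samples_def by (intro finite_PiE) auto

lemma sample_in_spins: "X \<in> samples n d \<Longrightarrow> i \<in> {1..n} \<Longrightarrow> X i \<in> spins d"
  unfolding samples_def by auto

lemma sprob_nonneg [simp]: "0 \<le> sprob n d \<theta> F X"
  unfolding sprob_def by (intro prod_nonneg) auto

lemma sexp_prod: "sexp n d \<theta> F (\<lambda>X. \<Prod>i\<in>{1..n}. f (X i)) = gexp d \<theta> F f ^ n"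
proof -
  have "(\<Prod>i\<in>{1..n}. \<Sum>x\<in>spins d. gibbs d \<theta> F x * f x)
     = (\<Sum>X\<in>samples n d. \<Prod>i\<in>{1..n}. gibbs d \<theta> F (X i) * f (X i))"
    unfolding samples_def by (rule prod_sum_PiE) auto
  then show ?thesis
    by (simp add: sexp_def sprob_def gexp_def prod.distrib)
qed

lemma sexp_const [simp]: "sexp n d \<theta> F (\<lambda>X. c) = c"
proof -
  have "(\<Sum>X\<in>samples n d. sprob n d \<theta> F X) = 1"
  proof -
    have "sexp n d \<theta> F (\<lambda>X. \<Prod>i\<in>{1..n}. 1) = gexp d \<theta> F (\<lambda>x. 1) ^ n" by (rule sexp_prod)
    then show ?thesis by (simp only: sexp_def prod.neutral_const mult_1_right gexp_const power_one)
  qed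
  then show ?thesis unfolding sexp_def by (simp add: sum_distrib_right[symmetric])
qed

lemma sum_sprob: "(\<Sum>X\<in>samples n d. sprob n d \<theta> F X) = 1"
  using sexp_const[of n d \<theta> F 1] unfolding sexp_def by simp

lemma sexp_cong: "(\<And>X. X \<in> samples n d \<Longrightarrow> f X = g X) \<Longrightarrow> sexp n d \<theta> F f = sexp n d \<theta> F g"
  unfolding sexp_def by (intro sum.cong) auto

lemma sexp_add: "sexp n d \<theta> F (\<lambda>x. f x + g x) = sexp n d \<theta> F f + sexp n d \<theta> F g"
  unfolding sexp_def by (simp add: ring_distribs sum.distrib)

lemma sexp_diff: "sexp n d \<theta> F (\<lambda>x. f x - g x) = sexp n d \<theta> F f - sexp n d \<theta> F g"
  unfolding sexp_def by (simp add: ring_distribs sum_subtractf)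

lemma sexp_cmult: "sexp n d \<theta> F (\<lambda>x. c * f x) = c * sexp n d \<theta> F f"
  unfolding sexp_def sum_distrib_left by (simp add: mult_ac)

lemma sexp_divide: "sexp n d \<theta> F (\<lambda>x. f x / c) = sexp n d \<theta> F f / c"
  using sexp_cmult[of n d \<theta> F "inverse c" f] by (simp add: field_simps)

lemma sexp_sum: "sexp n d \<theta> F (\<lambda>x. \<Sum>i\<in>I. f i x) = (\<Sum>i\<in>I. sexp n d \<theta> F (f i))"
  unfolding sexp_def by (simp add: sum_distrib_left) (rule sum.swap)

lemma sexp_mono:
  "(\<And>x. x \<in> samples n d \<Longrightarrow> f x \<le> g x) \<Longrightarrow> sexp n d \<theta> F f \<le> sexp n d \<theta> F g"
  unfolding sexp_def by (intro sum_mono mult_left_mono) auto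

lemma sexp_nonneg: "(\<And>x. x \<in> samples n d \<Longrightarrow> 0 \<le> f x) \<Longrightarrow> 0 \<le> sexp n d \<theta> F f"
  using sexp_mono[of n d "\<lambda>_. 0" f] by simp

lemma sexp_abs_le_sqrt: "sexp n d \<theta> F (\<lambda>x. \<bar>f x\<bar>) \<le> sqrt (sexp n d \<theta> F (\<lambda>x. (f x)\<^sup>2))"
proof -
  have "(\<Sum>x\<in>samples n d. sqrt (sprob n d \<theta> F x) * (sqrt (sprob n d \<theta> F x) * \<bar>f x\<bar>))\<^sup>2
      \<le> (\<Sum>x\<in>samples n d. (sqrt (sprob n d \<theta> F x))\<^sup>2) * (\<Sum>x\<in>samples n d. (sqrt (sprob n d \<theta> F x) * \<bar>f x\<bar>)\<^sup>2)"
    by (rule Cauchy_Schwarz_ineq_sum)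
  then have "(sexp n d \<theta> F (\<lambda>x. \<bar>f x\<bar>))\<^sup>2 \<le> sexp n d \<theta> F (\<lambda>x. (f x)\<^sup>2)"
    by (simp add: sexp_def power_mult_distrib mult.assoc[symmetric] sum_sprob)
  then show ?thesis by (rule real_le_rsqrt)
qed

lemma prob_space_ising: "prob_space (ising d \<theta> ({1..d}, F))"
proof
  have "emeasure (ising d \<theta> ({1..d}, F)) (space (ising d \<theta> ({1..d}, F)))
      = (\<Sum>x\<in>spins d. ennreal (gibbs d \<theta> F x))"
    unfolding ising_def by (simp add: space_point_measure emeasure_point_measure_finite gibbs_def)
  also have "\<dots> = 1" by (simp add: sum_ennreal sum_gibbs)
  finally show "emeasure (ising d \<theta> ({1..d}, F)) (space (ising d \<theta> ({1..d}, F))) = 1" .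
qed

lemma space_ising_sample: "space (ising_sample n d \<theta> G) = samples n d"
  by (simp add: ising_sample_def space_PiM ising_def space_point_measure samples_def)

text \<open>The sample space is finite and every subset of it is measurable, so from here on all probabilities are finite
sums.\<close>

lemma emeasure_ising_sample:
  "emeasure (ising_sample n d \<theta> ({1..d}, F)) {x \<in> space (ising_sample n d \<theta> ({1..d}, F)). \<psi> x}
    = ennreal (\<Sum>X\<in>{X \<in> samples n d. \<psi> X}. sprob n d \<theta> F X)"
proof -
  let ?M = "\<lambda>_::nat. ising d \<theta> ({1..d}, F)"
  interpret prob_space "?M i" for i by (rule prob_space_ising)
  interpret product_sigma_finite ?M ..
  have single: "{X} = (\<Pi>\<^sub>E i\<in>{1..n}. {X i})" if "X \<in> samples n d" for X
    using that PiE_singleton[of X "{1..n}"] unfolding samples_def by (simp add: PiE_def)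
  have meas: "{x} \<in> sets (ising d \<theta> ({1..d}, F))" if "x \<in> spins d" for x
    using that by (simp add: ising_def sets_point_measure)
  have em: "emeasure (ising d \<theta> ({1..d}, F)) {x} = ennreal (gibbs d \<theta> F x)" if "x \<in> spins d" for x
    using that by (simp add: ising_def emeasure_point_measure_finite gibbs_def)
  have sets: "{X} \<in> sets (ising_sample n d \<theta> ({1..d}, F))" if "X \<in> samples n d" for X
    unfolding ising_sample_def
    by (subst single[OF that], rule sets_PiM_I_finite) (use meas sample_in_spins[OF that] in auto)
  have val: "emeasure (ising_sample n d \<theta> ({1..d}, F)) {X} = ennreal (sprob n d \<theta> F X)"
    if "X \<in> samples n d" for X
  proof -
    have "emeasure (ising_sample n d \<theta> ({1..d}, F)) (\<Pi>\<^sub>E i\<in>{1..n}. {X i}) = (\<Prod>i\<in>{1..n}. emeasure (?M i) {X i})"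
      unfolding ising_sample_def by (rule emeasure_PiM) (use meas sample_in_spins[OF that] in auto)
    also have "\<dots> = (\<Prod>i\<in>{1..n}. ennreal (gibbs d \<theta> F (X i)))"
      using em sample_in_spins[OF that] by (intro prod.cong) auto
    also have "\<dots> = ennreal (sprob n d \<theta> F X)" unfolding sprob_def by (simp add: prod_ennreal)
    finally show ?thesis using single[OF that] by simp
  qed
  let ?S = "{X \<in> samples n d. \<psi> X}"
  have "emeasure (ising_sample n d \<theta> ({1..d}, F)) ?S
     = (\<Sum>X\<in>?S. emeasure (ising_sample n d \<theta> ({1..d}, F)) {X})"
    by (rule emeasure_eq_sum_singleton) (use sets in auto)
  also have "\<dots> = (\<Sum>X\<in>?S. ennreal (sprob n d \<theta> F X))"
    using val by (intro sum.cong) auto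
  also have "\<dots> = ennreal (\<Sum>X\<in>?S. sprob n d \<theta> F X)" by (simp add: sum_ennreal)
  finally show ?thesis by (simp add: space_ising_sample)
qed

definition toggle :: "nat set set \<Rightarrow> nat set \<Rightarrow> nat set set" where
  "toggle F e = (if e \<in> F then F - {e} else insert e F)"

definition esign :: "nat set set \<Rightarrow> nat set \<Rightarrow> real" where
  "esign F e = (if e \<in> F then - 1 else 1)"

text \<open>The likelihood ratio, for one observation, of the graph with the edge toggled to the graph itself.\<close>

definition lr :: "nat \<Rightarrow> real \<Rightarrow> nat set set \<Rightarrow> nat set \<Rightarrow> (nat \<Rightarrow> real) \<Rightarrow> real" where
  "lr d \<theta> F e x = (1 + esign F e * tanh \<theta> * chi e x) / (1 + esign F e * tanh \<theta> * gexp d \<theta> F (chi e))"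

definition critical_edges :: "(ugraph \<Rightarrow> bool) \<Rightarrow> nat \<Rightarrow> nat set set \<Rightarrow> nat set set \<Rightarrow> bool" where
  "critical_edges P d F K \<longleftrightarrow> F \<subseteq> pairs {1..d} \<and> K \<subseteq> pairs {1..d} \<and>
     (\<forall>e\<in>K. P ({1..d}, toggle F e) \<noteq> P ({1..d}, F))"

lemma toggle_pairs: "F \<subseteq> pairs A \<Longrightarrow> e \<in> pairs A \<Longrightarrow> toggle F e \<subseteq> pairs A"
  unfolding toggle_def by auto

lemma gibbs_reweight:
  assumes "\<And>x. x \<in> spins d \<Longrightarrow> ising_weight \<theta> ({1..d}, B) x = ising_weight \<theta> ({1..d}, A) x * h x"
    and "x \<in> spins d"
  shows "gibbs d \<theta> B x = gibbs d \<theta> A x * (h x / gexp d \<theta> A h)"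
proof -
  let ?w = "\<lambda>F x. ising_weight \<theta> ({1..d}, F) x" and ?Z = "\<lambda>F. ising_Z d \<theta> ({1..d}, F)"
  have Z: "0 < ?Z A" "0 < ?Z B" by (rule ising_Z_pos)+
  have "?Z A * gexp d \<theta> A h = (\<Sum>x\<in>spins d. ?w A x * h x)"
    using Z unfolding gexp_def gibbs_def sum_distrib_left by (intro sum.cong) auto
  also have "\<dots> = ?Z B" unfolding ising_Z_def[of d \<theta> "({1..d}, B)"] using assms(1) by (intro sum.cong) auto
  finally have eq: "?Z B = ?Z A * gexp d \<theta> A h" ..
  have "gibbs d \<theta> A x * (h x / gexp d \<theta> A h) = ?w A x * h x / ?Z B"
    unfolding gibbs_def eq by simp
  then show ?thesis unfolding gibbs_def assms(1)[OF assms(2)] by (rule sym)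
qed

lemma gibbs_toggle:
  assumes F: "F \<subseteq> pairs {1..d}" and e: "e \<in> pairs {1..d}" and x: "x \<in> spins d"
  shows "gibbs d \<theta> (toggle F e) x = gibbs d \<theta> F x * lr d \<theta> F e x"
proof -
  have sub: "e \<subseteq> {1..d}" using e by (simp add: pairs_def)
  have fin: "finite F" using F finite_edge_set by blast
  let ?h = "\<lambda>x. cosh \<theta> * (1 + esign F e * tanh \<theta> * chi e x)"
  have hx: "exp (esign F e * \<theta> * chi e y) = ?h y" if "y \<in> spins d" for y
    using exp_edge[OF that sub, of "esign F e * \<theta>"] by (auto simp: esign_def)
  have "ising_weight \<theta> ({1..d}, toggle F e) y = ising_weight \<theta> ({1..d}, F) y * ?h y" if "y \<in> spins d" for y
    unfolding hx[OF that, symmetric] gibbs_weight exp_add[symmetric]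
    using fin by (auto simp: toggle_def esign_def sum_diff1 ring_distribs)
  then have "gibbs d \<theta> (toggle F e) x = gibbs d \<theta> F x * (?h x / gexp d \<theta> F ?h)"
    using x by (rule gibbs_reweight)
  then show ?thesis by (simp add: gexp_cmult gexp_add lr_def)
qed

text \<open>A test whose two errors add up to less than \<open>1 - \<delta>\<close> against each of the toggled graphs would also do so against
their uniform mixture; but the mixture differs from the law of \<open>F\<close> by at most the \<open>L\<^sup>1\<close>-distance \<open>\<delta>\<close>, and a test
cannot separate a law from itself. The two errors play symmetric roles, so \<open>F\<close> may lie on either side of the
property.\<close>

lemma testing_lower_bound:
  assumes crit: "critical_edges P d F K" and K: "finite K" "K \<noteq> {}"
  shows "ennreal (1 - sexp n d \<theta> F (\<lambda>X. \<bar>(\<Sum>e\<in>K. \<Prod>i\<in>{1..n}. lr d \<theta> F e (X i)) / card K - 1\<bar>))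
    \<le> minimax_risk n d P \<theta>"
  unfolding minimax_risk_def
proof (rule INF_greatest)
  fix \<psi>
  let ?L = "\<lambda>X. (\<Sum>e\<in>K. \<Prod>i\<in>{1..n}. lr d \<theta> F e (X i)) / card K"
  let ?\<delta> = "sexp n d \<theta> F (\<lambda>X. \<bar>?L X - 1\<bar>)"
  let ?p = "\<lambda>F X. sprob n d \<theta> F X"
  let ?pr = "\<lambda>F \<phi>. \<Sum>X\<in>{X \<in> samples n d. \<phi> X}. ?p F X"
  have FK: "F \<subseteq> pairs {1..d}" "K \<subseteq> pairs {1..d}" using crit by (auto simp: critical_edges_def)
  have on: "({1..d}, A) \<in> graphs_on d" if "A \<subseteq> pairs {1..d}" for A
    using that by (auto simp: graphs_on_def simple_graph_def pairs_def)
  have mix: "(\<Sum>e\<in>K. ?p (toggle F e) X) / card K = ?p F X * ?L X" if X: "X \<in> samples n d" for X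
  proof -
    have "?p (toggle F e) X = ?p F X * (\<Prod>i\<in>{1..n}. lr d \<theta> F e (X i))" if "e \<in> K" for e
      unfolding sprob_def prod.distrib[symmetric]
      using FK that sample_in_spins[OF X] by (intro prod.cong refl gibbs_toggle) auto
    then show ?thesis by (simp add: sum_distrib_left)
  qed
  \<comment> \<open>stated for an arbitrary test, since \<open>F\<close> may lie on either side of the property\<close>
  have key: "\<exists>e\<in>K. 1 - ?\<delta> \<le> ?pr F \<phi> + ?pr (toggle F e) (\<lambda>X. \<not> \<phi> X)" for \<phi>
  proof (rule ccontr)
    assume "\<not> ?thesis"
    then have less: "?pr F \<phi> + ?pr (toggle F e) (\<lambda>X. \<not> \<phi> X) < 1 - ?\<delta>" if "e \<in> K" for e
      using that by auto
    have "(\<Sum>e\<in>K. ?pr F \<phi> + ?pr (toggle F e) (\<lambda>X. \<not> \<phi> X)) < (\<Sum>e\<in>K. 1 - ?\<delta>)"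
      using K less by (intro sum_strict_mono) auto
    then have "card K * ?pr F \<phi> + (\<Sum>e\<in>K. ?pr (toggle F e) (\<lambda>X. \<not> \<phi> X)) < card K * (1 - ?\<delta>)"
      by (simp add: sum.distrib)
    then have "?pr F \<phi> + (\<Sum>e\<in>K. ?pr (toggle F e) (\<lambda>X. \<not> \<phi> X)) / card K < 1 - ?\<delta>"
      using K by (simp add: field_simps card_gt_0_iff)
    moreover have "(\<Sum>e\<in>K. ?pr (toggle F e) (\<lambda>X. \<not> \<phi> X)) / card K
       = (\<Sum>X\<in>{X \<in> samples n d. \<not> \<phi> X}. (\<Sum>e\<in>K. ?p (toggle F e) X) / card K)"
      by (subst sum.swap) (simp add: sum_divide_distrib)
    moreover have "\<dots> = (\<Sum>X\<in>{X \<in> samples n d. \<not> \<phi> X}. ?p F X * ?L X)"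
      using mix by (intro sum.cong) auto
    moreover have "(\<Sum>X\<in>{X \<in> samples n d. \<not> \<phi> X}. ?p F X * ?L X)
       \<ge> (\<Sum>X\<in>{X \<in> samples n d. \<not> \<phi> X}. ?p F X * (1 - \<bar>?L X - 1\<bar>))"
      by (intro sum_mono mult_left_mono) auto
    moreover have "(\<Sum>X\<in>{X \<in> samples n d. \<not> \<phi> X}. ?p F X * (1 - \<bar>?L X - 1\<bar>))
      = ?pr F (\<lambda>X. \<not> \<phi> X) - (\<Sum>X\<in>{X \<in> samples n d. \<not> \<phi> X}. ?p F X * \<bar>?L X - 1\<bar>)"
      by (simp add: right_diff_distrib sum_subtractf)
    moreover have "(\<Sum>X\<in>{X \<in> samples n d. \<not> \<phi> X}. ?p F X * \<bar>?L X - 1\<bar>) \<le> ?\<delta>"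
      unfolding sexp_def by (intro sum_mono2) auto
    moreover have "?pr F \<phi> + ?pr F (\<lambda>X. \<not> \<phi> X) = 1"
    proof -
      have "?pr F \<phi> + ?pr F (\<lambda>X. \<not> \<phi> X) = (\<Sum>X\<in>{X \<in> samples n d. \<phi> X} \<union> {X \<in> samples n d. \<not> \<phi> X}. ?p F X)"
        by (rule sum.union_disjoint[symmetric]) auto
      also have "{X \<in> samples n d. \<phi> X} \<union> {X \<in> samples n d. \<not> \<phi> X} = samples n d" by auto
      finally show ?thesis by (simp add: sum_sprob)
    qed
    ultimately show False by linarith
  qed
  have em: "emeasure (ising_sample n d \<theta> ({1..d}, A)) {x \<in> space (ising_sample n d \<theta> ({1..d}, A)). \<phi> x} = ennreal (?pr A \<phi>)" for A \<phi>
    by (rule emeasure_ising_sample)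
  have pr_nonneg: "0 \<le> ?pr A \<phi>" for A \<phi> by (intro sum_nonneg) auto
  let ?N = "SUP G\<in>null_graphs P d. emeasure (ising_sample n d \<theta> G) {x \<in> space (ising_sample n d \<theta> G). \<psi> x}"
  let ?A = "SUP G\<in>alt_graphs P d. emeasure (ising_sample n d \<theta> G) {x \<in> space (ising_sample n d \<theta> G). \<not> \<psi> x}"
  have null: "ennreal (?pr A \<psi>) \<le> ?N" if "A \<subseteq> pairs {1..d}" "\<not> P ({1..d}, A)" for A
    unfolding em[symmetric] using that on by (intro SUP_upper) (auto simp: null_graphs_def)
  have alt: "ennreal (?pr A (\<lambda>X. \<not> \<psi> X)) \<le> ?A" if "A \<subseteq> pairs {1..d}" "P ({1..d}, A)" for A
    unfolding em[symmetric] using that on by (intro SUP_upper) (auto simp: alt_graphs_def)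
  show "ennreal (1 - ?\<delta>) \<le> ?N + ?A"
  proof (cases "P ({1..d}, F)")
    case False
    obtain e where e: "e \<in> K" "1 - ?\<delta> \<le> ?pr F \<psi> + ?pr (toggle F e) (\<lambda>X. \<not> \<psi> X)"
      using key[of \<psi>] by blast
    have T: "P ({1..d}, toggle F e)" "toggle F e \<subseteq> pairs {1..d}"
      using crit e False FK toggle_pairs[of F _ e] by (auto simp: critical_edges_def)
    have "ennreal (1 - ?\<delta>) \<le> ennreal (?pr F \<psi>) + ennreal (?pr (toggle F e) (\<lambda>X. \<not> \<psi> X))"
      using e pr_nonneg by (simp flip: ennreal_plus add: ennreal_leI)
    also have "\<dots> \<le> ?N + ?A" using T FK False by (intro add_mono null alt)
    finally show ?thesis .
  next
    case True
    obtain e where e: "e \<in> K" "1 - ?\<delta> \<le> ?pr F (\<lambda>X. \<not> \<psi> X) + ?pr (toggle F e) (\<lambda>X. \<psi> X)"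
      using key[of "\<lambda>X. \<not> \<psi> X"] by auto
    have T: "\<not> P ({1..d}, toggle F e)" "toggle F e \<subseteq> pairs {1..d}"
      using crit e True FK toggle_pairs[of F _ e] by (auto simp: critical_edges_def)
    have "ennreal (1 - ?\<delta>) \<le> ennreal (?pr (toggle F e) \<psi>) + ennreal (?pr F (\<lambda>X. \<not> \<psi> X))"
      using e pr_nonneg by (simp flip: ennreal_plus add: ennreal_leI)
    also have "\<dots> \<le> ?N + ?A" using T FK True by (intro add_mono null alt)
    finally show ?thesis .
  qed
qed

lemma minimax_risk_le_1:
  assumes "null_graphs P d \<noteq> {}"
  shows "minimax_risk n d P \<theta> \<le> 1"
proof -
  have form: "\<exists>A. G = ({1..d}, A)" if "G \<in> graphs_on d" for G
    using that by (cases G) (auto simp: graphs_on_def)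
  have "minimax_risk n d P \<theta> \<le>
      (SUP G\<in>null_graphs P d. emeasure (ising_sample n d \<theta> G) {x \<in> space (ising_sample n d \<theta> G). True}) +
      (SUP G\<in>alt_graphs P d. emeasure (ising_sample n d \<theta> G) {x \<in> space (ising_sample n d \<theta> G). \<not> True})"
    unfolding minimax_risk_def by (rule INF_lower) (simp add: tests_def)
  also have "(SUP G\<in>alt_graphs P d. emeasure (ising_sample n d \<theta> G) {x \<in> space (ising_sample n d \<theta> G). \<not> True}) \<le> 0"
    by (rule SUP_least) simp
  also have "(SUP G\<in>null_graphs P d. emeasure (ising_sample n d \<theta> G) {x \<in> space (ising_sample n d \<theta> G). True}) \<le> 1"
  proof (rule SUP_least)
    fix G assume "G \<in> null_graphs P d"
    then have "G \<in> graphs_on d" by (simp add: null_graphs_def)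
    from form[OF this] obtain A where G: "G = ({1..d}, A)" ..
    show "emeasure (ising_sample n d \<theta> G) {x \<in> space (ising_sample n d \<theta> G). True} \<le> 1"
      unfolding G emeasure_ising_sample by (simp add: sum_sprob)
  qed
  finally show ?thesis by (simp add: add_mono)
qed

lemma lr_bounds:
  assumes F: "F \<subseteq> pairs {1..d}" and e: "e \<in> pairs {1..d}" and \<theta>: "0 \<le> \<theta>"
  shows "1 - tanh \<theta> \<le> 1 + esign F e * tanh \<theta> * gexp d \<theta> F (chi e)"
    and "0 \<le> gexp d \<theta> F (chi e)" "gexp d \<theta> F (chi e) \<le> 1"
    and "x \<in> spins d \<Longrightarrow> 0 < lr d \<theta> F e x"
proof -
  have sub: "e \<subseteq> {1..d}" using e by (simp add: pairs_def)
  show r0: "0 \<le> gexp d \<theta> F (chi e)" by (rule griffiths_first[OF F \<theta> sub])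
  have "\<bar>gexp d \<theta> F (chi e)\<bar> \<le> 1" using chi_abs[OF _ sub] by (intro gexp_abs_le1) auto
  then show r1: "gexp d \<theta> F (chi e) \<le> 1" by simp
  have t: "0 \<le> tanh \<theta>" "tanh \<theta> < 1" using \<theta> tanh_real_lt_1[of \<theta>] by auto
  show den: "1 - tanh \<theta> \<le> 1 + esign F e * tanh \<theta> * gexp d \<theta> F (chi e)"
    using mult_left_mono[OF r1 t(1)] mult_nonneg_nonneg[OF t(1) r0] t by (auto simp: esign_def)
  assume x: "x \<in> spins d"
  have "0 < 1 + esign F e * tanh \<theta> * chi e x"
    using chi_value[OF x sub] t less_le_trans[of "-1" 0 "tanh \<theta>"] by (auto simp: esign_def)
  then show "0 < lr d \<theta> F e x" unfolding lr_def using den t by (intro divide_pos_pos) auto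
qed

lemma gexp_lr:
  assumes F: "F \<subseteq> pairs {1..d}" and e: "e \<in> pairs {1..d}" and \<theta>: "0 \<le> \<theta>"
  shows "gexp d \<theta> F (lr d \<theta> F e) = 1"
proof -
  have "0 < 1 + esign F e * tanh \<theta> * gexp d \<theta> F (chi e)"
    using lr_bounds(1)[OF assms] tanh_real_lt_1[of \<theta>] by linarith
  moreover have "gexp d \<theta> F (\<lambda>x. 1 + esign F e * tanh \<theta> * chi e x)
      = 1 + esign F e * tanh \<theta> * gexp d \<theta> F (chi e)"
    by (simp add: gexp_add gexp_cmult)
  ultimately show ?thesis unfolding lr_def by (simp add: gexp_divide)
qed

lemma gexp_lr_lr:
  assumes F: "F \<subseteq> pairs {1..d}" and e: "e \<in> pairs {1..d}" and f: "f \<in> pairs {1..d}" and \<theta>: "0 \<le> \<theta>"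
  shows "gexp d \<theta> F (\<lambda>x. lr d \<theta> F e x * lr d \<theta> F f x) = 1 + esign F e * esign F f * (tanh \<theta>)\<^sup>2 *
     (gexp d \<theta> F (\<lambda>x. chi e x * chi f x) - gexp d \<theta> F (chi e) * gexp d \<theta> F (chi f)) /
     ((1 + esign F e * tanh \<theta> * gexp d \<theta> F (chi e)) * (1 + esign F f * tanh \<theta> * gexp d \<theta> F (chi f)))"
proof -
  let ?a = "esign F e * tanh \<theta>" and ?b = "esign F f * tanh \<theta>"
  let ?r = "gexp d \<theta> F (chi e)" and ?s = "gexp d \<theta> F (chi f)"
  let ?c = "gexp d \<theta> F (\<lambda>x. chi e x * chi f x)"
  have pos: "0 < 1 + ?a * ?r" "0 < 1 + ?b * ?s"
    using lr_bounds(1)[OF F e \<theta>] lr_bounds(1)[OF F f \<theta>] tanh_real_lt_1[of \<theta>] by linarith+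
  have "gexp d \<theta> F (\<lambda>x. lr d \<theta> F e x * lr d \<theta> F f x)
     = gexp d \<theta> F (\<lambda>x. (1 + ?a * chi e x + ?b * chi f x + ?a * ?b * (chi e x * chi f x)) / ((1 + ?a * ?r) * (1 + ?b * ?s)))"
    by (rule gexp_cong) (simp add: lr_def algebra_simps)
  also have "\<dots> = (1 + ?a * ?r + ?b * ?s + ?a * ?b * ?c) / ((1 + ?a * ?r) * (1 + ?b * ?s))"
    unfolding gexp_divide gexp_add gexp_cmult gexp_const ..
  also have "\<dots> = 1 + ?a * ?b * (?c - ?r * ?s) / ((1 + ?a * ?r) * (1 + ?b * ?s))"
  proof -
    have "1 + ?a * ?r + ?b * ?s + ?a * ?b * ?c = (1 + ?a * ?r) * (1 + ?b * ?s) + ?a * ?b * (?c - ?r * ?s)"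
      by (simp add: algebra_simps)
    then show ?thesis using pos by (simp add: add_divide_distrib)
  qed
  finally show ?thesis by (simp add: power2_eq_square mult_ac)
qed

section \<open>Monotone properties and many disjoint blocks\<close>

lemma property_edges_mono:
  assumes "strongly_monotone P" "A \<subseteq> B" "B \<subseteq> pairs {1..d}" "P ({1..d}, A)"
  shows "P ({1..d}, B)"
proof -
  have "simple_graph ({1..d}, A)" "simple_graph ({1..d}, B)" "subgraph ({1..d}, A) ({1..d}, B)"
    using assms by (auto simp: simple_graph_def pairs_def subgraph_def)
  then show ?thesis using assms(1,4) unfolding strongly_monotone_def by (metis le_boolD)
qed

lemma property_relabel:
  assumes "graph_property P" and \<pi>: "bij_betw \<pi> {1..d} {1..d}" and F: "F \<subseteq> pairs {1..d}"
  shows "P ({1..d}, (`) \<pi> ` F) = P ({1..d}, F)"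
proof -
  have "simple_graph ({1..d}, F)" "inj_on \<pi> (verts ({1..d}, F))"
    using F \<pi> by (auto simp: simple_graph_def pairs_def bij_betw_def)
  moreover have "relabel \<pi> ({1..d}, F) = ({1..d}, (`) \<pi> ` F)"
    using \<pi> by (simp add: relabel_def bij_betw_def)
  ultimately show ?thesis using assms(1) unfolding graph_property_def by metis
qed

lemma pairs_image:
  assumes "inj_on \<pi> A"
  shows "(`) \<pi> ` pairs A = pairs (\<pi> ` A)"
proof
  show "(`) \<pi> ` pairs A \<subseteq> pairs (\<pi> ` A)"
    using assms by (auto simp: pairs_def card_image inj_on_subset)
  show "pairs (\<pi> ` A) \<subseteq> (`) \<pi> ` pairs A"
  proof
    fix e assume e: "e \<in> pairs (\<pi> ` A)"
    then obtain B where B: "B \<subseteq> A" "e = \<pi> ` B" by (auto simp: pairs_def subset_image_iff)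
    then have "card B = 2" using e card_image[of \<pi> B] inj_on_subset[OF assms] by (auto simp: pairs_def)
    then show "e \<in> (`) \<pi> ` pairs A" using B by (auto simp: pairs_def)
  qed
qed

text \<open>A bijection from \<open>A\<close> onto a subset of \<open>B\<close> extends to a permutation of all vertices; monotonicity does the rest.\<close>

lemma complete_property_transfer:
  assumes P: "graph_property P" "strongly_monotone P"
    and A: "A \<subseteq> {1..d}" "P ({1..d}, pairs A)" and B: "B \<subseteq> {1..d}" "card A \<le> card B"
  shows "P ({1..d}, pairs B)"
proof -
  obtain B' where B': "B' \<subseteq> B" "card B' = card A" using B obtain_subset_with_card_n by metis
  have fin: "finite A" "finite B'"
    using finite_subset[OF A(1)] finite_subset[OF order_trans[OF B'(1) B(1)]] by auto
  obtain f where f: "bij_betw f A B'" using fin B' finite_same_card_bij by metis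
  have "card ({1..d} - A) = card ({1..d} - B')"
    using card_Diff_subset[OF fin(1) A(1)] card_Diff_subset[OF fin(2) order_trans[OF B'(1) B(1)]] B'(2) by simp
  then obtain g where g: "bij_betw g ({1..d} - A) ({1..d} - B')"
    using finite_same_card_bij[of "{1..d} - A" "{1..d} - B'"] by auto
  define \<pi> where "\<pi> v = (if v \<in> A then f v else g v)" for v
  have "bij_betw \<pi> A B'" using f by (simp add: \<pi>_def cong: bij_betw_cong)
  moreover have "bij_betw \<pi> ({1..d} - A) ({1..d} - B')"
    using g by (subst bij_betw_cong[of _ \<pi> g]) (auto simp: \<pi>_def)
  ultimately have "bij_betw \<pi> (A \<union> ({1..d} - A)) (B' \<union> ({1..d} - B'))"
    by (rule bij_betw_combine) auto
  moreover have "A \<union> ({1..d} - A) = {1..d}" "B' \<union> ({1..d} - B') = {1..d}" using A B B' by auto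
  ultimately have \<pi>: "bij_betw \<pi> {1..d} {1..d}" by simp
  have "(`) \<pi> ` pairs A = pairs B'"
    using \<open>bij_betw \<pi> A B'\<close> pairs_image[of \<pi> A] by (simp add: bij_betw_def)
  then have "P ({1..d}, pairs B')"
    using property_relabel[OF P(1) \<pi> pairs_mono[OF A(1)]] A(2) by simp
  then show ?thesis
    using property_edges_mono[OF P(2) pairs_mono[OF B'(1)] pairs_mono[OF B(1)]] by simp
qed

lemma empty_graph_null:
  assumes "strongly_monotone P" "null_graphs P d \<noteq> {}"
  shows "\<not> P ({1..d}, {})"
proof
  assume P: "P ({1..d}, {})"
  obtain G where G: "G \<in> null_graphs P d" using assms(2) by blast
  then have "verts G = {1..d}" "edges G \<subseteq> pairs {1..d}" "\<not> P G"
    by (auto simp: null_graphs_def graphs_on_def simple_graph_def pairs_def)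
  then show False
    using property_edges_mono[OF assms(1) _ _ P, of "edges G"] by (metis empty_subsetI prod.collapse)
qed

text \<open>Functions of disjoint parts of a graph are independent. In two independent copies of the sample, exchange the
spins of \<open>B\<close>: the joint probability does not change, because no edge joins \<open>B\<close> to its complement.\<close>

lemma sexp_block_independent:
  assumes F: "F \<subseteq> pairs B \<union> pairs ({1..d} - B)" and B: "B \<subseteq> {1..d}"
    and f: "\<And>X Y. X \<in> samples n d \<Longrightarrow> Y \<in> samples n d \<Longrightarrow>
        (\<And>i v. i \<in> {1..n} \<Longrightarrow> v \<in> B \<Longrightarrow> X i v = Y i v) \<Longrightarrow> f X = f Y"
    and g: "\<And>X Y. X \<in> samples n d \<Longrightarrow> Y \<in> samples n d \<Longrightarrow>
        (\<And>i v. i \<in> {1..n} \<Longrightarrow> v \<in> {1..d} - B \<Longrightarrow> X i v = Y i v) \<Longrightarrow> g X = g Y"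
  shows "sexp n d \<theta> F (\<lambda>X. f X * g X) = sexp n d \<theta> F f * sexp n d \<theta> F g"
proof -
  let ?S = "samples n d" and ?p = "sprob n d \<theta> F"
  define sw where "sw X Y = (\<lambda>i\<in>{1..n}. \<lambda>v. if v \<in> B then Y i v else X i v)"
    for X Y :: "nat \<Rightarrow> nat \<Rightarrow> real"
  have sw1: "(\<lambda>v. if v \<in> B then y v else x v) \<in> spins d" if "x \<in> spins d" "y \<in> spins d"
    for x y :: "nat \<Rightarrow> real"
    using that B unfolding spins_def by (auto simp: PiE_iff extensional_def)
  have swS: "sw X Y \<in> ?S" if "X \<in> ?S" "Y \<in> ?S" for X Y
    using that sw1 unfolding samples_def sw_def by (auto simp: PiE_iff)
  have swsw: "sw (sw X Y) (sw Y X) = X" if "X \<in> ?S" "Y \<in> ?S" for X Y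
    using that unfolding samples_def sw_def by (auto simp: PiE_iff extensional_def fun_eq_iff)
  have w: "gibbs d \<theta> F (\<lambda>v. if v \<in> B then y v else x v) * gibbs d \<theta> F (\<lambda>v. if v \<in> B then x v else y v)
      = gibbs d \<theta> F x * gibbs d \<theta> F y" for x y
  proof -
    let ?x = "\<lambda>v. if v \<in> B then y v else x v" and ?y = "\<lambda>v. if v \<in> B then x v else y v"
    have "chi e ?x + chi e ?y = chi e x + chi e y" if "e \<in> F" for e
    proof (cases "e \<subseteq> B")
      case True
      then have "chi e ?x = chi e y" "chi e ?y = chi e x" by (auto intro!: prod.cong)
      then show ?thesis by simp
    next
      case False
      then have "e \<subseteq> {1..d} - B" using F that by (auto simp: pairs_def)
      then have "chi e ?x = chi e x" "chi e ?y = chi e y" by (auto intro!: prod.cong)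
      then show ?thesis by simp
    qed
    then have "(\<Sum>e\<in>F. chi e ?x) + (\<Sum>e\<in>F. chi e ?y) = (\<Sum>e\<in>F. chi e x) + (\<Sum>e\<in>F. chi e y)"
      unfolding sum.distrib[symmetric] by (intro sum.cong) auto
    then have "ising_weight \<theta> ({1..d}, F) ?x * ising_weight \<theta> ({1..d}, F) ?y
       = ising_weight \<theta> ({1..d}, F) x * ising_weight \<theta> ({1..d}, F) y"
      unfolding gibbs_weight exp_add[symmetric] ring_distribs(1)[symmetric] by simp
    then show ?thesis by (simp add: gibbs_def)
  qed
  have pp: "?p (sw X Y) * ?p (sw Y X) = ?p X * ?p Y" for X Y
    unfolding sprob_def prod.distrib[symmetric] by (intro prod.cong refl) (simp add: sw_def w)
  have fsw: "f (sw X Y) = f Y" if "X \<in> ?S" "Y \<in> ?S" for X Y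
    using that by (intro f swS) (auto simp: sw_def)
  have gsw: "g (sw X Y) = g X" if "X \<in> ?S" "Y \<in> ?S" for X Y
    using that by (intro g swS) (auto simp: sw_def)
  have "sexp n d \<theta> F (\<lambda>X. f X * g X) = (\<Sum>X\<in>?S. ?p X * (f X * g X)) * (\<Sum>Y\<in>?S. ?p Y)"
    by (simp add: sexp_def sum_sprob)
  also have "\<dots> = (\<Sum>(X, Y)\<in>?S \<times> ?S. ?p X * ?p Y * (f X * g X))"
    unfolding sum_product sum.cartesian_product by (simp add: mult_ac)
  also have "\<dots> = (\<Sum>(X, Y)\<in>?S \<times> ?S. ?p X * ?p Y * (f Y * g X))"
    by (rule sum.reindex_bij_witness[of _ "\<lambda>(X, Y). (sw X Y, sw Y X)" "\<lambda>(X, Y). (sw X Y, sw Y X)"])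
       (auto simp: swS swsw pp fsw gsw)
  also have "\<dots> = sexp n d \<theta> F g * sexp n d \<theta> F f"
    unfolding sexp_def sum_product by (simp add: sum.cartesian_product mult_ac)
  finally show ?thesis by (simp only: mult.commute)
qed

text \<open>A weak law of large numbers under a bound on the moment of order \<open>3/2\<close>. Truncation at level \<open>N\<close> costs at most
\<open>N powr (48/100) / sqrt N\<close> in mean, and a truncated term has second moment at most
\<open>sqrt N * N powr (48/100)\<close>, which is less than \<open>N\<close>. An exponent below \<open>1/2\<close> in the moment bound is what makes both
errors vanish.\<close>

lemma truncated_average:
  fixes L :: "'i \<Rightarrow> (nat \<Rightarrow> nat \<Rightarrow> real) \<Rightarrow> real"
  assumes J: "finite J" and N: "N = real (card J)" "1 \<le> N"
    and L0: "\<And>j X. j \<in> J \<Longrightarrow> X \<in> samples n d \<Longrightarrow> 0 \<le> L j X"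
    and L1: "\<And>j. j \<in> J \<Longrightarrow> sexp n d \<theta> F (L j) = 1"
    and L32: "\<And>j. j \<in> J \<Longrightarrow> sexp n d \<theta> F (\<lambda>X. L j X * sqrt (L j X)) \<le> N powr (48/100)"
    and ind: "\<And>i j h. i \<in> J \<Longrightarrow> j \<in> J \<Longrightarrow> i \<noteq> j \<Longrightarrow>
       sexp n d \<theta> F (\<lambda>X. h (L i X) * h (L j X)) = sexp n d \<theta> F (\<lambda>X. h (L i X)) * sexp n d \<theta> F (\<lambda>X. h (L j X))"
  shows "sexp n d \<theta> F (\<lambda>X. \<bar>(\<Sum>j\<in>J. L j X) / card J - 1\<bar>) \<le> 3 * N powr (- 1/100)"
proof -
  let ?E = "sexp n d \<theta> F"
  define h where "h l = (if l \<le> N then l else 0)" for l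
  define Y where "Y j X = h (L j X)" for j X
  define W where "W j X = L j X - Y j X" for j X
  have Yfun: "Y j = (\<lambda>X. h (L j X))" for j by (simp add: Y_def fun_eq_iff)
  have N0: "0 < N" using N by simp
  have sqrtN: "sqrt N = N powr (1/2)" using N0 by (simp add: powr_half_sqrt)
  have W0: "0 \<le> W j X" if "j \<in> J" "X \<in> samples n d" for j X
    using L0[OF that] by (simp add: W_def Y_def h_def)
  have EW: "?E (W j) \<le> N powr (- 2/100)" if j: "j \<in> J" for j
  proof -
    have "?E (W j) \<le> ?E (\<lambda>X. (L j X * sqrt (L j X)) / sqrt N)"
    proof (rule sexp_mono)
      fix X assume X: "X \<in> samples n d"
      show "W j X \<le> L j X * sqrt (L j X) / sqrt N"
      proof (cases "L j X \<le> N")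
        case True
        then show ?thesis using L0[OF j X] N0 by (simp add: W_def Y_def h_def)
      next
        case False
        then have "L j X * sqrt N \<le> L j X * sqrt (L j X)" using L0[OF j X] by (intro mult_left_mono) auto
        then show ?thesis using False N0 by (simp add: W_def Y_def h_def pos_le_divide_eq)
      qed
    qed
    also have "\<dots> = ?E (\<lambda>X. L j X * sqrt (L j X)) / sqrt N" by (rule sexp_divide)
    also have "\<dots> \<le> N powr (48/100) / N powr (1/2)"
      unfolding sqrtN using L32[OF j] N0 by (intro divide_right_mono) auto
    also have "\<dots> = N powr (- 2/100)" using N0 by (simp flip: powr_diff)
    finally show ?thesis .
  qed
  have EY2: "?E (\<lambda>X. Y j X * Y j X) \<le> N powr (98/100)" if j: "j \<in> J" for j
  proof -
    have "?E (\<lambda>X. Y j X * Y j X) \<le> ?E (\<lambda>X. sqrt N * (L j X * sqrt (L j X)))"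
    proof (rule sexp_mono)
      fix X assume X: "X \<in> samples n d"
      show "Y j X * Y j X \<le> sqrt N * (L j X * sqrt (L j X))"
      proof (cases "L j X \<le> N")
        case True
        have "L j X * (sqrt (L j X) * sqrt (L j X)) \<le> L j X * (sqrt (L j X) * sqrt N)"
          using True L0[OF j X] by (intro mult_left_mono) auto
        then show ?thesis using True L0[OF j X] by (simp add: Y_def h_def mult_ac)
      next
        case False
        then show ?thesis using L0[OF j X] N0 by (simp add: Y_def h_def)
      qed
    qed
    also have "\<dots> = sqrt N * ?E (\<lambda>X. L j X * sqrt (L j X))" by (rule sexp_cmult)
    also have "\<dots> \<le> N powr (1/2) * N powr (48/100)"
      unfolding sqrtN using L32[OF j] by (intro mult_left_mono) auto
    also have "\<dots> = N powr (98/100)" by (simp flip: powr_add)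
    finally show ?thesis .
  qed
  let ?V = "\<lambda>X. (\<Sum>j\<in>J. Y j X - ?E (Y j)) / N"
  have "?E (\<lambda>X. (?V X)\<^sup>2) = (\<Sum>i\<in>J. \<Sum>j\<in>J. ?E (\<lambda>X. (Y i X - ?E (Y i)) * (Y j X - ?E (Y j)))) / N\<^sup>2"
    by (simp add: power_divide sexp_divide power2_eq_square sum_product sexp_sum)
  also have "(\<Sum>i\<in>J. \<Sum>j\<in>J. ?E (\<lambda>X. (Y i X - ?E (Y i)) * (Y j X - ?E (Y j))))
     = (\<Sum>i\<in>J. \<Sum>j\<in>J. if i = j then ?E (\<lambda>X. Y i X * Y i X) - (?E (Y i))\<^sup>2 else 0)"
  proof (intro sum.cong refl)
    fix i j assume ij: "i \<in> J" "j \<in> J"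
    have "?E (\<lambda>X. (Y i X - ?E (Y i)) * (Y j X - ?E (Y j)))
      = ?E (\<lambda>X. (Y i X * Y j X + ?E (Y i) * ?E (Y j)) - (?E (Y j) * Y i X + ?E (Y i) * Y j X))"
      by (rule sexp_cong) (simp add: algebra_simps)
    also have "\<dots> = ?E (\<lambda>X. Y i X * Y j X) - ?E (Y i) * ?E (Y j)"
      by (simp add: sexp_diff sexp_add sexp_cmult)
    finally show "?E (\<lambda>X. (Y i X - ?E (Y i)) * (Y j X - ?E (Y j)))
       = (if i = j then ?E (\<lambda>X. Y i X * Y i X) - (?E (Y i))\<^sup>2 else 0)"
      using ind[OF ij, of h] by (auto simp: Yfun power2_eq_square)
  qed
  also have "\<dots> = (\<Sum>i\<in>J. ?E (\<lambda>X. Y i X * Y i X) - (?E (Y i))\<^sup>2)"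
    using J by (simp add: sum.delta)
  also have "\<dots> / N\<^sup>2 \<le> (\<Sum>i\<in>J. N powr (98/100)) / N\<^sup>2"
  proof (intro divide_right_mono sum_mono)
    fix i assume "i \<in> J"
    from EY2[OF this] show "?E (\<lambda>X. Y i X * Y i X) - (?E (Y i))\<^sup>2 \<le> N powr (98/100)"
      by (smt (verit) zero_le_power2)
  qed simp
  also have "\<dots> = N powr (- 2/100)"
  proof -
    have "N powr (98/100) = N powr (-2/100) * N"
      using N0 powr_add[of N "-2/100" 1] by simp
    then show ?thesis using N0 by (simp add: N(1)[symmetric] power2_eq_square)
  qed
  finally have V2: "?E (\<lambda>X. (?V X)\<^sup>2) \<le> N powr (- 2/100)" .
  have "sqrt (N powr (- 2/100)) = N powr (-1/100)"
    using N0 by (simp add: powr_half_sqrt[symmetric] powr_powr)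
  then have V: "?E (\<lambda>X. \<bar>?V X\<bar>) \<le> N powr (-1/100)"
    using sexp_abs_le_sqrt[of n d \<theta> F ?V] real_sqrt_le_mono[OF V2] by linarith
  have EYW: "?E (Y j) = 1 - ?E (W j)" if "j \<in> J" for j
  proof -
    have "?E (W j) = ?E (L j) - ?E (Y j)" unfolding W_def by (rule sexp_diff)
    then show ?thesis using L1[OF that] by simp
  qed
  have avgW: "(\<Sum>j\<in>J. ?E (W j)) / N \<le> N powr (- 2/100)"
  proof -
    have "(\<Sum>j\<in>J. ?E (W j)) / N \<le> (\<Sum>j\<in>J. N powr (- 2/100)) / N"
      using EW N0 by (intro divide_right_mono sum_mono) auto
    then show ?thesis using N0 by (simp add: N(1)[symmetric])
  qed
  have avgW0: "0 \<le> (\<Sum>j\<in>J. ?E (W j)) / N"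
    using W0 N0 by (intro divide_nonneg_pos sum_nonneg sexp_nonneg) auto
  have split: "(\<Sum>j\<in>J. L j X) / card J - 1 = (\<Sum>j\<in>J. W j X) / N + ?V X - (\<Sum>j\<in>J. ?E (W j)) / N" for X
  proof -
    have "(\<Sum>j\<in>J. L j X) = (\<Sum>j\<in>J. W j X) + (\<Sum>j\<in>J. Y j X)"
      by (simp add: W_def sum_subtractf)
    moreover have "(\<Sum>j\<in>J. ?E (Y j)) = N - (\<Sum>j\<in>J. ?E (W j))"
      by (simp add: EYW sum_subtractf N(1))
    ultimately show ?thesis
      using N0 unfolding N(1)[symmetric] by (simp add: sum_subtractf add_divide_distrib diff_divide_distrib)
  qed
  have "?E (\<lambda>X. \<bar>(\<Sum>j\<in>J. L j X) / card J - 1\<bar>)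
     \<le> ?E (\<lambda>X. ((\<Sum>j\<in>J. W j X) / N + \<bar>?V X\<bar>) + (\<Sum>j\<in>J. ?E (W j)) / N)"
  proof (rule sexp_mono)
    fix X assume X: "X \<in> samples n d"
    have "0 \<le> (\<Sum>j\<in>J. W j X) / N" using W0 X N0 by (intro divide_nonneg_pos sum_nonneg) auto
    then show "\<bar>(\<Sum>j\<in>J. L j X) / card J - 1\<bar>
      \<le> ((\<Sum>j\<in>J. W j X) / N + \<bar>?V X\<bar>) + (\<Sum>j\<in>J. ?E (W j)) / N"
      unfolding split using avgW0 by linarith
  qed
  also have "\<dots> = (\<Sum>j\<in>J. ?E (W j)) / N + ?E (\<lambda>X. \<bar>?V X\<bar>) + (\<Sum>j\<in>J. ?E (W j)) / N"
    unfolding sexp_add by (simp add: sexp_divide sexp_sum)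
  also have "\<dots> \<le> 2 * N powr (- 2/100) + N powr (-1/100)"
    using avgW V by linarith
  also have "N powr (- 2/100) \<le> N powr (-1/100)" using N(2) by (intro powr_mono) auto
  finally show ?thesis by simp
qed

text \<open>With \<open>w = sqrt l\<close> the difference of the two sides is \<open>(w - 1)\<^sup>2\<close> times \<open>a * (w + 1)\<^sup>2 - (w + 1/2)\<close>, where \<open>a\<close> is the
coefficient of the quadratic term. The second factor is nonnegative for \<open>a = 1/2\<close>, and for \<open>a = 4/9\<close> as soon as
\<open>w \<ge> 1/2\<close>.\<close>

lemma three_halves_power_bound:
  fixes l :: real
  assumes "0 \<le> l"
  shows "l * sqrt l \<le> 1 + 3/2 * (l - 1) + 1/2 * (l - 1)\<^sup>2"
    and "1/4 \<le> l \<Longrightarrow> l * sqrt l \<le> 1 + 3/2 * (l - 1) + 4/9 * (l - 1)\<^sup>2"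
proof -
  define w where "w = sqrt l"
  have w: "0 \<le> w" "l = w\<^sup>2" using assms by (simp_all add: w_def)
  have id: "1 + 3/2 * (l - 1) + a * (l - 1)\<^sup>2 - l * sqrt l = (w - 1)\<^sup>2 * (a * (w + 1)\<^sup>2 - (w + 1/2))" for a
    using w unfolding w_def[symmetric] by (simp add: power2_eq_square field_simps)
  have "0 \<le> (w - 1)\<^sup>2 * (1/2 * (w + 1)\<^sup>2 - (w + 1/2))"
  proof (rule mult_nonneg_nonneg)
    have "1/2 * (w + 1)\<^sup>2 - (w + 1/2) = w\<^sup>2 / 2" by (simp add: power2_eq_square field_simps)
    then show "0 \<le> 1/2 * (w + 1)\<^sup>2 - (w + 1/2)" using zero_le_power2[of w] by linarith
  qed simp
  then show "l * sqrt l \<le> 1 + 3/2 * (l - 1) + 1/2 * (l - 1)\<^sup>2" using id[of "1/2"] by linarith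
  assume "1/4 \<le> l"
  then have "sqrt (1/4) \<le> w" unfolding w_def by (rule real_sqrt_le_mono)
  then have "1/2 \<le> w" by (simp add: real_sqrt_divide)
  then have "0 \<le> (2 * w - 1) * (2 * w + 1/2)" by simp
  then have "0 \<le> 4/9 * (w + 1)\<^sup>2 - (w + 1/2)" by (simp add: power2_eq_square algebra_simps)
  then have "0 \<le> (w - 1)\<^sup>2 * (4/9 * (w + 1)\<^sup>2 - (w + 1/2))" by simp
  then show "l * sqrt l \<le> 1 + 3/2 * (l - 1) + 4/9 * (l - 1)\<^sup>2" using id[of "4/9"] by linarith
qed

text \<open>The variance of the likelihood ratio is at most \<open>t\<^sup>2\<close> with \<open>t = tanh \<theta>\<close>, because the mean of the edge is nonnegative
(first Griffiths inequality) and the edge is added rather than removed. If \<open>t \<le> 1/2\<close>, the ratio is bounded away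
from 0 and the coefficient \<open>4/9 < 48/100\<close> is available. Otherwise the coefficient is only \<open>1/2\<close>, but then \<open>t\<^sup>2\<close> is
so large that \<open>1 + t\<^sup>2 / 2\<close> falls below the quadratic Taylor polynomial of the exponential.\<close>

lemma lr_three_halves_moment:
  assumes F: "F \<subseteq> pairs {1..d}" and e: "e \<in> pairs {1..d}" "e \<notin> F" and \<theta>: "0 \<le> \<theta>"
  shows "gexp d \<theta> F (\<lambda>x. lr d \<theta> F e x * sqrt (lr d \<theta> F e x)) \<le> exp (48/100 * (tanh \<theta>)\<^sup>2)"
proof -
  let ?l = "lr d \<theta> F e" and ?t = "tanh \<theta>" and ?r = "gexp d \<theta> F (chi e)" and ?E = "gexp d \<theta> F"
  have sub: "e \<subseteq> {1..d}" using e by (simp add: pairs_def)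
  have t: "0 \<le> ?t" "?t < 1" using \<theta> tanh_real_lt_1 by auto
  have r: "0 \<le> ?r" "?r \<le> 1" by (rule lr_bounds[OF F e(1) \<theta>])+
  have l0: "0 \<le> ?l x" if "x \<in> spins d" for x using lr_bounds(4)[OF F e(1) \<theta> that] by simp
  have tr: "0 \<le> ?t * ?r" using t r by simp
  have sq: "?E (\<lambda>x. (?l x - 1)\<^sup>2) \<le> ?t\<^sup>2"
  proof -
    have "?E (\<lambda>x. (?l x - 1)\<^sup>2) = ?E (\<lambda>x. (?l x * ?l x + 1) - 2 * ?l x)"
      by (rule gexp_cong) (simp add: power2_eq_square algebra_simps)
    also have "\<dots> = ?E (\<lambda>x. ?l x * ?l x) - 1"
      by (simp add: gexp_diff gexp_add gexp_cmult gexp_lr[OF F e(1) \<theta>])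
    also have "?E (\<lambda>x. ?l x * ?l x) = 1 + ?t\<^sup>2 * (1 - ?r * ?r) / ((1 + ?t * ?r) * (1 + ?t * ?r))"
    proof -
      have "?E (\<lambda>x. chi e x * chi e x) = ?E (\<lambda>x. 1)" by (rule gexp_cong) (rule chi_sq[OF _ sub])
      then show ?thesis using gexp_lr_lr[OF F e(1) e(1) \<theta>] e(2) by (simp add: esign_def)
    qed
    also have "?t\<^sup>2 * (1 - ?r * ?r) / ((1 + ?t * ?r) * (1 + ?t * ?r)) \<le> ?t\<^sup>2 * 1 / 1"
    proof (rule frac_le)
      show "?t\<^sup>2 * (1 - ?r * ?r) \<le> ?t\<^sup>2 * 1" using r by (intro mult_left_mono) auto
      show "1 \<le> (1 + ?t * ?r) * (1 + ?t * ?r)" using mult_mono[of 1 "1 + ?t * ?r" 1 "1 + ?t * ?r"] tr by simp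
    qed auto
    finally show ?thesis by simp
  qed
  have lin: "?E (\<lambda>x. 1 + b * (?l x - 1) + a * (?l x - 1)\<^sup>2) = 1 + a * ?E (\<lambda>x. (?l x - 1)\<^sup>2)" for a b
    by (simp add: gexp_add gexp_cmult gexp_diff gexp_lr[OF F e(1) \<theta>])
  show ?thesis
  proof (cases "?t \<le> 1/2")
    case True
    have "?E (\<lambda>x. ?l x * sqrt (?l x)) \<le> ?E (\<lambda>x. 1 + 3/2 * (?l x - 1) + 4/9 * (?l x - 1)\<^sup>2)"
    proof (rule gexp_mono)
      fix x assume x: "x \<in> spins d"
      have "?t * ?r \<le> 1/2 * 1" using True t r by (intro mult_mono) auto
      moreover have "1/2 \<le> 1 + ?t * chi e x" using chi_value[OF x sub] True t by auto
      ultimately have "1/4 \<le> ?l x" using tr e(2) by (simp add: lr_def esign_def pos_le_divide_eq)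
      then show "?l x * sqrt (?l x) \<le> 1 + 3/2 * (?l x - 1) + 4/9 * (?l x - 1)\<^sup>2"
        by (rule three_halves_power_bound(2)[OF l0[OF x]])
    qed
    also have "\<dots> \<le> 1 + 48/100 * ?t\<^sup>2"
      unfolding lin using sq zero_le_power2[of ?t] by linarith
    also have "\<dots> \<le> exp (48/100 * ?t\<^sup>2)" by (rule exp_ge_add_one_self)
    finally show ?thesis .
  next
    case False
    have "?E (\<lambda>x. ?l x * sqrt (?l x)) \<le> ?E (\<lambda>x. 1 + 3/2 * (?l x - 1) + 1/2 * (?l x - 1)\<^sup>2)"
      by (intro gexp_mono three_halves_power_bound(1) l0)
    also have "\<dots> \<le> 1 + 1/2 * ?t\<^sup>2" unfolding lin using sq by simp
    also have "\<dots> \<le> 1 + 48/100 * ?t\<^sup>2 + (48/100 * ?t\<^sup>2)\<^sup>2 / 2"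
    proof -
      have "(1/2)\<^sup>2 \<le> ?t\<^sup>2" using False by (intro power_mono) auto
      then have t2: "1/4 \<le> ?t\<^sup>2" by (simp add: power2_eq_square)
      have "1/4 * ?t\<^sup>2 \<le> ?t\<^sup>2 * ?t\<^sup>2" using t2 by (intro mult_right_mono) auto
      moreover have "(48/100 * ?t\<^sup>2)\<^sup>2 / 2 = 1152/10000 * (?t\<^sup>2 * ?t\<^sup>2)"
        by (simp add: power2_eq_square)
      ultimately show ?thesis using zero_le_power2[of ?t] by linarith
    qed
    also have "\<dots> \<le> exp (48/100 * ?t\<^sup>2)"
      by (rule exp_lower_Taylor_quadratic) simp
    finally show ?thesis .
  qed
qed

text \<open>The case of many blocks: a maximal graph without the property inside a disjoint union of complete graphs has a
critical missing edge in every block.\<close>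

lemma risk_complete_blocks:
  assumes P: "graph_property P" "strongly_monotone P" and null: "null_graphs P d \<noteq> {}"
    and A: "A \<subseteq> {1..d}" "P ({1..d}, pairs A)" "card A \<le> s" and s: "1 \<le> s" "s \<le> d"
    and \<theta>: "0 \<le> \<theta>" and nt: "real n * (tanh \<theta>)\<^sup>2 \<le> ln (real (d div s))"
  shows "ennreal (1 - 3 * real (d div s) powr (- 1/100)) \<le> minimax_risk n d P \<theta>"
proof -
  define N where "N = d div s"
  have N: "1 \<le> N" using s by (simp add: N_def Suc_le_eq div_greater_zero_iff)
  define B where "B j = {j * s + 1..(j + 1) * s}" for j
  have Bsub: "B j \<subseteq> {1..d}" if "j < N" for j
  proof -
    have "(j + 1) * s \<le> N * s" using that by (intro mult_right_mono) auto
    also have "\<dots> \<le> d" by (simp add: N_def)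
    finally show ?thesis by (auto simp: B_def)
  qed
  have Bdisj: "B i \<inter> B j = {}" if "i \<noteq> j" for i j
  proof -
    have "B i \<inter> B j = {}" if "i < j" for i j
    proof -
      have "(i + 1) * s \<le> j * s" using that by (intro mult_right_mono) auto
      then show ?thesis by (auto simp: B_def)
    qed
    then show ?thesis using \<open>i \<noteq> j\<close> by (metis Int_commute linorder_neqE_nat)
  qed
  have BP: "P ({1..d}, pairs (B j))" if "j < N" for j
    using complete_property_transfer[OF P A(1,2) Bsub[OF that]] A(3) by (simp add: B_def)
  define U where "U = (\<Union>j<N. pairs (B j))"
  have U: "U \<subseteq> pairs {1..d}" using Bsub pairs_mono unfolding U_def by blast
  have finU: "finite U" using U finite_edge_set by blast
  let ?\<N> = "{F. F \<subseteq> U \<and> \<not> P ({1..d}, F)}"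
  have "finite ?\<N>" using finU by simp
  moreover have "{} \<in> ?\<N>" using empty_graph_null[OF P(2) null] by simp
  ultimately obtain F where F: "F \<in> ?\<N>" and max: "\<And>F'. F' \<in> ?\<N> \<Longrightarrow> F \<subseteq> F' \<Longrightarrow> F = F'"
    using finite_has_maximal[of ?\<N>] by (metis (no_types, lifting) empty_iff)
  have FU: "F \<subseteq> U" "\<not> P ({1..d}, F)" using F by auto
  then have Fp: "F \<subseteq> pairs {1..d}" using U by blast
  have "\<exists>e. e \<in> pairs (B j) \<and> e \<notin> F" if "j < N" for j
    using property_edges_mono[OF P(2) _ Fp BP[OF that]] FU by blast
  then obtain e where e: "\<And>j. j < N \<Longrightarrow> e j \<in> pairs (B j)" "\<And>j. j < N \<Longrightarrow> e j \<notin> F" by metis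
  have eB: "e j \<subseteq> B j" "e j \<noteq> {}" if "j < N" for j using e(1)[OF that] by (auto simp: pairs_def)
  have inj: "inj_on e {..<N}"
  proof (rule inj_onI)
    fix i j assume "i \<in> {..<N}" "j \<in> {..<N}" "e i = e j"
    then show "i = j" using Bdisj[of i j] eB[of i] eB[of j] by fastforce
  qed
  define K where "K = e ` {..<N}"
  have K: "finite K" "K \<noteq> {}" "card K = N"
    unfolding K_def using N card_image[OF inj] by (auto simp: lessThan_empty_iff)
  have Kp: "K \<subseteq> pairs {1..d}" using e(1) Bsub pairs_mono unfolding K_def by blast
  have crit: "critical_edges P d F K"
  proof -
    have "P ({1..d}, toggle F f)" if f: "f \<in> K" for f
    proof -
      obtain j where j: "j < N" "f = e j" using f by (auto simp: K_def)
      have "f \<notin> F" "insert f F \<subseteq> U" using e[OF j(1)] j FU by (auto simp: U_def)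
      then show ?thesis using max[of "insert f F"] by (auto simp: toggle_def)
    qed
    then show ?thesis using FU Fp Kp by (simp add: critical_edges_def)
  qed
  let ?L = "\<lambda>f X. \<Prod>i\<in>{1..n}. lr d \<theta> F f (X i)"
  have "sexp n d \<theta> F (\<lambda>X. \<bar>(\<Sum>f\<in>K. ?L f X) / card K - 1\<bar>) \<le> 3 * real N powr (- 1/100)"
  proof (rule truncated_average)
    show "real N = real (card K)" "1 \<le> real N" using K N by auto
    fix f assume fK: "f \<in> K"
    then have f: "f \<in> pairs {1..d}" "f \<notin> F" using Kp e(2) by (auto simp: K_def)
    have pos: "0 < lr d \<theta> F f x" if "x \<in> spins d" for x by (rule lr_bounds(4)[OF Fp f(1) \<theta> that])
    show "0 \<le> ?L f X" if "X \<in> samples n d" for X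
      using pos sample_in_spins[OF that] by (intro prod_nonneg) (auto intro: less_imp_le)
    show "sexp n d \<theta> F (?L f) = 1" unfolding sexp_prod gexp_lr[OF Fp f(1) \<theta>] by simp
    have "sqrt (\<Prod>i\<in>I. a i) = (\<Prod>i\<in>I. sqrt (a i))" for I and a :: "nat \<Rightarrow> real"
      by (induction I rule: infinite_finite_induct) (auto simp: real_sqrt_mult)
    then have "sexp n d \<theta> F (\<lambda>X. ?L f X * sqrt (?L f X))
       = sexp n d \<theta> F (\<lambda>X. \<Prod>i\<in>{1..n}. lr d \<theta> F f (X i) * sqrt (lr d \<theta> F f (X i)))"
      by (simp add: prod.distrib)
    also have "\<dots> = gexp d \<theta> F (\<lambda>x. lr d \<theta> F f x * sqrt (lr d \<theta> F f x)) ^ n" by (rule sexp_prod)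
    also have "\<dots> \<le> exp (48/100 * (tanh \<theta>)\<^sup>2) ^ n"
      using pos by (intro power_mono lr_three_halves_moment[OF Fp f \<theta>] gexp_nonneg) (auto intro: less_imp_le)
    also have "\<dots> = exp (48/100 * (real n * (tanh \<theta>)\<^sup>2))" by (simp flip: exp_of_nat_mult)
    also have "\<dots> \<le> exp (48/100 * ln (real N))" using nt by (simp add: N_def)
    also have "\<dots> = real N powr (48/100)" using N by (simp add: powr_def)
    finally show "sexp n d \<theta> F (\<lambda>X. ?L f X * sqrt (?L f X)) \<le> real N powr (48/100)" .
    fix f' h assume f': "f' \<in> K" "f \<noteq> f'"
    obtain i j where ij: "i < N" "f = e i" "j < N" "f' = e j" "i \<noteq> j"
      using fK f' by (auto simp: K_def)
    have fi: "f \<subseteq> B i" and fj: "f' \<subseteq> {1..d} - B i"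
      using eB[OF ij(1)] eB[OF ij(3)] ij Bdisj[OF ij(5)] Bsub[OF ij(3)] by auto
    have F2: "F \<subseteq> pairs (B i) \<union> pairs ({1..d} - B i)"
    proof
      fix g assume "g \<in> F"
      then obtain k where k: "k < N" "g \<in> pairs (B k)" using FU by (auto simp: U_def)
      then show "g \<in> pairs (B i) \<union> pairs ({1..d} - B i)"
        using Bdisj[of k i] Bsub[OF k(1)] by (cases "k = i") (auto simp: pairs_def)
    qed
    show "sexp n d \<theta> F (\<lambda>X. h (?L f X) * h (?L f' X))
       = sexp n d \<theta> F (\<lambda>X. h (?L f X)) * sexp n d \<theta> F (\<lambda>X. h (?L f' X))"
    proof (rule sexp_block_independent[OF F2 Bsub[OF ij(1)]])
      fix X Y :: "nat \<Rightarrow> nat \<Rightarrow> real"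
      { assume eq: "\<And>k v. k \<in> {1..n} \<Longrightarrow> v \<in> B i \<Longrightarrow> X k v = Y k v"
        have "lr d \<theta> F f (X k) = lr d \<theta> F f (Y k)" if "k \<in> {1..n}" for k
        proof -
          have "chi f (X k) = chi f (Y k)" using eq[OF that] fi by (intro prod.cong) auto
          then show ?thesis by (simp add: lr_def)
        qed
        then show "h (?L f X) = h (?L f Y)" by simp }
      { assume eq: "\<And>k v. k \<in> {1..n} \<Longrightarrow> v \<in> {1..d} - B i \<Longrightarrow> X k v = Y k v"
        have "lr d \<theta> F f' (X k) = lr d \<theta> F f' (Y k)" if "k \<in> {1..n}" for k
        proof -
          have "chi f' (X k) = chi f' (Y k)" using eq[OF that] fj by (intro prod.cong) auto
          then show ?thesis by (simp add: lr_def)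
        qed
        then show "h (?L f' X) = h (?L f' Y)" by simp }
    qed
  qed (rule K(1))
  then have "ennreal (1 - 3 * real N powr (- 1/100))
     \<le> ennreal (1 - sexp n d \<theta> F (\<lambda>X. \<bar>(\<Sum>f\<in>K. ?L f X) / card K - 1\<bar>))"
    by (intro ennreal_leI) simp
  also have "\<dots> \<le> minimax_risk n d P \<theta>" by (rule testing_lower_bound[OF crit K(1,2)])
  finally show ?thesis by (simp add: N_def)
qed

section \<open>Concentration in the Curie-Weiss model\<close>

abbreviation (input) mag :: "nat set \<Rightarrow> (nat \<Rightarrow> real) \<Rightarrow> real" where
  "mag A x \<equiv> (\<Sum>v\<in>A. x v)"

lemma pairs_insert:
  assumes "v \<notin> C" "finite C"
  shows "pairs (insert v C) = pairs C \<union> (\<lambda>u. {v, u}) ` C" "pairs C \<inter> (\<lambda>u. {v, u}) ` C = {}"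
    "inj_on (\<lambda>u. {v, u}) C"
proof -
  show "pairs (insert v C) = pairs C \<union> (\<lambda>u. {v, u}) ` C"
  proof (intro equalityI subsetI)
    fix e assume e: "e \<in> pairs (insert v C)"
    show "e \<in> pairs C \<union> (\<lambda>u. {v, u}) ` C"
    proof (cases "v \<in> e")
      case True
      have "card (e - {v}) = 1" using e True by (simp add: pairs_def)
      then obtain u where "e - {v} = {u}" by (auto simp: card_1_singleton_iff)
      then have "e = {v, u}" "u \<in> C" using e True by (auto simp: pairs_def)
      then show ?thesis by blast
    next
      case False
      then show ?thesis using e by (auto simp: pairs_def)
    qed
  next
    fix e assume "e \<in> pairs C \<union> (\<lambda>u. {v, u}) ` C"
    then show "e \<in> pairs (insert v C)" using assms by (auto simp: pairs_def card_insert_if)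
  qed
  show "pairs C \<inter> (\<lambda>u. {v, u}) ` C = {}" using assms by (auto simp: pairs_def)
  show "inj_on (\<lambda>u. {v, u}) C" by (auto simp: inj_on_def doubleton_eq_iff)
qed

lemma sum_pairs_eq:
  assumes "finite C" "C \<subseteq> {1..d}" "x \<in> spins d"
  shows "(\<Sum>e\<in>pairs C. chi e x) = ((mag C x)\<^sup>2 - real (card C)) / 2"
  using assms
proof (induction C)
  case empty
  have "pairs {} = {}" by (auto simp: pairs_def)
  then show ?case by simp
next
  case (insert v C)
  have star: "(\<Sum>e\<in>(\<lambda>u. {v, u}) ` C. chi e x) = x v * mag C x"
  proof -
    have "(\<Sum>e\<in>(\<lambda>u. {v, u}) ` C. chi e x) = (\<Sum>u\<in>C. chi {v, u} x)"
      using pairs_insert(3)[of v C] insert.hyps by (simp add: sum.reindex)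
    also have "\<dots> = (\<Sum>u\<in>C. x v * x u)"
    proof (intro sum.cong refl)
      fix u assume "u \<in> C"
      then have "v \<noteq> u" using insert.hyps by auto
      then show "chi {v, u} x = x v * x u" by simp
    qed
    finally show ?thesis by (simp add: sum_distrib_left)
  qed
  have "(\<Sum>e\<in>pairs (insert v C). chi e x) = ((mag C x)\<^sup>2 - real (card C)) / 2 + x v * mag C x"
    using pairs_insert[of v C] insert finite_pairs[of C] star by (simp add: sum.union_disjoint)
  moreover have "mag (insert v C) x = x v + mag C x" using insert by simp
  moreover have "x v * x v = 1" using insert by (intro spins_sq[of x d]) auto
  ultimately show ?case using insert by (simp add: power2_eq_square field_simps)
qed

text \<open>The binomial law of the sum of independent signs, by induction on the set of spins and the recursion of Pascal.\<close>

lemma sum_spins_mag: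
  assumes "finite C" "C \<subseteq> {1..d}"
  shows "(\<Sum>x\<in>spins d. \<phi> (mag C x)) * 2 ^ card C
     = 2 ^ d * (\<Sum>k\<le>card C. real (card C choose k) * \<phi> (2 * real k - real (card C)))"
  using assms
proof (induction C arbitrary: \<phi>)
  case empty
  then show ?case by (simp add: card_spins)
next
  case (insert v C)
  let ?R = "card C"
  have v: "v \<in> {1..d}" using insert by auto
  have flip: "(\<Sum>x\<in>spins d. \<phi> (x v + mag C x)) = (\<Sum>x\<in>spins d. \<phi> (- x v + mag C x))"
  proof (rule sum.reindex_bij_witness[of _ "\<lambda>x. x(v := - x v)" "\<lambda>x. x(v := - x v)"])
    show s: "x(v := - x v) \<in> spins d" if "x \<in> spins d" for x
      using spins_value[OF that v] by (intro spins_upd that v) auto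
    show "x(v := - x v) \<in> spins d" if "x \<in> spins d" for x by (rule s[OF that])
    fix x
    have "mag C (x(v := - x v)) = mag C x" using insert.hyps by (intro sum.cong) auto
    then show "\<phi> (- (x(v := - x v)) v + mag C (x(v := - x v))) = \<phi> (x v + mag C x)" by simp
  qed auto
  have "2 * (\<Sum>x\<in>spins d. \<phi> (x v + mag C x))
     = (\<Sum>x\<in>spins d. \<phi> (x v + mag C x) + \<phi> (- x v + mag C x))"
    using flip by (simp add: sum.distrib)
  also have "\<dots> = (\<Sum>x\<in>spins d. \<phi> (1 + mag C x) + \<phi> (- 1 + mag C x))"
    using spins_value[OF _ v] by (intro sum.cong refl) fastforce
  finally have "2 * (\<Sum>x\<in>spins d. \<phi> (x v + mag C x))
     = (\<Sum>x\<in>spins d. \<phi> (1 + mag C x) + \<phi> (- 1 + mag C x))" .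
  then have "2 * (\<Sum>x\<in>spins d. \<phi> (x v + mag C x)) * 2 ^ ?R
     = 2 ^ d * (\<Sum>k\<le>?R. real (?R choose k) * (\<phi> (1 + (2 * real k - ?R)) + \<phi> (- 1 + (2 * real k - ?R))))"
    using insert.IH[of "\<lambda>m. \<phi> (1 + m) + \<phi> (- 1 + m)"] insert.prems by simp
  also have "(\<Sum>k\<le>?R. real (?R choose k) * (\<phi> (1 + (2 * real k - ?R)) + \<phi> (- 1 + (2 * real k - ?R))))
     = (\<Sum>k\<le>Suc ?R. real (Suc ?R choose k) * \<phi> (2 * real k - real (Suc ?R)))" (is "?l = ?r")
  proof -
    let ?g = "\<lambda>k. \<phi> (2 * real k - real (Suc ?R))"
    have "?r = ?g 0 + (\<Sum>k\<le>?R. real (Suc ?R choose Suc k) * ?g (Suc k))"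
      by (subst sum.atMost_Suc_shift) simp
    also have "(\<Sum>k\<le>?R. real (Suc ?R choose Suc k) * ?g (Suc k))
      = (\<Sum>k\<le>?R. real (?R choose k) * ?g (Suc k)) + (\<Sum>k\<le>?R. real (?R choose Suc k) * ?g (Suc k))"
      by (simp add: sum.distrib ring_distribs del: of_nat_Suc)
    also have "?g 0 + ((\<Sum>k\<le>?R. real (?R choose k) * ?g (Suc k)) + (\<Sum>k\<le>?R. real (?R choose Suc k) * ?g (Suc k)))
      = (\<Sum>k\<le>?R. real (?R choose k) * ?g (Suc k)) + (\<Sum>k\<le>Suc ?R. real (?R choose k) * ?g k)"
    proof -
      have "(\<Sum>k\<le>Suc ?R. real (?R choose k) * ?g k) = ?g 0 + (\<Sum>k\<le>?R. real (?R choose Suc k) * ?g (Suc k))"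
        by (subst sum.atMost_Suc_shift) simp
      then show ?thesis by simp
    qed
    also have "(\<Sum>k\<le>Suc ?R. real (?R choose k) * ?g k) = (\<Sum>k\<le>?R. real (?R choose k) * ?g k)"
      by simp
    finally show ?thesis by (simp add: sum.distrib ring_distribs algebra_simps)
  qed
  finally show ?case using insert by (simp del: sum.atMost_Suc)
qed

lemma artanh_bound:
  fixes s :: real assumes "0 \<le> s" "s < 1"
  shows "artanh s \<le> s / (1 - s\<^sup>2) - 2 * s ^ 3 / 3"
proof -
  let ?k = "\<lambda>s::real. s / (1 - s\<^sup>2) - 2 * s ^ 3 / 3 - artanh s"
  have "?k 0 \<le> ?k s"
  proof (rule DERIV_nonneg_imp_nondecreasing[OF assms(1)])
    fix x assume x: "0 \<le> x" "x \<le> s"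
    then have x1: "\<bar>x\<bar> < 1" "x\<^sup>2 < 1" using assms by (auto simp: abs_square_less_1)
    have "(?k has_field_derivative
        ((1 - x\<^sup>2) + x * (2 * x)) / (1 - x\<^sup>2)\<^sup>2 - 2 * x\<^sup>2 - 1 / (1 - x\<^sup>2)) (at x)"
      using x1 by (auto intro!: derivative_eq_intros simp: power2_eq_square algebra_simps)
    moreover have "0 \<le> ((1 - x\<^sup>2) + x * (2 * x)) / (1 - x\<^sup>2)\<^sup>2 - 2 * x\<^sup>2 - 1 / (1 - x\<^sup>2)"
    proof -
      define q where "q = x\<^sup>2"
      have q: "0 \<le> q" "q < 1" using x1 by (auto simp: q_def)
      have "((1 - x\<^sup>2) + x * (2 * x)) / (1 - x\<^sup>2)\<^sup>2 - 2 * x\<^sup>2 - 1 / (1 - x\<^sup>2)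
         = 2 * q * (1 / (1 - q)\<^sup>2 - 1)"
      proof -
        have e: "(1 - x\<^sup>2) + x * (2 * x) = 1 + q" by (simp add: q_def power2_eq_square)
        show ?thesis unfolding e unfolding q_def[symmetric]
          using q by (simp add: divide_simps) (simp add: power2_eq_square algebra_simps)
      qed
      moreover have "1 \<le> 1 / (1 - q)\<^sup>2" using q by (simp add: pos_le_divide_eq power_le_one)
      ultimately show ?thesis using q by simp
    qed
    ultimately show "\<exists>y. (?k has_real_derivative y) (at x) \<and> 0 \<le> y" by blast
  qed
  then show ?thesis by (simp add: artanh_def)
qed

text \<open>The power series of \<open>artanh s / s\<close> has nonnegative coefficients in \<open>s\<^sup>2\<close>, the first of which is \<open>1/3\<close>. The derivative
is controlled instead of the series.\<close>

lemma artanh_ratio_mono: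
  fixes s s' :: real assumes "0 < s" "s \<le> s'" "s' < 1"
  shows "artanh s / s + (s'\<^sup>2 - s\<^sup>2) / 3 \<le> artanh s' / s'"
proof -
  let ?g = "\<lambda>s::real. artanh s / s - s\<^sup>2 / 3"
  have "?g s \<le> ?g s'"
  proof (rule DERIV_nonneg_imp_nondecreasing[OF assms(2)])
    fix x assume x: "s \<le> x" "x \<le> s'"
    then have x1: "0 < x" "\<bar>x\<bar> < 1" "x\<^sup>2 < 1" using assms by (auto simp: abs_square_less_1)
    have "(?g has_field_derivative ((1 / (1 - x\<^sup>2)) * x - artanh x) / x\<^sup>2 - 2 * x / 3) (at x)"
      using x1 by (auto intro!: derivative_eq_intros simp: power2_eq_square)
    moreover have "0 \<le> ((1 / (1 - x\<^sup>2)) * x - artanh x) / x\<^sup>2 - 2 * x / 3"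
    proof -
      have "2 * x ^ 3 / 3 \<le> (1 / (1 - x\<^sup>2)) * x - artanh x"
        using artanh_bound[of x] x1 by (simp only: times_divide_eq_left mult_1_left) linarith
      then have "(2 * x ^ 3 / 3) / x\<^sup>2 \<le> ((1 / (1 - x\<^sup>2)) * x - artanh x) / x\<^sup>2"
        by (rule divide_right_mono) simp
      then show ?thesis using x1 by (simp add: power2_eq_square power3_eq_cube)
    qed
    ultimately show "\<exists>y. (?g has_real_derivative y) (at x) \<and> 0 \<le> y" by blast
  qed
  then show ?thesis by (simp add: diff_divide_distrib)
qed

text \<open>The weight of \<open>k\<close> plus spins among \<open>R\<close> in the Curie-Weiss model, that is, the Ising model on the complete graph,
without the constant factor from the diagonal terms of the squared magnetization.\<close>

definition cw :: "nat \<Rightarrow> real \<Rightarrow> nat \<Rightarrow> real" where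
  "cw R \<theta> k = real (R choose k) * exp (\<theta> * (2 * real k - real R)\<^sup>2 / 2)"

lemma cw_pos: "k \<le> R \<Longrightarrow> 0 < cw R \<theta> k"
  by (simp add: cw_def)

lemma cw_nonneg: "0 \<le> cw R \<theta> k"
  by (simp add: cw_def)

lemma cw_sym: "k \<le> R \<Longrightarrow> cw R \<theta> (R - k) = cw R \<theta> k"
  by (simp add: cw_def binomial_symmetric[symmetric] of_nat_diff power2_eq_square algebra_simps)

text \<open>The increment of the log-weight when the magnetization moves from \<open>u - 1\<close> to \<open>u + 1\<close>.\<close>

definition cw_inc :: "nat \<Rightarrow> real \<Rightarrow> real \<Rightarrow> real" where
  "cw_inc R \<theta> u = 2 * \<theta> * u - 2 * artanh (u / (real R + 1))"

lemma cw_step: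
  assumes "k < R"
  shows "ln (cw R \<theta> (Suc k)) = ln (cw R \<theta> k) + cw_inc R \<theta> (2 * real k + 1 - real R)"
proof -
  define u where "u = 2 * real k + 1 - real R"
  have ch: "real (R choose Suc k) = real (R choose k) * ((real R - real k) / (real k + 1))"
  proof -
    have "Suc k * (R choose Suc k) = (R choose k) * (R - k)"
      using binomial_absorb_comp[of R k] binomial_absorption[of k R]
      by (metis binomial_absorb_comp binomial_absorption mult.commute)
    then have "real (Suc k) * real (R choose Suc k) = real (R choose k) * real (R - k)"
      by (metis of_nat_mult)
    then show ?thesis using assms by (simp add: of_nat_diff field_simps)
  qed
  have "cw R \<theta> (Suc k) = cw R \<theta> k * ((real R - real k) / (real k + 1) * exp (2 * \<theta> * u))"
  proof -
    have "\<theta> * (2 * real (Suc k) - real R)\<^sup>2 / 2 = \<theta> * (2 * real k - real R)\<^sup>2 / 2 + 2 * \<theta> * u"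
      by (simp add: u_def power2_eq_square field_simps)
    note eq = this
    show ?thesis unfolding cw_def ch eq exp_add by simp
  qed
  then have "ln (cw R \<theta> (Suc k)) = ln (cw R \<theta> k) + ln ((real R - real k) / (real k + 1)) + 2 * \<theta> * u"
  proof -
    assume eq: "cw R \<theta> (Suc k) = cw R \<theta> k * ((real R - real k) / (real k + 1) * exp (2 * \<theta> * u))"
    have "0 < (real R - real k) / (real k + 1)" using assms by simp
    then show ?thesis unfolding eq using assms cw_pos[of k R \<theta>] ln_mult[of "cw R \<theta> k" "(real R - real k) / (real k + 1) * exp (2 * \<theta> * u)"]
      ln_mult[of "(real R - real k) / (real k + 1)" "exp (2 * \<theta> * u)"] by simp
  qed
  moreover have "ln ((real R - real k) / (real k + 1)) = - 2 * artanh (u / (real R + 1))"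
  proof -
    have "(1 + u / (real R + 1)) / (1 - u / (real R + 1)) = (real k + 1) / (real R - real k)"
    proof -
      have "1 + u / (real R + 1) = 2 * (real k + 1) / (real R + 1)"
        "1 - u / (real R + 1) = 2 * (real R - real k) / (real R + 1)"
        by (simp_all add: u_def field_simps)
      then have "(1 + u / (real R + 1)) / (1 - u / (real R + 1))
          = (2 * (real k + 1)) / (2 * (real R - real k))" by simp
      then show ?thesis by (simp only: mult_divide_mult_cancel_left_if) simp
    qed
    then show ?thesis using assms by (simp add: artanh_def ln_div)
  qed
  ultimately show ?thesis by (simp add: cw_inc_def u_def)
qed

text \<open>The increment at \<open>u\<close>, divided by \<open>u\<close>, is the derivative of the log-weight in the squared magnetization, up to a
constant factor. It decreases at least linearly in \<open>u\<^sup>2\<close>, whatever \<open>\<theta>\<close> is.\<close>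

lemma cw_inc_mono:
  assumes "0 < u" "u \<le> u'" "u' < real R + 1"
  shows "u * (cw_inc R \<theta> u' / u') + 2 * u * (u'\<^sup>2 - u\<^sup>2) / (3 * (real R + 1) ^ 3) \<le> cw_inc R \<theta> u"
proof -
  let ?N = "real R + 1"
  have N: "0 < ?N" by simp
  have "artanh (u / ?N) / (u / ?N) + ((u' / ?N)\<^sup>2 - (u / ?N)\<^sup>2) / 3 \<le> artanh (u' / ?N) / (u' / ?N)"
    using assms by (intro artanh_ratio_mono) (auto simp: divide_right_mono)
  then have "u * (2 / ?N * (artanh (u / ?N) / (u / ?N) + ((u' / ?N)\<^sup>2 - (u / ?N)\<^sup>2) / 3))
      \<le> u * (2 / ?N * (artanh (u' / ?N) / (u' / ?N)))"
    using assms by (intro mult_left_mono) auto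
  moreover have "u * (2 / ?N * (artanh (u / ?N) / (u / ?N) + ((u' / ?N)\<^sup>2 - (u / ?N)\<^sup>2) / 3))
     = 2 * artanh (u / ?N) + 2 * u * (u'\<^sup>2 - u\<^sup>2) / (3 * ?N ^ 3)"
  proof -
    have "u * (2 / M * (a / (u / M) + ((u' / M)\<^sup>2 - (u / M)\<^sup>2) / 3)) = 2 * a + 2 * u * (u'\<^sup>2 - u\<^sup>2) / (3 * M ^ 3)"
      if "0 < M" for M a
      using assms that by (simp add: field_simps power2_eq_square power3_eq_cube)
    from this[OF N] show ?thesis .
  qed
  moreover have "u * (2 / ?N * (artanh (u' / ?N) / (u' / ?N))) = 2 * \<theta> * u - u * (cw_inc R \<theta> u' / u')"
  proof -
    have "u * (2 / M * (a / (u' / M))) = 2 * \<theta> * u - u * ((2 * \<theta> * u' - 2 * a) / u')"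
      if "0 < M" for M a
      using assms that by (simp add: field_simps)
    from this[OF N] show ?thesis unfolding cw_inc_def .
  qed
  ultimately show ?thesis by (simp add: cw_inc_def)
qed

text \<open>As a function of the squared magnetization the log-weight lies below a parabola with its vertex at the mode and a
curvature that does not depend on \<open>\<theta>\<close>, up to \<open>1/3\<close>. Since the increments change sign at the mode \<open>k0\<close>, their monotonicity bounds them on both
sides of it, and the resulting sums telescope: with \<open>V\<^sub>k\<close> the squared magnetization, \<open>V\<^bsub>k+1\<^esub> - V\<^sub>k\<close> is \<open>4 * u\<close>. The
correction terms that are linear in \<open>V\<^sub>k - V\<^bsub>k0\<^esub>\<close> come from the lattice spacing. This excludes the coexistence of
two phases with different absolute magnetization.\<close>

lemma cw_log_concave:
  obtains k0 where "k0 \<le> R" "R \<le> 2 * k0"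
    "\<And>k. k \<le> R \<Longrightarrow> ln (cw R \<theta> k) \<le> ln (cw R \<theta> k0) + 1/3
       - ((2 * real k - real R)\<^sup>2 - (2 * real k0 - real R)\<^sup>2)\<^sup>2 / (12 * (real R + 1) ^ 3)"
proof -
  let ?K = "{k. k \<le> R \<and> R \<le> 2 * k}"
  let ?N = "real R + 1" and ?l = "\<lambda>k. ln (cw R \<theta> k)"
  let ?V = "\<lambda>k. (2 * real k - real R)\<^sup>2"
  have fin: "finite ?K" by simp
  have "R \<in> ?K" by simp
  then have "Max (?l ` ?K) \<in> ?l ` ?K" using fin by (intro Max_in) blast+
  then obtain k0 where k0: "k0 \<in> ?K" and Mx: "Max (?l ` ?K) = ?l k0" by (rule imageE)
  have mx: "?l k \<le> ?l k0" if "k \<in> ?K" for k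
    unfolding Mx[symmetric] using fin that by (intro Max_ge) auto
  define m where "m = 2 * real k0 - real R"
  have m: "0 \<le> m" "m \<le> real R" using k0 by (auto simp: m_def)
  have N: "0 < ?N" by simp
  have up: "?l k \<le> ?l k0 - ((?V k - m\<^sup>2)\<^sup>2 - 4 * (m + 1) * (?V k - m\<^sup>2)) / (12 * ?N ^ 3)"
    if "k0 \<le> k" "k \<le> R" for k
    using that
  proof (induction k rule: dec_induct)
    case base
    then show ?case by (simp add: m_def)
  next
    case (step k)
    define u where "u = 2 * real k + 1 - real R"
    have k: "k < R" "k0 < R" using step by auto
    have u: "0 < m + 1" "m + 1 \<le> u" "u < ?N" using m step.hyps k by (auto simp: u_def m_def)
    have "?l (Suc k0) \<le> ?l k0" using mx[of "Suc k0"] k k0 by auto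
    then have "cw_inc R \<theta> (m + 1) \<le> 0" using cw_step[OF k(2), of \<theta>] by (simp add: m_def algebra_simps)
    moreover have "(m + 1) * (cw_inc R \<theta> u / u) + 2 * (m + 1) * (u\<^sup>2 - (m + 1)\<^sup>2) / (3 * ?N ^ 3) \<le> cw_inc R \<theta> (m + 1)"
      using u by (intro cw_inc_mono)
    moreover have "(m + 1) * (c + 2 * b / e) = (m + 1) * c + 2 * (m + 1) * b / e" for b c e
      by (simp add: ring_distribs add_divide_distrib)
    ultimately have "(m + 1) * (cw_inc R \<theta> u / u + 2 * (u\<^sup>2 - (m + 1)\<^sup>2) / (3 * ?N ^ 3)) \<le> 0"
      by (metis order_trans)
    then have "cw_inc R \<theta> u / u + 2 * (u\<^sup>2 - (m + 1)\<^sup>2) / (3 * ?N ^ 3) \<le> 0"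
      using u(1) by (simp add: mult_le_0_iff)
    then have "cw_inc R \<theta> u / u \<le> - (2 * (u\<^sup>2 - (m + 1)\<^sup>2) / (3 * ?N ^ 3))" by simp
    then have "cw_inc R \<theta> u \<le> - (2 * (u\<^sup>2 - (m + 1)\<^sup>2) / (3 * ?N ^ 3)) * u"
      using u by (subst (asm) pos_divide_le_eq) auto
    then have "?l (Suc k) \<le> ?l k - 2 * (u\<^sup>2 - (m + 1)\<^sup>2) * u / (3 * ?N ^ 3)"
      using cw_step[OF k(1), of \<theta>] by (simp add: u_def)
    also have "\<dots> \<le> ?l k0 - ((?V k - m\<^sup>2)\<^sup>2 - 4 * (m + 1) * (?V k - m\<^sup>2)) / (12 * ?N ^ 3)
        - 8 * (u\<^sup>2 - (m + 1)\<^sup>2) * u / (12 * ?N ^ 3)"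
    proof -
      have "2 * b * u / (3 * e) = 8 * b * u / (12 * e)" for b e :: real by simp
      moreover have "?l k \<le> ?l k0 - ((?V k - m\<^sup>2)\<^sup>2 - 4 * (m + 1) * (?V k - m\<^sup>2)) / (12 * ?N ^ 3)"
        using step by auto
      ultimately show ?thesis by (metis diff_right_mono)
    qed
    also have "\<dots> = ?l k0 - ((?V k - m\<^sup>2)\<^sup>2 - 4 * (m + 1) * (?V k - m\<^sup>2) + 8 * (u\<^sup>2 - (m + 1)\<^sup>2) * u) / (12 * ?N ^ 3)"
      by (simp add: add_divide_distrib)
    also have "(?V k - m\<^sup>2)\<^sup>2 - 4 * (m + 1) * (?V k - m\<^sup>2) + 8 * (u\<^sup>2 - (m + 1)\<^sup>2) * u
       = (?V (Suc k) - m\<^sup>2)\<^sup>2 - 4 * (m + 1) * (?V (Suc k) - m\<^sup>2)"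
    proof -
      have "2 * real k - real R = u - 1" "2 * real (Suc k) - real R = u + 1" by (auto simp: u_def)
      then show ?thesis by (simp only:) (simp add: power2_eq_square algebra_simps)
    qed
    finally show ?case .
  qed
  have down: "?l k \<le> ?l k0 - ((m\<^sup>2 - ?V k)\<^sup>2 - 4 * (m - 1) * (m\<^sup>2 - ?V k)) / (12 * ?N ^ 3)"
    if "k \<le> k0" "R \<le> 2 * k" for k
    using that
  proof (induction k rule: inc_induct)
    case base
    then show ?case by (simp add: m_def)
  next
    case (step k)
    define u where "u = 2 * real k + 1 - real R"
    have k: "k < R" "k0 - 1 < R" "k0 - 1 \<in> ?K" using step k0 by auto
    have k01: "real (k0 - 1) = real k0 - 1" "Suc (k0 - 1) = k0" using step.hyps by auto
    have "real R \<le> 2 * real k" "real k + 1 \<le> real k0" using step by linarith+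
    then have u: "0 < u" "u \<le> m - 1" "m - 1 < ?N" using m by (auto simp: u_def m_def)
    have "?l (k0 - 1) \<le> ?l k0" using mx k by auto
    then have c0: "0 \<le> cw_inc R \<theta> (m - 1)" using cw_step[OF k(2), of \<theta>] k01 by (simp add: m_def algebra_simps)
    have "u * (cw_inc R \<theta> (m - 1) / (m - 1)) + 2 * u * ((m - 1)\<^sup>2 - u\<^sup>2) / (3 * ?N ^ 3) \<le> cw_inc R \<theta> u"
      using u by (intro cw_inc_mono)
    moreover have "0 \<le> u * (cw_inc R \<theta> (m - 1) / (m - 1))" using u c0 by simp
    ultimately have "8 * u * ((m - 1)\<^sup>2 - u\<^sup>2) / (12 * ?N ^ 3) \<le> cw_inc R \<theta> u" by simp
    then have "?l k \<le> ?l (Suc k) - 8 * u * ((m - 1)\<^sup>2 - u\<^sup>2) / (12 * ?N ^ 3)"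
      using cw_step[OF k(1), of \<theta>] by (simp add: u_def)
    also have "\<dots> \<le> ?l k0 - ((m\<^sup>2 - ?V (Suc k))\<^sup>2 - 4 * (m - 1) * (m\<^sup>2 - ?V (Suc k))) / (12 * ?N ^ 3)
        - 8 * u * ((m - 1)\<^sup>2 - u\<^sup>2) / (12 * ?N ^ 3)"
      using step by simp
    also have "\<dots> = ?l k0 - ((m\<^sup>2 - ?V (Suc k))\<^sup>2 - 4 * (m - 1) * (m\<^sup>2 - ?V (Suc k)) + 8 * u * ((m - 1)\<^sup>2 - u\<^sup>2)) / (12 * ?N ^ 3)"
      by (simp add: add_divide_distrib)
    also have "(m\<^sup>2 - ?V (Suc k))\<^sup>2 - 4 * (m - 1) * (m\<^sup>2 - ?V (Suc k)) + 8 * u * ((m - 1)\<^sup>2 - u\<^sup>2)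
       = (m\<^sup>2 - ?V k)\<^sup>2 - 4 * (m - 1) * (m\<^sup>2 - ?V k)"
    proof -
      have "2 * real k - real R = u - 1" "2 * real (Suc k) - real R = u + 1" by (auto simp: u_def)
      then show ?thesis by (simp only:) (simp add: power2_eq_square algebra_simps)
    qed
    finally show ?case .
  qed
  have slack: "- ((D\<^sup>2 - 4 * a * D) / (12 * ?N ^ 3)) \<le> 1/3 - D\<^sup>2 / (12 * ?N ^ 3)"
    if "0 \<le> D" "D \<le> ?N\<^sup>2" "a \<le> ?N" for D a
  proof -
    have "a * D \<le> ?N * ?N\<^sup>2" using that by (intro mult_mono) auto
    then have "a * D \<le> ?N ^ 3" by (simp add: power2_eq_square power3_eq_cube)
    then show ?thesis using N by (simp add: field_simps)
  qed
  have VN: "?V k \<le> ?N\<^sup>2" if "k \<le> R" for k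
    using that by (intro abs_le_square_iff[THEN iffD1]) auto
  have half: "?l k \<le> ?l k0 + 1/3 - (?V k - m\<^sup>2)\<^sup>2 / (12 * ?N ^ 3)" if "k \<in> ?K" for k
  proof (cases "k0 \<le> k")
    case True
    have kk: "real R \<le> 2 * real k0" "real k0 \<le> real k" using k0 True by auto
    have D: "0 \<le> ?V k - m\<^sup>2" using kk by (simp add: m_def)
    have "?V k \<le> ?N\<^sup>2" using that by (intro VN) auto
    then have "?V k - m\<^sup>2 \<le> ?N\<^sup>2" using zero_le_power2[of m] by linarith
    then show ?thesis using up[OF True] slack[OF D, of "m + 1"] m that by auto
  next
    case False
    have kk: "real R \<le> 2 * real k" "real k \<le> real k0" using that False by auto
    have D: "0 \<le> m\<^sup>2 - ?V k" using kk by (simp add: m_def)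
    have "m\<^sup>2 \<le> ?N\<^sup>2" unfolding m_def using k0 by (intro VN) auto
    then have "m\<^sup>2 - ?V k \<le> ?N\<^sup>2" using zero_le_power2[of "2 * real k - real R"] by linarith
    then show ?thesis using down[of k] slack[OF D, of "m - 1"] m that False
      by (auto simp: power2_commute[of "?V k"])
  qed
  show ?thesis
  proof (rule that[of k0])
    show "k0 \<le> R" "R \<le> 2 * k0" using k0 by auto
    fix k assume k: "k \<le> R"
    show "?l k \<le> ?l k0 + 1/3 - (?V k - (2 * real k0 - real R)\<^sup>2)\<^sup>2 / (12 * ?N ^ 3)"
    proof (cases "R \<le> 2 * k")
      case True
      then show ?thesis using half[of k] k by (simp add: m_def)
    next
      case False
      have "?V (R - k) = ?V k" using k by (simp add: of_nat_diff power2_eq_square algebra_simps)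
      then show ?thesis using half[of "R - k"] k False cw_sym[OF k, of \<theta>] by (simp add: m_def)
    qed
  qed
qed

lemma gexp_mag:
  assumes C: "C \<subseteq> {1..d}"
  shows "gexp d \<theta> (pairs C) (\<lambda>x. \<phi> (mag C x))
    = (\<Sum>k\<le>card C. cw (card C) \<theta> k * \<phi> (2 * real k - real (card C))) / (\<Sum>k\<le>card C. cw (card C) \<theta> k)"
proof -
  let ?R = "card C"
  have fin: "finite C" using C finite_subset by blast
  let ?c = "exp (- \<theta> * real ?R / 2)"
  have w: "ising_weight \<theta> ({1..d}, pairs C) x = ?c * exp (\<theta> * (mag C x)\<^sup>2 / 2)" if "x \<in> spins d" for x
    unfolding gibbs_weight sum_pairs_eq[OF fin C that] exp_add[symmetric]
    by (simp add: field_simps)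
  have S: "(\<Sum>x\<in>spins d. ising_weight \<theta> ({1..d}, pairs C) x * \<psi> (mag C x))
     = ?c * (2 ^ d / 2 ^ ?R) * (\<Sum>k\<le>?R. cw ?R \<theta> k * \<psi> (2 * real k - real ?R))" for \<psi>
  proof -
    have "(\<Sum>x\<in>spins d. ising_weight \<theta> ({1..d}, pairs C) x * \<psi> (mag C x))
       = ?c * (\<Sum>x\<in>spins d. exp (\<theta> * (mag C x)\<^sup>2 / 2) * \<psi> (mag C x))"
      unfolding sum_distrib_left by (intro sum.cong refl) (simp only: w mult.assoc)
    also have "(\<Sum>x\<in>spins d. exp (\<theta> * (mag C x)\<^sup>2 / 2) * \<psi> (mag C x))
       = 2 ^ d / 2 ^ ?R * (\<Sum>k\<le>?R. cw ?R \<theta> k * \<psi> (2 * real k - real ?R))"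
      using sum_spins_mag[OF fin C, of "\<lambda>m. exp (\<theta> * m\<^sup>2 / 2) * \<psi> m"]
      by (simp add: cw_def field_simps)
    finally show ?thesis by simp
  qed
  have "gexp d \<theta> (pairs C) (\<lambda>x. \<phi> (mag C x))
     = (\<Sum>x\<in>spins d. ising_weight \<theta> ({1..d}, pairs C) x * \<phi> (mag C x)) / ising_Z d \<theta> ({1..d}, pairs C)"
    by (simp add: gexp_def gibbs_def sum_divide_distrib)
  also have "ising_Z d \<theta> ({1..d}, pairs C) = ?c * (2 ^ d / 2 ^ ?R) * (\<Sum>k\<le>?R. cw ?R \<theta> k)"
    using S[of "\<lambda>_. 1"] by (simp add: ising_Z_def)
  finally show ?thesis unfolding S by simp
qed

text \<open>There are \<open>R + 1\<close> possible values of the magnetization, and each of those far from the mode has a weight that is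
exponentially small compared with that of the mode.\<close>

lemma cw_concentration:
  assumes C: "C \<subseteq> {1..d}" and \<delta>: "0 \<le> \<delta>"
  obtains z where "0 \<le> z"
    "gexp d \<theta> (pairs C) (\<lambda>x. of_bool (\<delta> * (real (card C))\<^sup>2 < \<bar>(mag C x)\<^sup>2 - z\<^sup>2\<bar>))
      \<le> (real (card C) + 1) * exp (1/3 - \<delta>\<^sup>2 * real (card C) ^ 4 / (12 * (real (card C) + 1) ^ 3))"
proof -
  let ?R = "card C" and ?w = "cw (card C) \<theta>"
  obtain k0 where k0: "k0 \<le> ?R" "?R \<le> 2 * k0" and
    lc: "\<And>k. k \<le> ?R \<Longrightarrow> ln (?w k) \<le> ln (?w k0) + 1/3
       - ((2 * real k - real ?R)\<^sup>2 - (2 * real k0 - real ?R)\<^sup>2)\<^sup>2 / (12 * (real ?R + 1) ^ 3)"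
    using cw_log_concave[of ?R \<theta>] by metis
  let ?z = "2 * real k0 - real ?R"
  let ?b = "exp (1/3 - \<delta>\<^sup>2 * real ?R ^ 4 / (12 * (real ?R + 1) ^ 3))"
  have z: "0 \<le> ?z" using k0 by linarith
  have S: "?w k0 \<le> (\<Sum>k\<le>?R. ?w k)"
    using k0 by (intro member_le_sum) (auto simp: cw_nonneg)
  have S0: "0 < (\<Sum>k\<le>?R. ?w k)" using S cw_pos[OF k0(1), of \<theta>] by linarith
  have summand: "?w k * of_bool (\<delta> * (real ?R)\<^sup>2 < \<bar>(2 * real k - real ?R)\<^sup>2 - ?z\<^sup>2\<bar>) \<le> ?w k0 * ?b" if k: "k \<le> ?R" for k
  proof (cases "\<delta> * (real ?R)\<^sup>2 < \<bar>(2 * real k - real ?R)\<^sup>2 - ?z\<^sup>2\<bar>")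
    case True
    have "(\<delta> * (real ?R)\<^sup>2)\<^sup>2 \<le> ((2 * real k - real ?R)\<^sup>2 - ?z\<^sup>2)\<^sup>2"
      using True \<delta> by (intro abs_le_square_iff[THEN iffD1]) auto
    then have "\<delta>\<^sup>2 * real ?R ^ 4 / (12 * (real ?R + 1) ^ 3)
       \<le> ((2 * real k - real ?R)\<^sup>2 - ?z\<^sup>2)\<^sup>2 / (12 * (real ?R + 1) ^ 3)"
      by (intro divide_right_mono) (auto simp: power_mult_distrib)
    then have "ln (?w k) \<le> ln (?w k0) + (1/3 - \<delta>\<^sup>2 * real ?R ^ 4 / (12 * (real ?R + 1) ^ 3))"
      using lc[OF k] by linarith
    then have "exp (ln (?w k)) \<le> exp (ln (?w k0)) * ?b" unfolding exp_add[symmetric] exp_le_cancel_iff .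
    then show ?thesis using True cw_pos[OF k, of \<theta>] cw_pos[OF k0(1), of \<theta>] by simp
  next
    case False
    then show ?thesis using cw_nonneg[of ?R \<theta> k0] by simp
  qed
  have "gexp d \<theta> (pairs C) (\<lambda>x. of_bool (\<delta> * (real ?R)\<^sup>2 < \<bar>(mag C x)\<^sup>2 - ?z\<^sup>2\<bar>))
    = (\<Sum>k\<le>?R. ?w k * of_bool (\<delta> * (real ?R)\<^sup>2 < \<bar>(2 * real k - real ?R)\<^sup>2 - ?z\<^sup>2\<bar>)) / (\<Sum>k\<le>?R. ?w k)"
    by (rule gexp_mag[OF C, of \<theta> "\<lambda>m. of_bool (\<delta> * (real ?R)\<^sup>2 < \<bar>m\<^sup>2 - ?z\<^sup>2\<bar>)"])
  also have "\<dots> \<le> (\<Sum>k\<le>?R. ?w k0 * ?b) / (\<Sum>k\<le>?R. ?w k)"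
    using S0 summand by (intro divide_right_mono sum_mono) auto
  also have "\<dots> = (real ?R + 1) * ?b * (?w k0 / (\<Sum>k\<le>?R. ?w k))" by simp
  also have "\<dots> \<le> (real ?R + 1) * ?b * 1"
    using S S0 by (intro mult_left_mono) (auto simp: divide_le_eq)
  finally show ?thesis using that[OF z] by simp
qed

text \<open>The derivative of \<open>x - tanh x\<close> is \<open>(tanh x)\<^sup>2\<close>.\<close>

lemma tanh_lipschitz: "\<bar>tanh a - tanh b\<bar> \<le> \<bar>a - b :: real\<bar>"
proof -
  have "0 \<le> tanh b - tanh a \<and> tanh b - tanh a \<le> b - a" if "a \<le> b" for a b :: real
  proof -
    have "(\<lambda>x. x - tanh x) a \<le> (\<lambda>x. x - tanh x) b"
    proof (rule DERIV_nonneg_imp_nondecreasing[OF that])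
      fix x :: real
      have "((\<lambda>x. x - tanh x) has_real_derivative (tanh x)\<^sup>2) (at x)"
        by (auto intro!: derivative_eq_intros simp: cosh_real_nonzero)
      then show "\<exists>y. ((\<lambda>x. x - tanh x) has_real_derivative y) (at x) \<and> 0 \<le> y" by fastforce
    qed
    then show ?thesis using that by simp
  qed
  from this[of a b] this[of b a] show ?thesis by linarith
qed

text \<open>Symmetries of the graph preserve the Gibbs measure. Involutions are enough, because transpositions generate the
symmetries of a complete graph.\<close>

lemma gexp_involution:
  assumes F: "F \<subseteq> pairs {1..d}" and \<pi>: "\<And>v. v \<in> {1..d} \<Longrightarrow> \<pi> v \<in> {1..d}" "\<And>v. \<pi> (\<pi> v) = v"
    and inv: "\<And>e. e \<in> F \<Longrightarrow> \<pi> ` e \<in> F"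
  shows "gexp d \<theta> F (\<lambda>x. f (\<lambda>v. if v \<in> {1..d} then x (\<pi> v) else undefined)) = gexp d \<theta> F f"
proof -
  let ?T = "\<lambda>x v. if v \<in> {1..d} then x (\<pi> v) else undefined :: real"
  have T: "?T x \<in> spins d" if "x \<in> spins d" for x
    using that \<pi>(1) unfolding spins_def by (auto simp: PiE_iff extensional_def)
  have TT: "?T (?T x) = x" if "x \<in> spins d" for x
    by (rule spins_eqI[OF T[OF T[OF that]] that]) (use \<pi> in auto)
  have inj: "inj_on \<pi> A" for A using \<pi>(2) by (metis inj_on_inverseI)
  have chiT: "chi e (?T x) = chi (\<pi> ` e) x" if "e \<in> F" for e x
  proof -
    have "chi e (?T x) = (\<Prod>v\<in>e. x (\<pi> v))"
      using pairs_subset[OF F that] by (intro prod.cong) auto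
    then show ?thesis by (simp add: prod.reindex[OF inj])
  qed
  have "(\<Sum>e\<in>F. chi e (?T x)) = (\<Sum>e\<in>F. chi e x)" for x
  proof -
    have "(\<Sum>e\<in>F. chi e (?T x)) = (\<Sum>e\<in>F. chi (\<pi> ` e) x)" using chiT by (intro sum.cong) auto
    also have "\<dots> = (\<Sum>e\<in>F. chi e x)"
      by (rule sum.reindex_bij_witness[of _ "(`) \<pi>" "(`) \<pi>"]) (auto simp: image_image \<pi>(2) inv)
    finally show ?thesis .
  qed
  then have g: "gibbs d \<theta> F (?T x) = gibbs d \<theta> F x" for x
    unfolding gibbs_def gibbs_weight by presburger
  show ?thesis unfolding gexp_def
    by (rule sum.reindex_bij_witness[of _ ?T ?T]) (simp_all only: T TT g)
qed

lemma complete_graph_exchangeable: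
  assumes C: "C \<subseteq> {1..d}"
  obtains \<rho> where "\<bar>\<rho>\<bar> \<le> 1" "\<And>u w. u \<in> C \<Longrightarrow> w \<in> C \<Longrightarrow> u \<noteq> w \<Longrightarrow> gexp d \<theta> (pairs C) (\<lambda>x. x u * x w) = \<rho>"
proof -
  let ?c = "\<lambda>u w. gexp d \<theta> (pairs C) (\<lambda>x. x u * x w)"
  have com: "?c u w = ?c w u" for u w by (simp add: mult.commute)
  have swap: "?c u w = ?c u' w" if "u \<in> C" "u' \<in> C" "w \<in> C" "w \<noteq> u" "w \<noteq> u'" for u u' w
  proof -
    define \<pi> where "\<pi> v = (if v = u then u' else if v = u' then u else v)" for v
    have "gexp d \<theta> (pairs C) (\<lambda>x. (\<lambda>y. y u * y w) (\<lambda>v. if v \<in> {1..d} then x (\<pi> v) else undefined)) = ?c u w"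
    proof (rule gexp_involution)
      show "pairs C \<subseteq> pairs {1..d}" by (rule pairs_mono[OF C])
      show "\<pi> v \<in> {1..d}" if "v \<in> {1..d}" for v using that C \<open>u \<in> C\<close> \<open>u' \<in> C\<close> by (auto simp: \<pi>_def)
      show pp: "\<pi> (\<pi> v) = v" for v by (simp add: \<pi>_def)
      fix e assume e: "e \<in> pairs C"
      have "inj_on \<pi> e" using pp by (metis inj_on_inverseI)
      moreover have "\<pi> ` e \<subseteq> C" using e \<open>u \<in> C\<close> \<open>u' \<in> C\<close> by (auto simp: \<pi>_def pairs_def)
      ultimately show "\<pi> ` e \<in> pairs C" using e by (simp add: pairs_def card_image)
    qed
    moreover have "u \<in> {1..d}" "w \<in> {1..d}" "\<pi> u = u'" "\<pi> w = w" using that C by (auto simp: \<pi>_def)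
    ultimately show ?thesis by simp
  qed
  have bd: "\<bar>?c u w\<bar> \<le> 1" if "u \<in> C" "w \<in> C" for u w
  proof (rule gexp_abs_le1)
    fix x assume "x \<in> spins d"
    then show "\<bar>x u * x w\<bar> \<le> 1"
      using spins_value[of x d u] spins_value[of x d w] subsetD[OF C that(1)] subsetD[OF C that(2)] by auto
  qed
  show ?thesis
  proof (cases "\<exists>u\<in>C. \<exists>w\<in>C. u \<noteq> w")
    case True
    then obtain u w where uw: "u \<in> C" "w \<in> C" "u \<noteq> w" by auto
    have all: "?c u' w' = ?c u w" if "u' \<in> C" "w' \<in> C" "u' \<noteq> w'" for u' w'
    proof (cases "w = u'")
      case False
      then show ?thesis using swap[of u' u w] swap[of w w' u'] that uw com by metis
    next
      case True
      show ?thesis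
      proof (cases "u = w'")
        case False
        have "?c u w = ?c w' w" by (rule swap) (use that uw True in auto)
        then show ?thesis unfolding True[symmetric] by (metis com)
      next
        case u: True
        show ?thesis unfolding True[symmetric] u[symmetric] by (rule com)
      qed
    qed
    show ?thesis
    proof (rule that[of "?c u w"])
      show "\<bar>?c u w\<bar> \<le> 1" by (rule bd[OF uw(1,2)])
    qed (rule all)
  next
    case False
    then show ?thesis using that[of 0] by auto
  qed
qed

lemma gexp_linear_square:
  assumes C: "C \<subseteq> {1..d}" and \<rho>: "\<And>u w. u \<in> C \<Longrightarrow> w \<in> C \<Longrightarrow> u \<noteq> w \<Longrightarrow> gexp d \<theta> (pairs C) (\<lambda>x. x u * x w) = \<rho>"
  shows "gexp d \<theta> (pairs C) (\<lambda>x. (\<Sum>v\<in>C. a v * x v)\<^sup>2) = \<rho> * (\<Sum>v\<in>C. a v)\<^sup>2 + (1 - \<rho>) * (\<Sum>v\<in>C. (a v)\<^sup>2)"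
proof -
  have fin: "finite C" using C finite_subset by blast
  have "gexp d \<theta> (pairs C) (\<lambda>x. (\<Sum>v\<in>C. a v * x v)\<^sup>2)
     = (\<Sum>u\<in>C. \<Sum>w\<in>C. gexp d \<theta> (pairs C) (\<lambda>x. (a u * a w) * (x u * x w)))"
    unfolding gexp_sum[symmetric] by (rule gexp_cong) (simp add: power2_eq_square sum_product mult_ac)
  also have "\<dots> = (\<Sum>u\<in>C. \<Sum>w\<in>C. \<rho> * (a u * a w) + (if u = w then (1 - \<rho>) * (a u)\<^sup>2 else 0))"
  proof (intro sum.cong refl)
    fix u w assume uw: "u \<in> C" "w \<in> C"
    have "gexp d \<theta> (pairs C) (\<lambda>x. x u * x u) = gexp d \<theta> (pairs C) (\<lambda>x. 1)"
      using uw C by (intro gexp_cong spins_sq) auto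
    then show "gexp d \<theta> (pairs C) (\<lambda>x. (a u * a w) * (x u * x w))
       = \<rho> * (a u * a w) + (if u = w then (1 - \<rho>) * (a u)\<^sup>2 else 0)"
      unfolding gexp_cmult using \<rho>[OF uw] by (auto simp: power2_eq_square algebra_simps)
  qed
  also have "\<dots> = \<rho> * (\<Sum>v\<in>C. a v)\<^sup>2 + (1 - \<rho>) * (\<Sum>v\<in>C. (a v)\<^sup>2)"
  proof -
    have "(\<Sum>u\<in>C. \<Sum>w\<in>C. \<rho> * (a u * a w)) = \<rho> * (\<Sum>v\<in>C. a v)\<^sup>2"
    proof -
      have "(\<Sum>v\<in>C. a v)\<^sup>2 = (\<Sum>u\<in>C. \<Sum>w\<in>C. a u * a w)" by (simp only: power2_eq_square sum_product)
      then show ?thesis by (simp only: sum_distrib_left)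
    qed
    moreover have "(\<Sum>u\<in>C. \<Sum>w\<in>C. if u = w then (1 - \<rho>) * (a u)\<^sup>2 else 0) = (1 - \<rho>) * (\<Sum>v\<in>C. (a v)\<^sup>2)"
      using fin by (simp add: sum_distrib_left sum.delta)
    ultimately show ?thesis by (simp add: sum.distrib)
  qed
  finally show ?thesis .
qed

text \<open>The Gibbs measure has entropy at most \<open>ln 2\<close> per spin, so the mean energy is within that amount of the ground state
energy. By exchangeability the deficit is shared equally by all pairs. The entropy bound appears here as Jensen's
inequality for the logarithm of the inverse weight, in the form \<open>ln z \<le> z - 1\<close>.\<close>

lemma complete_graph_alignment:
  assumes C: "C \<subseteq> {1..d}" "2 \<le> card C" and \<theta>: "0 < \<theta>" and uw: "u \<in> C" "w \<in> C" "u \<noteq> w"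
  shows "1 - 2 * ln 2 / (\<theta> * (real (card C) - 1)) \<le> gexp d \<theta> (pairs C) (\<lambda>x. x u * x w)"
proof -
  let ?R = "real (card C)" and ?E = "gexp d \<theta> (pairs C)"
  obtain \<rho> where \<rho>: "\<And>u w. u \<in> C \<Longrightarrow> w \<in> C \<Longrightarrow> u \<noteq> w \<Longrightarrow> ?E (\<lambda>x. x u * x w) = \<rho>"
    using complete_graph_exchangeable[OF C(1)] by metis
  \<comment> \<open>the weight of a ground state divided by the weight of a configuration of magnetization \<open>m\<close>\<close>
  let ?h = "\<lambda>m. exp (\<theta> * (?R\<^sup>2 - m\<^sup>2) / 2)"
  have M2: "?E (\<lambda>x. (mag C x)\<^sup>2) = \<rho> * ?R\<^sup>2 + (1 - \<rho>) * ?R"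
    using gexp_linear_square[OF C(1) \<rho>, of "\<lambda>_. 1"] by simp
  have "?E (\<lambda>x. ?h (mag C x)) = (\<Sum>k\<le>card C. cw (card C) \<theta> k * ?h (2 * real k - ?R)) / (\<Sum>k\<le>card C. cw (card C) \<theta> k)"
    by (rule gexp_mag[OF C(1)])
  also have "(\<Sum>k\<le>card C. cw (card C) \<theta> k * ?h (2 * real k - ?R)) = 2 ^ card C * exp (\<theta> * ?R\<^sup>2 / 2)"
  proof -
    have "cw (card C) \<theta> k * ?h (2 * real k - ?R) = real (card C choose k) * exp (\<theta> * ?R\<^sup>2 / 2)" for k
      by (simp add: cw_def exp_add[symmetric] algebra_simps diff_divide_distrib)
    moreover have "(\<Sum>k\<le>card C. real (card C choose k)) = 2 ^ card C"
      using choose_row_sum[of "card C"] by (metis of_nat_sum of_nat_power of_nat_numeral)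
    ultimately show ?thesis by (simp add: sum_distrib_right[symmetric])
  qed
  also have "\<dots> / (\<Sum>k\<le>card C. cw (card C) \<theta> k) \<le> 2 ^ card C"
  proof -
    have "cw (card C) \<theta> (card C) \<le> (\<Sum>k\<le>card C. cw (card C) \<theta> k)"
      by (intro member_le_sum) (auto simp: cw_nonneg)
    moreover have "cw (card C) \<theta> (card C) = exp (\<theta> * ?R\<^sup>2 / 2)" by (simp add: cw_def)
    moreover have "0 < exp (\<theta> * ?R\<^sup>2 / 2)" by simp
    ultimately show ?thesis by (subst pos_divide_le_eq) (auto intro: less_le_trans simp del: exp_gt_zero)
  qed
  finally have Eh: "?E (\<lambda>x. ?h (mag C x)) \<le> 2 ^ card C" .
  have "?E (\<lambda>x. \<theta> * (?R\<^sup>2 - (mag C x)\<^sup>2) / 2) \<le> ?E (\<lambda>x. ?h (mag C x) / 2 ^ card C + (?R * ln 2 - 1))"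
  proof (rule gexp_mono)
    fix x
    let ?y = "\<theta> * (?R\<^sup>2 - (mag C x)\<^sup>2) / 2"
    have "ln (exp ?y / 2 ^ card C) \<le> exp ?y / 2 ^ card C - 1" by (intro ln_le_minus_one) simp
    moreover have "ln (exp ?y / 2 ^ card C) = ?y - ?R * ln 2" by (simp add: ln_div ln_realpow)
    ultimately show "?y \<le> exp ?y / 2 ^ card C + (?R * ln 2 - 1)" by linarith
  qed
  also have "\<dots> = ?E (\<lambda>x. ?h (mag C x)) / 2 ^ card C + (?R * ln 2 - 1)"
    by (simp only: gexp_add gexp_divide gexp_const)
  also have "\<dots> \<le> ?R * ln 2" using Eh by (simp add: divide_le_eq)
  also have "?E (\<lambda>x. \<theta> * (?R\<^sup>2 - (mag C x)\<^sup>2) / 2) = \<theta> * (?R\<^sup>2 - ?E (\<lambda>x. (mag C x)\<^sup>2)) / 2"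
    by (simp only: gexp_divide gexp_cmult gexp_diff gexp_const)
  also have "\<dots> = ?R * (\<theta> * (?R - 1) * (1 - \<rho>) / 2)" unfolding M2 by (simp add: power2_eq_square field_simps)
  finally have "\<theta> * (?R - 1) * (1 - \<rho>) / 2 \<le> ln 2" using C(2) by (subst (asm) mult_le_cancel_left_pos) auto
  moreover have "0 < \<theta> * (?R - 1)" using \<theta> C(2) by simp
  ultimately have "1 - \<rho> \<le> 2 * ln 2 / (\<theta> * (?R - 1))" by (simp add: pos_le_divide_eq mult_ac)
  then show ?thesis using \<rho>[OF uw] by simp
qed

text \<open>By exchangeability the magnetization of a part of the graph deviates from its share of the total magnetization
only by a fluctuation of the order of the square root of the size.\<close>

lemma mag_subset_close:
  assumes C: "C \<subseteq> {1..d}" and J: "J \<subseteq> C" and \<theta>: "0 \<le> \<theta>"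
  shows "gexp d \<theta> (pairs C) (\<lambda>x. \<bar>tanh (\<theta> * mag J x) - tanh (\<theta> * (real (card J) / real (card C)) * mag C x)\<bar>)
     \<le> \<theta> * sqrt (2 * real (card C))"
proof -
  let ?E = "gexp d \<theta> (pairs C)" and ?r = "real (card J) / real (card C)"
  have fin: "finite C" "finite J" using C J finite_subset by (metis finite_atLeastAtMost)+
  obtain \<rho> where \<rho>1: "\<bar>\<rho>\<bar> \<le> 1" and \<rho>: "\<And>u w. u \<in> C \<Longrightarrow> w \<in> C \<Longrightarrow> u \<noteq> w \<Longrightarrow> ?E (\<lambda>x. x u * x w) = \<rho>"
    using complete_graph_exchangeable[OF C] by metis
  \<comment> \<open>coefficients with sum 0, which removes the contribution of the common correlation \<open>\<rho>\<close>\<close>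
  define a where "a v = of_bool (v \<in> J) - ?r" for v
  have r: "0 \<le> ?r" "?r \<le> 1" using card_mono[OF fin(1) J] by (auto simp: divide_le_eq_1)
  have sumJ: "(\<Sum>v\<in>C. of_bool (v \<in> J) * y v) = mag J y" for y :: "nat \<Rightarrow> real"
  proof -
    have "(\<Sum>v\<in>C. of_bool (v \<in> J) * y v) = (\<Sum>v\<in>J. of_bool (v \<in> J) * y v)"
      by (rule sum.mono_neutral_right[OF fin(1) J]) auto
    then show ?thesis by simp
  qed
  have lin: "(\<Sum>v\<in>C. a v * x v) = mag J x - ?r * mag C x" for x :: "nat \<Rightarrow> real"
    unfolding a_def left_diff_distrib sum_subtractf sumJ by (simp add: sum_distrib_left)
  have "(\<Sum>v\<in>C. a v) = 0"
  proof (cases "C = {}")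
    case False
    have "(\<Sum>v\<in>C. a v * 1) = mag J (\<lambda>_. 1) - ?r * mag C (\<lambda>_. 1)" by (rule lin)
    then show ?thesis using False fin by simp
  qed simp
  moreover have "(\<Sum>v\<in>C. (a v)\<^sup>2) \<le> (\<Sum>v\<in>C. 1)"
    using r by (intro sum_mono) (auto simp: a_def abs_square_le_1)
  moreover have "0 \<le> (\<Sum>v\<in>C. (a v)\<^sup>2)" by (intro sum_nonneg) auto
  moreover have "?E (\<lambda>x. (\<Sum>v\<in>C. a v * x v)\<^sup>2) = \<rho> * (\<Sum>v\<in>C. a v)\<^sup>2 + (1 - \<rho>) * (\<Sum>v\<in>C. (a v)\<^sup>2)"
    by (rule gexp_linear_square[OF C \<rho>])
  ultimately have "?E (\<lambda>x. (\<Sum>v\<in>C. a v * x v)\<^sup>2) \<le> 2 * real (card C)"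
    using \<rho>1 mult_mono[of "1 - \<rho>" 2 "\<Sum>v\<in>C. (a v)\<^sup>2" "real (card C)"] by simp
  then have "sqrt (?E (\<lambda>x. (\<Sum>v\<in>C. a v * x v)\<^sup>2)) \<le> sqrt (2 * real (card C))" by (rule real_sqrt_le_mono)
  with gexp_abs_le_sqrt[of d \<theta> "pairs C" "\<lambda>x. \<Sum>v\<in>C. a v * x v"]
  have E: "?E (\<lambda>x. \<bar>\<Sum>v\<in>C. a v * x v\<bar>) \<le> sqrt (2 * real (card C))" by linarith
  have "?E (\<lambda>x. \<bar>tanh (\<theta> * mag J x) - tanh (\<theta> * ?r * mag C x)\<bar>) \<le> ?E (\<lambda>x. \<theta> * \<bar>\<Sum>v\<in>C. a v * x v\<bar>)"
  proof (rule gexp_mono)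
    fix x
    have "\<bar>tanh (\<theta> * mag J x) - tanh (\<theta> * ?r * mag C x)\<bar> \<le> \<bar>\<theta> * mag J x - \<theta> * ?r * mag C x\<bar>"
      by (rule tanh_lipschitz)
    also have "\<dots> = \<theta> * \<bar>\<Sum>v\<in>C. a v * x v\<bar>"
    proof -
      have "\<theta> * mag J x - \<theta> * ?r * mag C x = \<theta> * (mag J x - ?r * mag C x)" by (simp add: right_diff_distrib)
      then show ?thesis unfolding lin using \<theta> by (simp only: abs_mult abs_of_nonneg)
    qed
    finally show "\<bar>tanh (\<theta> * mag J x) - tanh (\<theta> * ?r * mag C x)\<bar> \<le> \<theta> * \<bar>\<Sum>v\<in>C. a v * x v\<bar>" .
  qed
  also have "\<dots> = \<theta> * ?E (\<lambda>x. \<bar>\<Sum>v\<in>C. a v * x v\<bar>)" by (rule gexp_cmult)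
  also have "\<dots> \<le> \<theta> * sqrt (2 * real (card C))" using E \<theta> by (rule mult_left_mono)
  finally show ?thesis .
qed

lemma tanh_abs_le_1: "\<bar>tanh (x::real)\<bar> \<le> 1"
  using tanh_real_bounds[of x] by (auto simp: greaterThanLessThan_iff)

lemma abs_product_diff:
  fixes a b c e :: real
  assumes "\<bar>b\<bar> \<le> 1" "\<bar>c\<bar> \<le> 1"
  shows "\<bar>a * b - c * e\<bar> \<le> \<bar>a - c\<bar> + \<bar>b - e\<bar>"
proof -
  have "a * b - c * e = (a - c) * b + c * (b - e)" by (simp add: algebra_simps)
  then have "\<bar>a * b - c * e\<bar> \<le> \<bar>a - c\<bar> * \<bar>b\<bar> + \<bar>c\<bar> * \<bar>b - e\<bar>"
    by (metis abs_mult abs_triangle_ineq)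
  also have "\<dots> \<le> \<bar>a - c\<bar> * 1 + 1 * \<bar>b - e\<bar>"
    using assms by (intro add_mono mult_left_mono mult_right_mono) auto
  finally show ?thesis by simp
qed

text \<open>The product of two local fields is an even function of the magnetization with Lipschitz constant of order \<open>\<theta>\<close>, up
to the fluctuation of the magnetization of subsets. So it concentrates because the absolute magnetization does;
when \<open>\<theta> * card C\<close> is bounded, an error of \<open>s * card C\<close> in the magnetization changes it only by order \<open>s\<close>.\<close>

lemma complete_graph_local_fields:
  fixes B \<eta> :: real
  assumes B: "0 < B" and \<eta>: "0 < \<eta>"
  obtains R0 :: nat where "\<And>d C J1 J2 \<theta>. C \<subseteq> {1..d} \<Longrightarrow> R0 \<le> card C \<Longrightarrow> J1 \<subseteq> C \<Longrightarrow> J2 \<subseteq> C \<Longrightarrow>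
     0 \<le> \<theta> \<Longrightarrow> \<theta> * real (card C) \<le> B \<Longrightarrow>
     \<exists>y. gexp d \<theta> (pairs C) (\<lambda>x. \<bar>tanh (\<theta> * mag J1 x) * tanh (\<theta> * mag J2 x) - y\<bar>) \<le> \<eta>"
proof -
  define s where "s = min 1 (\<eta> / (4 * (B + 1)))"
  define \<delta> where "\<delta> = s\<^sup>2"
  have s: "0 < s" "s \<le> 1" "s \<le> \<eta> / (4 * (B + 1))" using B \<eta> by (auto simp: s_def)
  have \<delta>: "0 < \<delta>" "\<delta> \<le> s" "sqrt \<delta> = s"
    using s by (auto simp: \<delta>_def power2_eq_square mult_left_le_one_le)
  have "((\<lambda>R. (R + 1) * exp (1/3 - \<delta>\<^sup>2 * R ^ 4 / (12 * (R + 1) ^ 3))) \<longlongrightarrow> 0) at_top"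
    using \<delta>(1) by real_asymp
  then have "eventually (\<lambda>R. (R + 1) * exp (1/3 - \<delta>\<^sup>2 * R ^ 4 / (12 * (R + 1) ^ 3)) < \<delta>) at_top"
    using \<delta>(1) by (rule order_tendstoD(2))
  then obtain r where r: "\<And>R. r \<le> R \<Longrightarrow> (R + 1) * exp (1/3 - \<delta>\<^sup>2 * R ^ 4 / (12 * (R + 1) ^ 3)) < \<delta>"
    unfolding eventually_at_top_linorder by auto
  define R0 where "R0 = nat \<lceil>max 1 (max r (32 * B\<^sup>2 / \<eta>\<^sup>2))\<rceil>"
  have R0: "1 \<le> real R0" "r \<le> real R0" "32 * B\<^sup>2 / \<eta>\<^sup>2 \<le> real R0" unfolding R0_def by linarith+
  show ?thesis
  proof (rule that[of R0])
    fix d :: nat and C J1 J2 and \<theta> :: real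
    assume C: "C \<subseteq> {1..d}" "R0 \<le> card C" and J: "J1 \<subseteq> C" "J2 \<subseteq> C" and \<theta>: "0 \<le> \<theta>" "\<theta> * real (card C) \<le> B"
    let ?R = "real (card C)" and ?E = "gexp d \<theta> (pairs C)"
    have R: "1 \<le> ?R" "r \<le> ?R" "32 * B\<^sup>2 / \<eta>\<^sup>2 \<le> ?R" using R0 C(2) by linarith+
    have fin: "finite C" using C finite_subset by blast
    obtain z where z: "0 \<le> z" "?E (\<lambda>x. of_bool (\<delta> * ?R\<^sup>2 < \<bar>(mag C x)\<^sup>2 - z\<^sup>2\<bar>)) \<le> \<delta>"
      using cw_concentration[OF C(1) less_imp_le[OF \<delta>(1)], of \<theta>] r[OF R(2)] by (smt (verit))
    define \<alpha> where "\<alpha> J = \<theta> * (real (card J) / ?R)" for J :: "nat set"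
    have \<alpha>: "0 \<le> \<alpha> J" "\<alpha> J \<le> \<theta>" if "J \<subseteq> C" for J
    proof -
      have "real (card J) / ?R \<le> 1" using card_mono[OF fin that] R(1) by (simp add: divide_le_eq_1)
      then show "0 \<le> \<alpha> J" "\<alpha> J \<le> \<theta>" using \<theta> mult_left_mono[of "real (card J) / ?R" 1 \<theta>] by (auto simp: \<alpha>_def)
    qed
    let ?y = "tanh (\<alpha> J1 * z) * tanh (\<alpha> J2 * z)"
    let ?bad = "\<lambda>x. of_bool (\<delta> * ?R\<^sup>2 < \<bar>(mag C x)\<^sup>2 - z\<^sup>2\<bar>) :: real"
    let ?g = "\<lambda>J x. \<bar>tanh (\<theta> * mag J x) - tanh (\<theta> * (real (card J) / ?R) * mag C x)\<bar>"
    have "?E (\<lambda>x. \<bar>tanh (\<theta> * mag J1 x) * tanh (\<theta> * mag J2 x) - ?y\<bar>)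
       \<le> ?E (\<lambda>x. (?g J1 x + ?g J2 x) + (2 * B * s + 2 * ?bad x))"
    proof (rule gexp_mono)
      fix x
      have t1: "\<bar>tanh (\<theta> * mag J1 x) * tanh (\<theta> * mag J2 x) - tanh (\<alpha> J1 * mag C x) * tanh (\<alpha> J2 * mag C x)\<bar>
        \<le> ?g J1 x + ?g J2 x"
        unfolding \<alpha>_def by (rule abs_product_diff) (rule tanh_abs_le_1)+
      have even: "tanh (a * m) * tanh (b * m) = tanh (a * \<bar>m\<bar>) * tanh (b * \<bar>m\<bar>)" for a b m :: real
        by (cases "0 \<le> m") auto
      have t2: "\<bar>tanh (\<alpha> J1 * mag C x) * tanh (\<alpha> J2 * mag C x) - ?y\<bar> \<le> 2 * B * s + 2 * ?bad x"
      proof (cases "\<delta> * ?R\<^sup>2 < \<bar>(mag C x)\<^sup>2 - z\<^sup>2\<bar>")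
        case True
        have p: "\<bar>a * b\<bar> \<le> 1" if "\<bar>a\<bar> \<le> 1" "\<bar>b\<bar> \<le> 1" for a b :: real
          using that mult_mono[of "\<bar>a\<bar>" 1 "\<bar>b\<bar>" 1] by (simp add: abs_mult)
        have "\<bar>tanh (\<alpha> J1 * mag C x) * tanh (\<alpha> J2 * mag C x)\<bar> \<le> 1" "\<bar>?y\<bar> \<le> 1"
          by (intro p tanh_abs_le_1)+
        then have "\<bar>tanh (\<alpha> J1 * mag C x) * tanh (\<alpha> J2 * mag C x) - ?y\<bar> \<le> 2" by linarith
        moreover have "0 \<le> 2 * B * s" using B s by simp
        ultimately show ?thesis using True by simp
      next
        case False
        let ?m = "\<bar>mag C x\<bar>"
        have "(?m - z)\<^sup>2 \<le> \<bar>?m - z\<bar> * \<bar>?m + z\<bar>"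
        proof -
          have "\<bar>?m - z\<bar> \<le> \<bar>?m + z\<bar>" using z(1) by linarith
          then have "\<bar>?m - z\<bar> * \<bar>?m - z\<bar> \<le> \<bar>?m - z\<bar> * \<bar>?m + z\<bar>" by (intro mult_left_mono) auto
          then show ?thesis by (simp only: power2_eq_square abs_mult_self_eq)
        qed
        also have "\<dots> = \<bar>(mag C x)\<^sup>2 - z\<^sup>2\<bar>"
          by (simp add: abs_mult[symmetric] power2_eq_square algebra_simps)
        also have "\<dots> \<le> \<delta> * ?R\<^sup>2" using False by simp
        also have "\<dots> = (s * ?R)\<^sup>2" by (simp add: \<delta>_def power_mult_distrib)
        finally have "\<bar>?m - z\<bar> \<le> \<bar>s * ?R\<bar>" by (simp only: abs_le_square_iff)
        then have mz: "\<bar>?m - z\<bar> \<le> s * ?R" using s by simp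
        have tl: "\<bar>tanh (\<alpha> J * ?m) - tanh (\<alpha> J * z)\<bar> \<le> B * s" if "J \<subseteq> C" for J
        proof -
          have "\<bar>tanh (\<alpha> J * ?m) - tanh (\<alpha> J * z)\<bar> \<le> \<bar>\<alpha> J * ?m - \<alpha> J * z\<bar>" by (rule tanh_lipschitz)
          also have "\<dots> = \<alpha> J * \<bar>?m - z\<bar>" using \<alpha>[OF that] by (metis abs_mult abs_of_nonneg right_diff_distrib)
          also have "\<dots> \<le> \<theta> * (s * ?R)" using \<alpha>[OF that] mz by (intro mult_mono) auto
          also have "\<dots> = (\<theta> * ?R) * s" by simp
          also have "\<dots> \<le> B * s" using \<theta> s by (intro mult_right_mono) auto
          finally show ?thesis .
        qed
        have "\<bar>tanh (\<alpha> J1 * ?m) * tanh (\<alpha> J2 * ?m) - ?y\<bar>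
          \<le> \<bar>tanh (\<alpha> J1 * ?m) - tanh (\<alpha> J1 * z)\<bar> + \<bar>tanh (\<alpha> J2 * ?m) - tanh (\<alpha> J2 * z)\<bar>"
          by (rule abs_product_diff) (rule tanh_abs_le_1)+
        then show ?thesis using tl[OF J(1)] tl[OF J(2)] False
          unfolding even[of "\<alpha> J1" "mag C x" "\<alpha> J2"] by simp
      qed
      show "\<bar>tanh (\<theta> * mag J1 x) * tanh (\<theta> * mag J2 x) - ?y\<bar>
         \<le> (?g J1 x + ?g J2 x) + (2 * B * s + 2 * ?bad x)"
        using t1 t2 by linarith
    qed
    also have "\<dots> = (?E (?g J1) + ?E (?g J2)) + (2 * B * s + 2 * ?E ?bad)"
      by (simp only: gexp_add gexp_cmult gexp_const)
    also have "\<dots> \<le> 2 * (\<theta> * sqrt (2 * ?R)) + (2 * B * s + 2 * \<delta>)"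
      using mag_subset_close[OF C(1) J(1) \<theta>(1)] mag_subset_close[OF C(1) J(2) \<theta>(1)] z(2) by linarith
    also have "2 * B * s + 2 * \<delta> \<le> \<eta> / 2"
    proof -
      have "2 * B * s + 2 * \<delta> \<le> 2 * (B + 1) * s" using \<delta> by (simp add: algebra_simps)
      also have "\<dots> \<le> 2 * (B + 1) * (\<eta> / (4 * (B + 1)))" using s B by (intro mult_left_mono) auto
      also have "\<dots> = \<eta> / 2" using B by (simp add: field_simps)
      finally show ?thesis .
    qed
    also have "2 * (\<theta> * sqrt (2 * ?R)) \<le> \<eta> / 2"
    proof -
      have "\<theta> * sqrt (2 * ?R) \<le> B / ?R * sqrt (2 * ?R)"
        using \<theta> R by (intro mult_right_mono) (auto simp: pos_le_divide_eq)
      also have "\<dots> = sqrt (2 * B\<^sup>2 / ?R)"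
      proof -
        have "(B / ?R * sqrt (2 * ?R))\<^sup>2 = 2 * B\<^sup>2 / ?R"
          using R by (simp add: power_mult_distrib power_divide) (simp add: power2_eq_square)
        then show ?thesis using B by (intro real_sqrt_unique[symmetric]) auto
      qed
      also have "\<dots> \<le> sqrt ((\<eta> / 4)\<^sup>2)"
      proof (rule real_sqrt_le_mono)
        have "32 * B\<^sup>2 \<le> ?R * \<eta>\<^sup>2" using R(3) \<eta> by (simp add: pos_divide_le_eq)
        then show "2 * B\<^sup>2 / ?R \<le> (\<eta> / 4)\<^sup>2" using R(1) by (simp add: pos_divide_le_eq power_divide field_simps)
      qed
      also have "\<dots> = \<eta> / 4" using \<eta> by simp
      finally show ?thesis by simp
    qed
    finally show "\<exists>y. ?E (\<lambda>x. \<bar>tanh (\<theta> * mag J1 x) * tanh (\<theta> * mag J2 x) - y\<bar>) \<le> \<eta>"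
      by (intro exI[of _ ?y]) simp
  qed
qed

section \<open>A complete core with a bounded periphery\<close>

text \<open>Given all other spins, the spin at \<open>s\<close> has mean \<open>tanh\<close> of its local field: the configurations that differ at \<open>s\<close> only
cancel in pairs.\<close>

lemma gexp_spin_average:
  assumes F: "F \<subseteq> pairs {1..d}" and s: "s \<in> {1..d}" and J: "J \<subseteq> {1..d} - {s}"
    and star: "{e \<in> F. s \<in> e} = (\<lambda>u. {s, u}) ` J"
    and f: "\<And>x a. f (x(s := a)) = f x"
  shows "gexp d \<theta> F (\<lambda>x. x s * f x) = gexp d \<theta> F (\<lambda>x. tanh (\<theta> * mag J x) * f x)"
proof -
  let ?w = "\<lambda>x. exp (\<theta> * (\<Sum>e\<in>F. chi e x))"
  let ?a = "\<lambda>x. \<Sum>e\<in>{e \<in> F. s \<notin> e}. chi e x"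
  let ?M = "mag J"
  let ?g = "\<lambda>x. ?w x * ((x s - tanh (\<theta> * ?M x)) * f x)"
  let ?fl = "\<lambda>x :: nat \<Rightarrow> real. x(s := - x s)"
  have fin: "finite F" using F finite_edge_set by blast
  have finJ: "finite J" using J finite_subset by blast
  have energy: "(\<Sum>e\<in>F. chi e x) = ?a x + x s * ?M x" for x :: "nat \<Rightarrow> real"
  proof -
    have "(\<Sum>e\<in>F. chi e x) = ?a x + (\<Sum>e\<in>{e \<in> F. s \<in> e}. chi e x)"
      using fin by (subst sum.union_disjoint[symmetric]) (auto intro: sum.cong)
    also have "(\<Sum>e\<in>{e \<in> F. s \<in> e}. chi e x) = (\<Sum>u\<in>J. chi {s, u} x)"
      unfolding star by (subst sum.reindex) (auto simp: inj_on_def doubleton_eq_iff)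
    also have "\<dots> = (\<Sum>u\<in>J. x s * x u)"
    proof (intro sum.cong refl)
      fix u assume "u \<in> J"
      then have "s \<noteq> u" using J by auto
      then show "chi {s, u} x = x s * x u" by simp
    qed
    finally show ?thesis by (simp add: sum_distrib_left)
  qed
  have a_fl: "?a (?fl x) = ?a x" for x by (intro sum.cong prod.cong refl) auto
  have M_fl: "?M (?fl x) = ?M x" for x using J by (intro sum.cong) auto
  have cancel: "?g x + ?g (?fl x) = 0" if x: "x \<in> spins d" for x
  proof -
    have e: "exp y * (1 - tanh y) = exp (- y) * (1 + tanh y)" for y :: real
    proof -
      have "exp y = cosh y + sinh y" "exp (- y) = cosh y - sinh y"
        by (simp_all add: cosh_plus_sinh cosh_minus_sinh)
      then have "1 - tanh y = exp (- y) / cosh y" "1 + tanh y = exp y / cosh y"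
        using cosh_real_nonzero[of y] by (simp_all add: tanh_def divide_simps)
      then show ?thesis by simp
    qed
    have "?g x + ?g (?fl x) = exp (\<theta> * ?a x) * f x *
       (exp (\<theta> * (x s * ?M x)) * (x s - tanh (\<theta> * ?M x)) + exp (- (\<theta> * (x s * ?M x))) * (- x s - tanh (\<theta> * ?M x)))"
      unfolding energy a_fl M_fl f by (simp add: ring_distribs exp_add exp_diff exp_minus field_simps)
    also have "exp (\<theta> * (x s * ?M x)) * (x s - tanh (\<theta> * ?M x)) + exp (- (\<theta> * (x s * ?M x))) * (- x s - tanh (\<theta> * ?M x)) = 0"
      using spins_value[OF x s] e[of "\<theta> * ?M x"] by (auto simp: algebra_simps)
    finally show ?thesis by (simp only: mult_zero_right)
  qed
  have "(\<Sum>x\<in>spins d. ?g x) = (\<Sum>x\<in>spins d. ?g (?fl x))"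
  proof (rule sum.reindex_bij_witness[of _ ?fl ?fl])
    show fl: "?fl x \<in> spins d" if "x \<in> spins d" for x
      using spins_value[OF that s] by (intro spins_upd that s) auto
    show "?fl x \<in> spins d" if "x \<in> spins d" for x by (rule fl[OF that])
  qed simp_all
  then have "2 * (\<Sum>x\<in>spins d. ?g x) = (\<Sum>x\<in>spins d. ?g x + ?g (?fl x))" by (simp only: sum.distrib)
  also have "\<dots> = (\<Sum>x\<in>spins d. 0)" by (rule sum.cong[OF refl cancel])
  finally have "(\<Sum>x\<in>spins d. ?g x) = 0" by simp
  moreover have "gexp d \<theta> F (\<lambda>x. (x s - tanh (\<theta> * ?M x)) * f x) = (\<Sum>x\<in>spins d. ?g x) / ising_Z d \<theta> ({1..d}, F)"
    by (simp add: gexp_def gibbs_def gibbs_weight sum_divide_distrib)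
  ultimately have "gexp d \<theta> F (\<lambda>x. x s * f x - tanh (\<theta> * ?M x) * f x) = 0"
    by (simp add: left_diff_distrib)
  then show ?thesis unfolding gexp_diff by simp
qed

lemma edge_sum_abs_le:
  assumes "finite D" "D \<subseteq> pairs {1..d}" "x \<in> spins d"
  shows "\<bar>\<Sum>e\<in>D. chi e x\<bar> \<le> real (card D)"
proof -
  have "\<bar>\<Sum>e\<in>D. chi e x\<bar> \<le> (\<Sum>e\<in>D. \<bar>chi e x\<bar>)" by (rule sum_abs)
  also have "\<dots> = (\<Sum>e\<in>D. 1)"
    using chi_abs[OF assms(3)] pairs_subset[OF assms(2)] by (intro sum.cong) auto
  finally show ?thesis by simp
qed

lemma gexp_add_edges_le:
  assumes F: "F \<subseteq> pairs {1..d}" and D: "D \<subseteq> pairs {1..d}" "F \<inter> D = {}" and \<theta>: "0 \<le> \<theta>"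
    and c: "\<theta> * real (card D) \<le> c"
    and f: "\<And>x. x \<in> spins d \<Longrightarrow> 0 \<le> f x"
  shows "gexp d \<theta> (F \<union> D) f \<le> exp (2 * c) * gexp d \<theta> F f"
proof -
  let ?h = "\<lambda>x. exp (\<theta> * (\<Sum>e\<in>D. chi e x))"
  have h: "exp (- c) \<le> ?h x" "?h x \<le> exp c" if "x \<in> spins d" for x
  proof -
    have "\<bar>\<theta> * (\<Sum>e\<in>D. chi e x)\<bar> \<le> \<theta> * real (card D)"
      using edge_sum_abs_le[OF finite_edge_set[OF D(1)] D(1) that] \<theta> by (simp add: abs_mult mult_left_mono)
    then have "\<bar>\<theta> * (\<Sum>e\<in>D. chi e x)\<bar> \<le> c" using c by linarith
    then show "exp (- c) \<le> ?h x" "?h x \<le> exp c" by auto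
  qed
  have Eh: "exp (- c) \<le> gexp d \<theta> F ?h" using gexp_mono[of d "\<lambda>_. exp (- c)" ?h \<theta> F] h by simp
  have "gexp d \<theta> F (\<lambda>x. ?h x * f x) \<le> gexp d \<theta> F (\<lambda>x. exp c * f x)"
    using h f by (intro gexp_mono mult_right_mono) auto
  then have num: "gexp d \<theta> F (\<lambda>x. ?h x * f x) \<le> exp c * gexp d \<theta> F f" by (simp add: gexp_cmult)
  have f0: "0 \<le> gexp d \<theta> F f" by (rule gexp_nonneg[OF f])
  have "gexp d \<theta> (F \<union> D) f = gexp d \<theta> F (\<lambda>x. ?h x * f x) / gexp d \<theta> F ?h"
    by (rule gexp_tilt[OF F D])
  also have "\<dots> \<le> (exp c * gexp d \<theta> F f) / exp (- c)"
    using num Eh f0 by (intro frac_le) auto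
  also have "\<dots> = exp (2 * c) * gexp d \<theta> F f"
  proof -
    have "exp (2 * c) = exp c * exp c" by (simp flip: exp_add)
    then show ?thesis by (simp add: exp_minus field_simps)
  qed
  finally show ?thesis .
qed

text \<open>The density of the larger model with respect to the smaller one is at most \<open>exp (2 * c)\<close>; it is applied to the
nonnegative functions \<open>1 + f\<close> and \<open>1 - f\<close>.\<close>

lemma gexp_add_edges_close:
  assumes F: "F \<subseteq> pairs {1..d}" and D: "D \<subseteq> pairs {1..d}" "F \<inter> D = {}" and \<theta>: "0 \<le> \<theta>"
    and c: "\<theta> * real (card D) \<le> c"
    and f: "\<And>x. x \<in> spins d \<Longrightarrow> \<bar>f x\<bar> \<le> 1"
  shows "\<bar>gexp d \<theta> (F \<union> D) f - gexp d \<theta> F f\<bar> \<le> 2 * (exp (2 * c) - 1)"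
proof -
  let ?E = "gexp d \<theta> F" and ?E' = "gexp d \<theta> (F \<union> D)"
  let ?c = "exp (2 * c)"
  have "0 \<le> \<theta> * real (card D)" using \<theta> by simp
  then have c1: "1 \<le> ?c" using c by simp
  have up: "?E' (\<lambda>x. 1 + f x) \<le> ?c * ?E (\<lambda>x. 1 + f x)"
    using f by (intro gexp_add_edges_le[OF F D \<theta> c]) (smt (verit) abs_le_D2)
  have dn: "?E' (\<lambda>x. 1 - f x) \<le> ?c * ?E (\<lambda>x. 1 - f x)"
    using f by (intro gexp_add_edges_le[OF F D \<theta> c]) (smt (verit) abs_le_D1)
  have E1: "\<bar>?E f\<bar> \<le> 1" by (rule gexp_abs_le1[OF f])
  have "?E' f - ?E f \<le> (?c - 1) * (1 + ?E f)"
    using up by (simp add: gexp_add algebra_simps)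
  also have "\<dots> \<le> (?c - 1) * 2" using c1 E1 by (intro mult_left_mono) auto
  finally have a: "?E' f - ?E f \<le> 2 * (?c - 1)" by simp
  have "?E f - ?E' f \<le> (?c - 1) * (1 - ?E f)"
    using dn by (simp add: gexp_diff algebra_simps)
  also have "\<dots> \<le> (?c - 1) * 2" using c1 E1 by (intro mult_left_mono) auto
  finally have b: "?E f - ?E' f \<le> 2 * (?c - 1)" by simp
  show ?thesis using a b by linarith
qed

definition core_graph :: "nat set \<Rightarrow> nat set \<Rightarrow> (nat \<Rightarrow> nat set) \<Rightarrow> nat set set" where
  "core_graph C S J = pairs C \<union> (\<Union>s\<in>S. (\<lambda>u. {s, u}) ` J s)"

text \<open>The shape of every graph met while the complete graph is filled up: the complete graph on the core \<open>C\<close>, with every peripheral vertex \<open>s\<close> joined to the part \<open>J s\<close> of the core.\<close>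

locale core_periphery =
  fixes d :: nat and C S :: "nat set" and J :: "nat \<Rightarrow> nat set" and \<theta> :: real
  assumes C: "C \<subseteq> {1..d}" and S: "S \<subseteq> {1..d}" and CS: "C \<inter> S = {}"
    and J: "\<And>s. s \<in> S \<Longrightarrow> J s \<subseteq> C" and \<theta>: "0 \<le> \<theta>"
begin

abbreviation field :: "nat \<Rightarrow> (nat \<Rightarrow> real) \<Rightarrow> real" where
  "field s x \<equiv> tanh (\<theta> * mag (J s) x)"

abbreviation E0 :: "((nat \<Rightarrow> real) \<Rightarrow> real) \<Rightarrow> real" where
  "E0 \<equiv> gexp d \<theta> (core_graph C S J)"

lemma core_graph_pairs: "core_graph C S J \<subseteq> pairs {1..d}"
proof -
  have "{s, u} \<in> pairs {1..d}" if "s \<in> S" "u \<in> J s" for s u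
  proof -
    have "s \<noteq> u" "u \<in> C" using that J CS by auto
    then show ?thesis using that C S by (auto simp: pairs_def)
  qed
  then show ?thesis using pairs_mono[OF C] by (auto simp: core_graph_def)
qed

lemma star_eq:
  assumes s: "s \<in> S" shows "{e \<in> core_graph C S J. s \<in> e} = (\<lambda>u. {s, u}) ` J s"
proof
  show "{e \<in> core_graph C S J. s \<in> e} \<subseteq> (\<lambda>u. {s, u}) ` J s"
  proof
    fix e assume e: "e \<in> {e \<in> core_graph C S J. s \<in> e}"
    then have "e \<notin> pairs C" using s CS by (auto simp: pairs_def)
    then obtain s' u where su: "s' \<in> S" "u \<in> J s'" "e = {s', u}" using e by (auto simp: core_graph_def)
    then have "u \<notin> S" using J CS by auto
    then have "s = s'" using e su s by auto
    then show "e \<in> (\<lambda>u. {s, u}) ` J s" using su by auto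
  qed
  show "(\<lambda>u. {s, u}) ` J s \<subseteq> {e \<in> core_graph C S J. s \<in> e}" using s by (auto simp: core_graph_def)
qed

lemma spin_average:
  assumes s: "s \<in> S" and f: "\<And>x a. f (x(s := a)) = f x"
  shows "E0 (\<lambda>x. x s * f x) = E0 (\<lambda>x. field s x * f x)"
proof (rule gexp_spin_average[OF core_graph_pairs _ _ star_eq[OF s] f])
  show "s \<in> {1..d}" using s S by auto
  show "J s \<subseteq> {1..d} - {s}" using J[OF s] C CS s by auto
qed

lemma mag_upd: "s \<in> S \<Longrightarrow> t \<in> S \<Longrightarrow> (\<Sum>v\<in>J t. if v = s then a else x v) = mag (J t) x"
  using J CS by (intro sum.cong) auto

lemma spin_average_two:
  assumes "s1 \<in> S" "s2 \<in> S" "s1 \<noteq> s2"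
  shows "E0 (\<lambda>x. x s1 * x s2) = E0 (\<lambda>x. field s1 x * field s2 x)"
proof -
  have "E0 (\<lambda>x. x s1 * x s2) = E0 (\<lambda>x. field s1 x * x s2)"
    using assms by (intro spin_average) auto
  also have "\<dots> = E0 (\<lambda>x. x s2 * field s1 x)" by (simp only: mult.commute)
  also have "\<dots> = E0 (\<lambda>x. field s2 x * field s1 x)"
    using assms by (intro spin_average) (auto simp: mag_upd)
  finally show ?thesis by (simp only: mult.commute)
qed

lemma spin_average_four:
  assumes "{s1, s2, s3, s4} \<subseteq> S" "distinct [s1, s2, s3, s4]"
  shows "E0 (\<lambda>x. (x s1 * x s2) * (x s3 * x s4)) = E0 (\<lambda>x. (field s1 x * field s2 x) * (field s3 x * field s4 x))"
proof -
  have "E0 (\<lambda>x. (x s1 * x s2) * (x s3 * x s4)) = E0 (\<lambda>x. x s1 * (x s2 * x s3 * x s4))"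
    by (simp only: mult_ac)
  also have "\<dots> = E0 (\<lambda>x. field s1 x * (x s2 * x s3 * x s4))"
    using assms by (intro spin_average) auto
  also have "\<dots> = E0 (\<lambda>x. x s2 * (field s1 x * x s3 * x s4))" by (simp only: mult_ac)
  also have "\<dots> = E0 (\<lambda>x. field s2 x * (field s1 x * x s3 * x s4))"
    using assms by (intro spin_average) (auto simp: mag_upd)
  also have "\<dots> = E0 (\<lambda>x. x s3 * (field s1 x * field s2 x * x s4))" by (simp only: mult_ac)
  also have "\<dots> = E0 (\<lambda>x. field s3 x * (field s1 x * field s2 x * x s4))"
    using assms by (intro spin_average) (auto simp: mag_upd)
  also have "\<dots> = E0 (\<lambda>x. x s4 * (field s1 x * field s2 x * field s3 x))" by (simp only: mult_ac)
  also have "\<dots> = E0 (\<lambda>x. field s4 x * (field s1 x * field s2 x * field s3 x))"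
    using assms by (intro spin_average) (auto simp: mag_upd)
  finally show ?thesis by (simp only: mult_ac)
qed

lemma abs_product_le_1: "\<bar>a\<bar> \<le> 1 \<Longrightarrow> \<bar>b\<bar> \<le> 1 \<Longrightarrow> \<bar>a * b :: real\<bar> \<le> 1"
  using mult_mono[of "\<bar>a\<bar>" 1 "\<bar>b\<bar>" 1] by (simp add: abs_mult)

text \<open>Without the edges among peripheral vertices, the four spins can be replaced by their local fields, and a product of two
fields that is nearly constant has a small covariance with any bounded quantity. The edges among
peripheral vertices contribute the second term.\<close>

lemma covariance_bound:
  assumes s: "{s1, s2, s3, s4} \<subseteq> S" "distinct [s1, s2, s3, s4]"
    and D: "D \<subseteq> pairs S" "\<theta> * real (card D) \<le> c"
    and y: "E0 (\<lambda>x. \<bar>field s1 x * field s2 x - y\<bar>) \<le> \<eta>"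
  shows "\<bar>gexp d \<theta> (core_graph C S J \<union> D) (\<lambda>x. (x s1 * x s2) * (x s3 * x s4))
     - gexp d \<theta> (core_graph C S J \<union> D) (\<lambda>x. x s1 * x s2) * gexp d \<theta> (core_graph C S J \<union> D) (\<lambda>x. x s3 * x s4)\<bar>
     \<le> 2 * \<eta> + 6 * (exp (2 * c) - 1)"
proof -
  let ?E = "gexp d \<theta> (core_graph C S J \<union> D)"
  let ?f = "\<lambda>x. field s1 x * field s2 x" and ?g = "\<lambda>x. field s3 x * field s4 x"
  let ?x = "\<lambda>x :: nat \<Rightarrow> real. x s1 * x s2" and ?z = "\<lambda>x :: nat \<Rightarrow> real. x s3 * x s4"
  have D1: "D \<subseteq> pairs {1..d}" using D pairs_mono[OF S] by blast
  have D2: "core_graph C S J \<inter> D = {}"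
  proof -
    have "e \<notin> core_graph C S J" if "e \<in> pairs S" for e
    proof
      assume "e \<in> core_graph C S J"
      moreover have "e \<inter> C \<noteq> {}" if "e \<in> pairs C"
        using that by (auto simp: pairs_def Int_absorb2)
      ultimately have "e \<inter> C \<noteq> {}"
        using J by (auto simp: core_graph_def)
      then show False using that CS by (auto simp: pairs_def)
    qed
    then show ?thesis using D by auto
  qed
  have b1: "\<bar>x s\<bar> \<le> 1" if "x \<in> spins d" "s \<in> S" for x s
    using spins_value[OF that(1) subsetD[OF S that(2)]] by auto
  have bx: "\<bar>?x x\<bar> \<le> 1" "\<bar>?z x\<bar> \<le> 1" "\<bar>?x x * ?z x\<bar> \<le> 1" if "x \<in> spins d" for x
    using b1[OF that] s by (auto intro!: abs_product_le_1)
  note cl = gexp_add_edges_close[OF core_graph_pairs D1 D2 \<theta> D(2)]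
  let ?k = "2 * (exp (2 * c) - 1)"
  have c1: "\<bar>?E (\<lambda>x. ?x x * ?z x) - E0 (\<lambda>x. ?x x * ?z x)\<bar> \<le> ?k"
    "\<bar>?E ?x - E0 ?x\<bar> \<le> ?k" "\<bar>?E ?z - E0 ?z\<bar> \<le> ?k"
    using bx by (intro cl; blast)+
  have e1: "\<bar>?E ?x\<bar> \<le> 1" "\<bar>E0 ?z\<bar> \<le> 1" "\<bar>?E ?z\<bar> \<le> 1" "\<bar>E0 ?x\<bar> \<le> 1" using bx by (intro gexp_abs_le1; blast)+
  have prod: "\<bar>?E ?x * ?E ?z - E0 ?x * E0 ?z\<bar> \<le> ?k + ?k"
    using abs_product_diff[OF e1(3) e1(4), of "?E ?x" "E0 ?z"] c1 by linarith
  have cov0: "\<bar>E0 (\<lambda>x. ?x x * ?z x) - E0 ?x * E0 ?z\<bar> \<le> 2 * \<eta>"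
  proof -
    have "E0 (\<lambda>x. ?x x * ?z x) = E0 (\<lambda>x. ?f x * ?g x)" by (rule spin_average_four[OF s])
    moreover have "E0 ?x = E0 ?f" "E0 ?z = E0 ?g" using s by (intro spin_average_two; auto)+
    ultimately have "E0 (\<lambda>x. ?x x * ?z x) - E0 ?x * E0 ?z = E0 (\<lambda>x. (?f x - y) * (?g x - E0 ?g))"
      by (simp add: left_diff_distrib right_diff_distrib gexp_diff gexp_cmult gexp_multc)
    moreover have "\<bar>E0 (\<lambda>x. (?f x - y) * (?g x - E0 ?g))\<bar> \<le> E0 (\<lambda>x. \<bar>(?f x - y) * (?g x - E0 ?g)\<bar>)"
      by (rule gexp_abs)
    moreover have "\<dots> \<le> E0 (\<lambda>x. \<bar>?f x - y\<bar> * 2)"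
    proof (rule gexp_mono)
      fix x
      have g1: "\<bar>?g x\<bar> \<le> 1" for x by (intro abs_product_le_1 tanh_abs_le_1)
      have "\<bar>E0 ?g\<bar> \<le> 1" by (rule gexp_abs_le1[OF g1])
      then have "\<bar>?g x - E0 ?g\<bar> \<le> 2" using g1[of x] by linarith
      then show "\<bar>(?f x - y) * (?g x - E0 ?g)\<bar> \<le> \<bar>?f x - y\<bar> * 2"
        unfolding abs_mult by (intro mult_left_mono) auto
    qed
    moreover have "\<dots> \<le> 2 * \<eta>" using y by (simp add: gexp_multc)
    ultimately show ?thesis by linarith
  qed
  show ?thesis using cov0 prod c1(1) by linarith
qed

text \<open>A strongly coupled core is aligned, also in the presence of the periphery, since adding edges increases correlations.
Relative to the spin at a core vertex \<open>c0\<close>, the local field of \<open>s\<close> then is close to \<open>tanh (\<theta> * card (J s))\<close>. Concavity of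
\<open>tanh\<close> makes the error proportional to the \<^emph>\<open>fraction\<close> of misaligned spins in \<open>J s\<close>, so that it does not
matter how large \<open>\<theta> * card (J s)\<close> is.\<close>

lemma aligned_fields:
  assumes R: "2 \<le> card C" and B: "0 < B" "B \<le> \<theta> * (real (card C) - 1)" and s: "s1 \<in> S" "s2 \<in> S"
  shows "\<exists>y. E0 (\<lambda>x. \<bar>field s1 x * field s2 x - y\<bar>) \<le> 8 / B"
proof -
  obtain c0 where c0: "c0 \<in> C" using R by fastforce
  have c0d: "c0 \<in> {1..d}" using c0 C by auto
  have \<theta>0: "0 < \<theta>" using B \<theta> by (cases "\<theta> = 0") auto
  let ?\<delta> = "2 / B"
  have align: "E0 (\<lambda>x. 1 - x c0 * x u) \<le> ?\<delta>" if u: "u \<in> C" for u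
  proof (cases "u = c0")
    case True
    have "E0 (\<lambda>x. x c0 * x c0) = E0 (\<lambda>x. 1)" by (rule gexp_cong) (rule spins_sq[OF _ c0d])
    then show ?thesis using True B by (simp add: gexp_diff)
  next
    case False
    have "1 - 2 * ln 2 / (\<theta> * (real (card C) - 1)) \<le> gexp d \<theta> (pairs C) (\<lambda>x. x c0 * x u)"
      using False by (intro complete_graph_alignment[OF C R \<theta>0 c0 u]) auto
    also have "\<dots> = gexp d \<theta> (pairs C) (chi {c0, u})" using False by (intro gexp_cong) auto
    also have "\<dots> \<le> E0 (chi {c0, u})"
      using c0 u C by (intro gexp_edge_mono[OF core_graph_pairs _ \<theta>]) (auto simp: core_graph_def)
    also have "\<dots> = E0 (\<lambda>x. x c0 * x u)" using False by (intro gexp_cong) auto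
    finally have "E0 (\<lambda>x. 1 - x c0 * x u) \<le> 2 * ln 2 / (\<theta> * (real (card C) - 1))" by (simp add: gexp_diff)
    also have "\<dots> \<le> 2 * 1 / B" using B ln_2_less_1 by (intro frac_le) auto
    finally show ?thesis by simp
  qed
  have single: "E0 (\<lambda>x. \<bar>x c0 * field s x - tanh (\<theta> * real (card (J s)))\<bar>) \<le> 2 * ?\<delta>" if s: "s \<in> S" for s
  proof (cases "J s = {}")
    case True
    then show ?thesis using B by simp
  next
    case False
    let ?j = "real (card (J s))"
    have finJ: "finite (J s)" using J[OF s] C finite_subset by (metis finite_atLeastAtMost)
    have j: "0 < ?j" using False finJ by (simp add: card_gt_0_iff)
    let ?D = "\<lambda>x. \<Sum>u\<in>J s. 1 - x c0 * x u"
    have "E0 (\<lambda>x. \<bar>x c0 * field s x - tanh (\<theta> * ?j)\<bar>) \<le> E0 (\<lambda>x. 2 * ?D x / ?j)"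
    proof (rule gexp_mono)
      fix x assume x: "x \<in> spins d"
      have xc: "x c0 = 1 \<or> x c0 = -1" by (rule spins_value[OF x c0d])
      have xu: "x u = 1 \<or> x u = -1" if "u \<in> J s" for u using spins_value[OF x] that J[OF s] C by blast
      have D0: "0 \<le> ?D x" using xc xu by (intro sum_nonneg) fastforce
      have Dj: "?j - ?D x = x c0 * mag (J s) x" by (simp add: sum_subtractf sum_distrib_left)
      have "x c0 * field s x = tanh (\<theta> * (?j - ?D x))" unfolding Dj using xc by auto
      moreover have "\<bar>tanh (\<theta> * (?j - ?D x)) - tanh (\<theta> * ?j)\<bar> \<le> 2 * ?D x / ?j"
      proof (cases "?D x \<le> ?j")
        case True
        let ?p = "?D x / ?j"
        have p: "0 \<le> ?p" "?p \<le> 1" using D0 True j by (auto simp: divide_le_eq_1)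
        \<comment> \<open>concavity of \<open>tanh\<close> on the nonnegative axis, with value 0 at the origin\<close>
        have conc: "(1 - p) * tanh y \<le> tanh ((1 - p) * y)" if "0 \<le> y" "0 \<le> p" "p \<le> 1" for p y :: real
        proof -
          have "(\<lambda>y. tanh ((1 - p) * y) - (1 - p) * tanh y) 0 \<le> (\<lambda>y. tanh ((1 - p) * y) - (1 - p) * tanh y) y"
          proof (rule DERIV_nonneg_imp_nondecreasing[OF that(1)])
            fix z assume z: "0 \<le> z" "z \<le> y"
            have "((\<lambda>y. tanh ((1 - p) * y) - (1 - p) * tanh y) has_real_derivative
              (1 - p) * ((tanh z)\<^sup>2 - (tanh ((1 - p) * z))\<^sup>2)) (at z)"
              by (auto intro!: derivative_eq_intros simp: cosh_real_nonzero algebra_simps)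
            moreover have "(tanh ((1 - p) * z))\<^sup>2 \<le> (tanh z)\<^sup>2"
            proof (rule power_mono)
              show "tanh ((1 - p) * z) \<le> tanh z" using z that mult_left_le_one_le[of z "1 - p"] by simp
              show "0 \<le> tanh ((1 - p) * z)" using z that by simp
            qed
            ultimately show "\<exists>w. ((\<lambda>y. tanh ((1 - p) * y) - (1 - p) * tanh y) has_real_derivative w) (at z) \<and> 0 \<le> w"
              using that by (intro exI[of _ "(1 - p) * ((tanh z)\<^sup>2 - (tanh ((1 - p) * z))\<^sup>2)"] conjI) auto
          qed
          then show ?thesis by simp
        qed
        have "?j - ?D x = (1 - ?p) * ?j" using j by (simp add: left_diff_distrib)
        then have eq: "\<theta> * (?j - ?D x) = (1 - ?p) * (\<theta> * ?j)" by simp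
        have y0: "0 \<le> \<theta> * ?j" using \<theta> by simp
        have "(1 - ?p) * tanh (\<theta> * ?j) \<le> tanh (\<theta> * (?j - ?D x))"
          unfolding eq by (rule conc[OF y0 p])
        moreover have "tanh (\<theta> * (?j - ?D x)) \<le> tanh (\<theta> * ?j)" using D0 \<theta> by (simp add: mult_left_mono)
        moreover have "?p * tanh (\<theta> * ?j) \<le> ?p * 1"
          using p tanh_abs_le_1[of "\<theta> * ?j"] by (intro mult_left_mono) auto
        moreover have "(1 - ?p) * tanh (\<theta> * ?j) = tanh (\<theta> * ?j) - ?p * tanh (\<theta> * ?j)"
          by (simp add: left_diff_distrib)
        moreover have "2 * ?D x / ?j = 2 * ?p" by simp
        ultimately show ?thesis using p by linarith
      next
        case False
        then have "1 \<le> ?D x / ?j" using j by (simp add: pos_le_divide_eq)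
        moreover have "2 * ?D x / ?j = 2 * (?D x / ?j)" by simp
        ultimately show ?thesis
          using tanh_abs_le_1[of "\<theta> * (?j - ?D x)"] tanh_abs_le_1[of "\<theta> * ?j"] by linarith
      qed
      ultimately show "\<bar>x c0 * field s x - tanh (\<theta> * ?j)\<bar> \<le> 2 * ?D x / ?j" by simp
    qed
    also have "\<dots> = 2 * (\<Sum>u\<in>J s. E0 (\<lambda>x. 1 - x c0 * x u)) / ?j"
      by (simp only: gexp_divide gexp_cmult gexp_sum)
    also have "\<dots> \<le> 2 * (\<Sum>u\<in>J s. ?\<delta>) / ?j"
      using align J[OF s] by (intro divide_right_mono mult_left_mono sum_mono) auto
    also have "\<dots> = 2 * ?\<delta>" using j by simp
    finally show ?thesis .
  qed
  let ?y1 = "tanh (\<theta> * real (card (J s1)))" and ?y2 = "tanh (\<theta> * real (card (J s2)))"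
  have "E0 (\<lambda>x. \<bar>field s1 x * field s2 x - ?y1 * ?y2\<bar>)
     \<le> E0 (\<lambda>x. \<bar>x c0 * field s1 x - ?y1\<bar> + \<bar>x c0 * field s2 x - ?y2\<bar>)"
  proof (rule gexp_mono)
    fix x assume x: "x \<in> spins d"
    have xc: "x c0 = 1 \<or> x c0 = -1" by (rule spins_value[OF x c0d])
    then have "field s1 x * field s2 x = (x c0 * field s1 x) * (x c0 * field s2 x)" by auto
    moreover have "\<bar>(x c0 * field s1 x) * (x c0 * field s2 x) - ?y1 * ?y2\<bar>
      \<le> \<bar>x c0 * field s1 x - ?y1\<bar> + \<bar>x c0 * field s2 x - ?y2\<bar>"
      using xc by (intro abs_product_diff abs_product_le_1 tanh_abs_le_1) auto
    ultimately show "\<bar>field s1 x * field s2 x - ?y1 * ?y2\<bar>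
      \<le> \<bar>x c0 * field s1 x - ?y1\<bar> + \<bar>x c0 * field s2 x - ?y2\<bar>" by (simp only:)
  qed
  also have "\<dots> \<le> 2 * ?\<delta> + 2 * ?\<delta>" unfolding gexp_add using single s by (intro add_mono) auto
  finally show ?thesis by (intro exI[of _ "?y1 * ?y2"]) simp
qed

text \<open>There are at most \<open>card S * card C\<close> edges between the periphery and the core, so adding them changes the measure
by a bounded factor when \<open>\<theta> * card C\<close> is bounded.\<close>

lemma core_graph_density:
  assumes f: "\<And>x. x \<in> spins d \<Longrightarrow> 0 \<le> f x" and c: "\<theta> * real (card S * card C) \<le> c"
  shows "E0 f \<le> exp (2 * c) * gexp d \<theta> (pairs C) f"
proof -
  let ?D = "\<Union>s\<in>S. (\<lambda>u. {s, u}) ` J s"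
  have fin: "finite C" "finite S" using C S finite_subset by blast+
  have "card ?D \<le> (\<Sum>s\<in>S. card ((\<lambda>u. {s, u}) ` J s))" by (rule card_UN_le[OF fin(2)])
  also have "\<dots> \<le> (\<Sum>s\<in>S. card C)"
  proof (rule sum_mono)
    fix s assume "s \<in> S"
    then have "finite (J s)" "card (J s) \<le> card C" using J fin finite_subset card_mono by metis+
    then show "card ((\<lambda>u. {s, u}) ` J s) \<le> card C" using card_image_le[of "J s"] by (meson order_trans)
  qed
  finally have "card ?D \<le> card S * card C" by simp
  then have "\<theta> * real (card ?D) \<le> \<theta> * real (card S * card C)" using \<theta> by (intro mult_left_mono) linarith+
  then have c': "\<theta> * real (card ?D) \<le> c" using c by linarith
  have D: "?D \<subseteq> pairs {1..d}" using core_graph_pairs by (auto simp: core_graph_def)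
  have disj: "pairs C \<inter> ?D = {}" using CS by (auto simp: pairs_def)
  show ?thesis unfolding core_graph_def
    by (rule gexp_add_edges_le[OF pairs_mono[OF C] D disj \<theta> c' f])
qed

end

text \<open>A large core makes disjoint pairs of peripheral spins nearly uncorrelated, uniformly over all small couplings. The threshold \<open>B\<close>
separates the aligned regime from the one where the periphery changes the law of the core by a bounded factor \<open>K\<close>
only, so that concentration carries over from the Curie-Weiss model.\<close>

lemma core_covariance_small:
  fixes q :: nat and \<eta> :: real
  assumes \<eta>: "0 < \<eta>"
  obtains R0 :: nat and \<theta>0 :: real where "0 < \<theta>0"
    "\<And>d C S J \<theta> D s1 s2 s3 s4. core_periphery d C S J \<theta> \<Longrightarrow> R0 \<le> card C \<Longrightarrow> \<theta> \<le> \<theta>0 \<Longrightarrow> card S \<le> q \<Longrightarrow>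
       D \<subseteq> pairs S \<Longrightarrow> {s1, s2, s3, s4} \<subseteq> S \<Longrightarrow> distinct [s1, s2, s3, s4] \<Longrightarrow>
       \<bar>gexp d \<theta> (core_graph C S J \<union> D) (\<lambda>x. (x s1 * x s2) * (x s3 * x s4))
         - gexp d \<theta> (core_graph C S J \<union> D) (\<lambda>x. x s1 * x s2) * gexp d \<theta> (core_graph C S J \<union> D) (\<lambda>x. x s3 * x s4)\<bar> \<le> \<eta>"
proof -
  define B where "B = 32 / \<eta>"
  define K where "K = exp (2 * ((B + 1) * real q))"
  have B: "0 < B" using \<eta> by (simp add: B_def)
  have K: "0 < K" by (simp add: K_def)
  have pos: "0 < B + 1" "0 < \<eta> / (4 * K)" using B \<eta> K by auto
  obtain R1 where R1: "\<And>d C J1 J2 \<theta>. C \<subseteq> {1..d} \<Longrightarrow> R1 \<le> card C \<Longrightarrow> J1 \<subseteq> C \<Longrightarrow> J2 \<subseteq> C \<Longrightarrow>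
     0 \<le> \<theta> \<Longrightarrow> \<theta> * real (card C) \<le> B + 1 \<Longrightarrow>
     \<exists>y. gexp d \<theta> (pairs C) (\<lambda>x. \<bar>tanh (\<theta> * mag J1 x) * tanh (\<theta> * mag J2 x) - y\<bar>) \<le> \<eta> / (4 * K)"
    by (rule complete_graph_local_fields[OF pos]) blast
  define c where "c = ln (1 + \<eta> / 12) / 2"
  have c: "0 < c" "6 * (exp (2 * c) - 1) = \<eta> / 2" using \<eta> by (auto simp: c_def)
  define \<theta>0 where "\<theta>0 = min 1 (c / 2 ^ q)"
  show ?thesis
  proof (rule that[of \<theta>0 "max 2 R1"])
    show "0 < \<theta>0" using c by (simp add: \<theta>0_def)
    fix d C S J \<theta> D s1 s2 s3 s4
    assume cp: "core_periphery d C S J \<theta>" and R: "max 2 R1 \<le> card C" and th: "\<theta> \<le> \<theta>0" and q: "card S \<le> q"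
      and D: "D \<subseteq> pairs S" and s: "{s1, s2, s3, s4} \<subseteq> S" "distinct [s1, s2, s3, s4]"
    interpret core_periphery d C S J \<theta> by (rule cp)
    have finS: "finite S" using S finite_subset by blast
    have "card D \<le> card (Pow S)" using D finS by (intro card_mono) (auto simp: pairs_def)
    also have "\<dots> \<le> 2 ^ q" using finS q by (simp add: card_Pow)
    finally have "real (card D) \<le> 2 ^ q" by (metis of_nat_le_iff of_nat_numeral of_nat_power)
    then have "\<theta> * real (card D) \<le> (c / 2 ^ q) * 2 ^ q"
      using th \<theta> by (intro mult_mono) (auto simp: \<theta>0_def)
    then have cD: "\<theta> * real (card D) \<le> c" by simp
    have "\<exists>y. E0 (\<lambda>x. \<bar>field s1 x * field s2 x - y\<bar>) \<le> \<eta> / 4"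
    proof (cases "B \<le> \<theta> * (real (card C) - 1)")
      case True
      then show ?thesis using aligned_fields[of B s1 s2] R B s \<eta> by (auto simp: B_def)
    next
      case False
      then have "\<theta> * real (card C) < B + \<theta>" by (simp add: algebra_simps)
      then have tR: "\<theta> * real (card C) \<le> B + 1" using th by (simp add: \<theta>0_def)
      obtain y where y: "gexp d \<theta> (pairs C) (\<lambda>x. \<bar>field s1 x * field s2 x - y\<bar>) \<le> \<eta> / (4 * K)"
        using R1[OF C _ _ _ \<theta> tR, of "J s1" "J s2"] R J s by auto
      have "\<theta> * real (card S * card C) = (\<theta> * real (card C)) * real (card S)" by simp
      also have "\<dots> \<le> (B + 1) * real q" using tR q B \<theta> by (intro mult_mono) auto
      finally have "E0 (\<lambda>x. \<bar>field s1 x * field s2 x - y\<bar>) \<le> K * gexp d \<theta> (pairs C) (\<lambda>x. \<bar>field s1 x * field s2 x - y\<bar>)"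
        unfolding K_def by (intro core_graph_density) auto
      also have "\<dots> \<le> K * (\<eta> / (4 * K))" using y K by (intro mult_left_mono) auto
      also have "\<dots> = \<eta> / 4" using K by simp
      finally show ?thesis by blast
    qed
    then obtain y where "E0 (\<lambda>x. \<bar>field s1 x * field s2 x - y\<bar>) \<le> \<eta> / 4" ..
    from covariance_bound[OF s D cD this] c(2)
    show "\<bar>gexp d \<theta> (core_graph C S J \<union> D) (\<lambda>x. (x s1 * x s2) * (x s3 * x s4))
         - gexp d \<theta> (core_graph C S J \<union> D) (\<lambda>x. x s1 * x s2) * gexp d \<theta> (core_graph C S J \<union> D) (\<lambda>x. x s3 * x s4)\<bar> \<le> \<eta>"
      by simp
  qed
qed

section \<open>Nearly uncorrelated critical edges\<close>

text \<open>The second moment of the averaged likelihood ratio is an average over pairs of edges. A pair contributes at most a constant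
multiple of its covariance: \<open>n * t\<^sup>2\<close> is bounded by \<open>L\<close>, so \<open>exp (4 * L * c) - 1\<close> is linear in the covariance \<open>c\<close>. Intersecting
pairs are few.\<close>

lemma risk_small_covariances:
  assumes crit: "critical_edges P d F K" and K: "finite K" "0 < card K"
    and \<theta>: "0 \<le> \<theta>" and t: "tanh \<theta> \<le> 1/2" and L: "real n * (tanh \<theta>)\<^sup>2 \<le> L" and \<eta>: "0 \<le> \<eta>"
    and cov: "\<And>e f. e \<in> K \<Longrightarrow> f \<in> K \<Longrightarrow> e \<inter> f = {} \<Longrightarrow>
       \<bar>gexp d \<theta> F (\<lambda>x. chi e x * chi f x) - gexp d \<theta> F (chi e) * gexp d \<theta> F (chi f)\<bar> \<le> \<eta>"
    and nbr: "\<And>e. e \<in> K \<Longrightarrow> card {f \<in> K. e \<inter> f \<noteq> {}} \<le> 4"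
  shows "ennreal (1 - sqrt (4 * L * exp (8 * L) * (8 / real (card K) + \<eta>))) \<le> minimax_risk n d P \<theta>"
proof -
  let ?t = "tanh \<theta>" and ?k = "real (card K)"
  let ?l = "\<lambda>e X. \<Prod>i\<in>{1..n}. lr d \<theta> F e (X i)"
  let ?c = "\<lambda>e f. gexp d \<theta> F (\<lambda>x. chi e x * chi f x) - gexp d \<theta> F (chi e) * gexp d \<theta> F (chi f)"
  define \<Lambda> where "\<Lambda> = 4 * L * exp (8 * L)"
  have F: "F \<subseteq> pairs {1..d}" and Kp: "\<And>e. e \<in> K \<Longrightarrow> e \<in> pairs {1..d}"
    using crit by (auto simp: critical_edges_def)
  have L0: "0 \<le> L" using L order_trans[of 0 "real n * ?t\<^sup>2" L] by simp
  have \<Lambda>: "0 \<le> \<Lambda>" using L0 by (simp add: \<Lambda>_def)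
  have t0: "0 \<le> ?t" using \<theta> by simp
  have c2: "\<bar>?c e f\<bar> \<le> 2" if "e \<in> K" "f \<in> K" for e f
  proof -
    have s: "e \<subseteq> {1..d}" "f \<subseteq> {1..d}" using Kp that by (auto simp: pairs_def)
    have "\<bar>gexp d \<theta> F (\<lambda>x. chi e x * chi f x)\<bar> \<le> 1"
      using chi_abs s by (intro gexp_abs_le1) (simp add: abs_mult)
    moreover have "\<bar>gexp d \<theta> F (chi e)\<bar> \<le> 1" "\<bar>gexp d \<theta> F (chi f)\<bar> \<le> 1"
      using chi_abs s by (intro gexp_abs_le1; simp)+
    moreover have "\<bar>gexp d \<theta> F (chi e) * gexp d \<theta> F (chi f)\<bar> \<le> 1 * 1"
      unfolding abs_mult using calculation by (intro mult_mono) auto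
    ultimately show ?thesis by linarith
  qed
  have pair: "gexp d \<theta> F (\<lambda>x. lr d \<theta> F e x * lr d \<theta> F f x) ^ n - 1 \<le> \<Lambda> * \<bar>?c e f\<bar>"
    if ef: "e \<in> K" "f \<in> K" for e f
  proof -
    let ?q = "(1 + esign F e * ?t * gexp d \<theta> F (chi e)) * (1 + esign F f * ?t * gexp d \<theta> F (chi f))"
    let ?u = "esign F e * esign F f * ?t\<^sup>2 * ?c e f / ?q"
    let ?z = "4 * L * \<bar>?c e f\<bar>"
    have b: "1/2 \<le> 1 + esign F e * ?t * gexp d \<theta> F (chi e)" "1/2 \<le> 1 + esign F f * ?t * gexp d \<theta> F (chi f)"
      using lr_bounds(1)[OF F Kp[OF ef(1)] \<theta>] lr_bounds(1)[OF F Kp[OF ef(2)] \<theta>] t by linarith+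
    have "1/2 * (1/2) \<le> ?q" using b by (intro mult_mono) auto
    then have q: "1/4 \<le> ?q" by simp
    have E: "gexp d \<theta> F (\<lambda>x. lr d \<theta> F e x * lr d \<theta> F f x) = 1 + ?u"
      by (rule gexp_lr_lr[OF F Kp[OF ef(1)] Kp[OF ef(2)] \<theta>])
    have E0: "0 \<le> 1 + ?u"
      unfolding E[symmetric] using lr_bounds(4)[OF F Kp[OF ef(1)] \<theta>] lr_bounds(4)[OF F Kp[OF ef(2)] \<theta>]
      by (intro gexp_nonneg) (simp add: less_imp_le)
    have "\<bar>?u\<bar> = ?t\<^sup>2 * \<bar>?c e f\<bar> / ?q"
    proof -
      have qa: "\<bar>?q\<bar> = ?q" using q by linarith
      have "\<bar>esign F e * esign F f * ?t\<^sup>2 * ?c e f\<bar> = ?t\<^sup>2 * \<bar>?c e f\<bar>"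
        by (simp add: abs_mult esign_def)
      then show ?thesis by (simp only: abs_divide qa)
    qed
    also have "\<dots> \<le> ?t\<^sup>2 * \<bar>?c e f\<bar> / (1/4)" using q by (intro divide_left_mono) auto
    also have "\<dots> = 4 * ?t\<^sup>2 * \<bar>?c e f\<bar>" by simp
    finally have "?u \<le> 4 * ?t\<^sup>2 * \<bar>?c e f\<bar>" by (rule order_trans[OF abs_ge_self])
    then have "(1 + ?u) ^ n \<le> exp (4 * ?t\<^sup>2 * \<bar>?c e f\<bar>) ^ n"
      using E0 exp_ge_add_one_self[of "4 * ?t\<^sup>2 * \<bar>?c e f\<bar>"] by (intro power_mono) linarith+
    also have "\<dots> = exp (4 * (real n * ?t\<^sup>2) * \<bar>?c e f\<bar>)" by (simp add: exp_of_nat_mult[symmetric] mult_ac)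
    also have "\<dots> \<le> exp ?z" using L by (simp add: mult_right_mono)
    finally have "(1 + ?u) ^ n - 1 \<le> exp ?z - 1" by simp
    also have "\<dots> \<le> ?z * exp ?z"
    proof -
      have "1 + - ?z \<le> exp (- ?z)" by (rule exp_ge_add_one_self)
      then have "(1 - ?z) * exp ?z \<le> exp (- ?z) * exp ?z" by (intro mult_right_mono) auto
      then show ?thesis by (simp add: exp_minus algebra_simps)
    qed
    also have "\<dots> \<le> ?z * exp (8 * L)"
    proof (rule mult_left_mono)
      have "?z \<le> 4 * L * 2" using c2[OF ef] L0 by (intro mult_left_mono) auto
      then show "exp ?z \<le> exp (8 * L)" by simp
    qed (use L0 in simp)
    finally show ?thesis unfolding E by (simp add: \<Lambda>_def mult_ac)
  qed
  have tot: "(\<Sum>e\<in>K. \<Sum>f\<in>K. gexp d \<theta> F (\<lambda>x. lr d \<theta> F e x * lr d \<theta> F f x) ^ n - 1) \<le> ?k * (8 * \<Lambda> + ?k * (\<Lambda> * \<eta>))"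
  proof -
    have "(\<Sum>f\<in>K. gexp d \<theta> F (\<lambda>x. lr d \<theta> F e x * lr d \<theta> F f x) ^ n - 1) \<le> 8 * \<Lambda> + ?k * (\<Lambda> * \<eta>)"
      if e: "e \<in> K" for e
    proof -
      have "(\<Sum>f\<in>K. gexp d \<theta> F (\<lambda>x. lr d \<theta> F e x * lr d \<theta> F f x) ^ n - 1)
        \<le> (\<Sum>f\<in>K. (if e \<inter> f \<noteq> {} then 2 * \<Lambda> else 0) + \<Lambda> * \<eta>)"
      proof (rule sum_mono)
        fix f assume f: "f \<in> K"
        have "\<Lambda> * \<bar>?c e f\<bar> \<le> (if e \<inter> f \<noteq> {} then 2 * \<Lambda> else 0) + \<Lambda> * \<eta>"
        proof (cases "e \<inter> f = {}")
          case True
          then show ?thesis using cov[OF e f] \<Lambda> by (simp add: mult_left_mono)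
        next
          case False
          have "\<Lambda> * \<bar>?c e f\<bar> \<le> \<Lambda> * 2" using c2[OF e f] \<Lambda> by (rule mult_left_mono)
          moreover have "0 \<le> \<Lambda> * \<eta>" using \<Lambda> \<eta> by simp
          ultimately show ?thesis using False by simp
        qed
        then show "gexp d \<theta> F (\<lambda>x. lr d \<theta> F e x * lr d \<theta> F f x) ^ n - 1
          \<le> (if e \<inter> f \<noteq> {} then 2 * \<Lambda> else 0) + \<Lambda> * \<eta>" using pair[OF e f] by linarith
      qed
      also have "\<dots> = real (card {f \<in> K. e \<inter> f \<noteq> {}}) * (2 * \<Lambda>) + ?k * (\<Lambda> * \<eta>)"
        using K by (simp add: sum.distrib sum.If_cases Int_def)
      also have "\<dots> \<le> 4 * (2 * \<Lambda>) + ?k * (\<Lambda> * \<eta>)"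
        using nbr[OF e] \<Lambda> \<eta> by (intro add_mono mult_right_mono) auto
      finally show ?thesis by simp
    qed
    then have "(\<Sum>e\<in>K. \<Sum>f\<in>K. gexp d \<theta> F (\<lambda>x. lr d \<theta> F e x * lr d \<theta> F f x) ^ n - 1)
       \<le> (\<Sum>e\<in>K. 8 * \<Lambda> + ?k * (\<Lambda> * \<eta>))" by (intro sum_mono) auto
    then show ?thesis by simp
  qed
  let ?A = "\<lambda>X. (\<Sum>e\<in>K. ?l e X) / ?k"
  have EA: "sexp n d \<theta> F ?A = 1"
  proof -
    have "sexp n d \<theta> F ?A = (\<Sum>e\<in>K. gexp d \<theta> F (lr d \<theta> F e) ^ n) / ?k"
      by (simp only: sexp_divide sexp_sum sexp_prod)
    also have "(\<Sum>e\<in>K. gexp d \<theta> F (lr d \<theta> F e) ^ n) = ?k" using gexp_lr[OF F Kp \<theta>] by simp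
    finally show ?thesis using K by auto
  qed
  have EA2: "sexp n d \<theta> F (\<lambda>X. ?A X * ?A X) = (\<Sum>e\<in>K. \<Sum>f\<in>K. gexp d \<theta> F (\<lambda>x. lr d \<theta> F e x * lr d \<theta> F f x) ^ n) / (?k * ?k)"
  proof -
    have "sexp n d \<theta> F (\<lambda>X. ?A X * ?A X)
      = sexp n d \<theta> F (\<lambda>X. (\<Sum>e\<in>K. \<Sum>f\<in>K. \<Prod>i\<in>{1..n}. lr d \<theta> F e (X i) * lr d \<theta> F f (X i)) / (?k * ?k))"
      by (rule sexp_cong) (simp add: sum_product prod.distrib)
    also have "\<dots> = (\<Sum>e\<in>K. \<Sum>f\<in>K. sexp n d \<theta> F (\<lambda>X. \<Prod>i\<in>{1..n}. lr d \<theta> F e (X i) * lr d \<theta> F f (X i))) / (?k * ?k)"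
      by (simp only: sexp_divide sexp_sum)
    finally show ?thesis unfolding sexp_prod[of n d \<theta> F "\<lambda>x. lr d \<theta> F e x * lr d \<theta> F f x" for e f] .
  qed
  have "sexp n d \<theta> F (\<lambda>X. (?A X - 1)\<^sup>2) = sexp n d \<theta> F (\<lambda>X. ?A X * ?A X + 1 - 2 * ?A X)"
    by (rule sexp_cong) (simp add: power2_eq_square algebra_simps)
  also have "\<dots> = sexp n d \<theta> F (\<lambda>X. ?A X * ?A X) - 1"
    unfolding sexp_diff sexp_add sexp_const sexp_cmult EA by simp
  also have "\<dots> = (\<Sum>e\<in>K. \<Sum>f\<in>K. gexp d \<theta> F (\<lambda>x. lr d \<theta> F e x * lr d \<theta> F f x) ^ n - 1) / (?k * ?k)"
    unfolding EA2 using K by (auto simp: sum_subtractf diff_divide_distrib)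
  also have "\<dots> \<le> (?k * (8 * \<Lambda> + ?k * (\<Lambda> * \<eta>))) / (?k * ?k)" using tot by (rule divide_right_mono) simp
  also have "\<dots> = \<Lambda> * (8 / ?k + \<eta>)"
  proof -
    have "k * (8 * \<Lambda> + k * (\<Lambda> * \<eta>)) / (k * k) = \<Lambda> * (8 / k + \<eta>)" if "0 < k" for k
      using that by (simp add: field_simps)
    from this[of ?k] show ?thesis using K(2) by (simp only: of_nat_0_less_iff)
  qed
  finally have "sqrt (sexp n d \<theta> F (\<lambda>X. (?A X - 1)\<^sup>2)) \<le> sqrt (\<Lambda> * (8 / ?k + \<eta>))" by (rule real_sqrt_le_mono)
  with sexp_abs_le_sqrt[of n d \<theta> F "\<lambda>X. ?A X - 1"]
  have "sexp n d \<theta> F (\<lambda>X. \<bar>?A X - 1\<bar>) \<le> sqrt (\<Lambda> * (8 / ?k + \<eta>))" by linarith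
  then have "ennreal (1 - sqrt (\<Lambda> * (8 / ?k + \<eta>))) \<le> ennreal (1 - sexp n d \<theta> F (\<lambda>X. \<bar>?A X - 1\<bar>))"
    by (intro ennreal_leI) simp
  also have "\<dots> \<le> minimax_risk n d P \<theta>" using K by (intro testing_lower_bound[OF crit]) auto
  finally show ?thesis unfolding \<Lambda>_def .
qed

section \<open>Critical edges from cyclic symmetry\<close>

text \<open>The maps \<open>\<rho> i\<close> for \<open>i < g\<close> are the elements of a cyclic group of order \<open>g\<close> that acts on all vertices and freely on \<open>V\<close>.\<close>

locale free_cyclic_action =
  fixes d g :: nat and V :: "nat set" and \<rho> :: "nat \<Rightarrow> nat \<Rightarrow> nat"
  assumes V: "V \<subseteq> {1..d}" and g: "0 < g"
    and bij: "\<And>i. bij_betw (\<rho> i) {1..d} {1..d}"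
    and inV: "\<And>i v. v \<in> V \<Longrightarrow> \<rho> i v \<in> V"
    and add: "\<And>i j v. \<rho> i (\<rho> j v) = \<rho> (i + j) v"
    and per: "\<And>v. \<rho> g v = v"
    and free: "\<And>v i j. v \<in> V \<Longrightarrow> i < g \<Longrightarrow> j < g \<Longrightarrow> \<rho> i v = \<rho> j v \<Longrightarrow> i = j"
begin

definition invariant :: "nat set set \<Rightarrow> bool" where
  "invariant Y \<longleftrightarrow> (\<forall>i. \<forall>e\<in>Y. \<rho> i ` e \<in> Y)"

definition orb :: "nat set \<Rightarrow> nat set set" where
  "orb f = (\<lambda>i. \<rho> i ` f) ` {..<g}"

lemma per_mult: "\<rho> (g * k) v = v"
proof (induction k)
  case 0
  have "\<rho> 0 (\<rho> g v) = \<rho> g v" by (simp only: add add_0)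
  then show ?case by (simp only: per mult_0_right)
next
  case (Suc k)
  have "\<rho> (g * Suc k) v = \<rho> g (\<rho> (g * k) v)" by (simp add: add)
  then show ?case by (simp add: Suc per)
qed

lemma rho_mod: "\<rho> i v = \<rho> (i mod g) v"
proof -
  have "\<rho> i v = \<rho> (i mod g + g * (i div g)) v" by simp
  also have "\<dots> = \<rho> (i mod g) (\<rho> (g * (i div g)) v)" by (simp only: add)
  finally show ?thesis by (simp add: per_mult)
qed

lemma rho_image_add: "\<rho> i ` \<rho> j ` f = \<rho> (i + j) ` f"
  by (simp add: image_image add)

lemma orb_mem: "\<rho> i ` f \<in> orb f"
proof -
  have "\<rho> i ` f = \<rho> (i mod g) ` f" by (intro image_cong refl rho_mod)
  then show ?thesis using g by (auto simp: orb_def)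
qed

lemma orb_self: "f \<in> orb f"
  using orb_mem[of g f] by (simp add: per)

lemma orb_invariant: "e \<in> orb f \<Longrightarrow> \<rho> i ` e \<in> orb f"
  by (auto simp: orb_def rho_image_add intro: orb_mem[unfolded orb_def])

lemma orb_subset: "invariant X \<Longrightarrow> f \<in> X \<Longrightarrow> orb f \<subseteq> X"
  by (auto simp: orb_def invariant_def)

lemma orb_disjoint:
  assumes Y: "invariant Y" and f: "f \<notin> Y" shows "orb f \<inter> Y = {}"
proof -
  have "\<rho> i ` f \<notin> Y" if "i < g" for i
  proof
    assume "\<rho> i ` f \<in> Y"
    then have "\<rho> (g - i) ` \<rho> i ` f \<in> Y" using Y by (simp add: invariant_def)
    then show False using f that by (simp add: rho_image_add per)
  qed
  then show ?thesis by (auto simp: orb_def)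
qed

lemma rho_pairs: "e \<in> pairs V \<Longrightarrow> \<rho> i ` e \<in> pairs V"
proof -
  assume e: "e \<in> pairs V"
  have "e \<subseteq> {1..d}" using e V by (auto simp: pairs_def)
  then have "inj_on (\<rho> i) e" using bij[of i] inj_on_subset by (auto simp: bij_betw_def)
  then show ?thesis using e inV by (auto simp: pairs_def card_image)
qed

lemma orb_pairs: "f \<in> pairs V \<Longrightarrow> orb f \<subseteq> pairs V"
  using rho_pairs by (auto simp: orb_def)

text \<open>By freeness a vertex is carried to a given vertex by at most one element of the group; two edges give four pairs of
vertices.\<close>

lemma few_translations:
  assumes a: "a \<in> pairs V" and s: "s \<in> pairs V"
  shows "card {i. i < g \<and> \<rho> i ` a \<inter> s \<noteq> {}} \<le> 4"
proof -
  have fin: "finite a" "finite s" "card a = 2" "card s = 2" "a \<subseteq> V"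
    using a s by (auto simp: pairs_def intro: card_ge_0_finite)
  have "{i. i < g \<and> \<rho> i ` a \<inter> s \<noteq> {}} \<subseteq> (\<Union>(v, w)\<in>a \<times> s. {i. i < g \<and> \<rho> i v = w})" by auto
  then have "card {i. i < g \<and> \<rho> i ` a \<inter> s \<noteq> {}} \<le> card (\<Union>(v, w)\<in>a \<times> s. {i. i < g \<and> \<rho> i v = w})"
    using fin by (intro card_mono) auto
  also have "\<dots> \<le> (\<Sum>(v, w)\<in>a \<times> s. card {i. i < g \<and> \<rho> i v = w})"
    using fin card_UN_le[of "a \<times> s" "\<lambda>(v, w). {i. i < g \<and> \<rho> i v = w}"] by (simp add: case_prod_beta)
  also have "\<dots> \<le> (\<Sum>(v, w)\<in>a \<times> s. 1)"
  proof (intro sum_mono, clarify)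
    fix v w assume "v \<in> a"
    then show "card {i. i < g \<and> \<rho> i v = w} \<le> 1" using free[of v] fin(5) by (auto simp: card_le_Suc0_iff_eq)
  qed
  also have "\<dots> = 4" using fin by (simp add: case_prod_beta card_cartesian_product)
  finally show ?thesis .
qed

lemma orbit_neighbours:
  assumes f: "f \<in> pairs V" and K: "K \<subseteq> orb f" and e: "e \<in> K"
  shows "card {f' \<in> K. e \<inter> f' \<noteq> {}} \<le> 4"
proof -
  have "{f' \<in> K. e \<inter> f' \<noteq> {}} \<subseteq> (\<lambda>i. \<rho> i ` f) ` {i. i < g \<and> \<rho> i ` f \<inter> e \<noteq> {}}"
    using K by (auto simp: orb_def)
  then have "card {f' \<in> K. e \<inter> f' \<noteq> {}} \<le> card {i. i < g \<and> \<rho> i ` f \<inter> e \<noteq> {}}"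
    by (intro surj_card_le) auto
  also have "\<dots> \<le> 4" using few_translations[OF f] e K orb_pairs[OF f] by auto
  finally show ?thesis .
qed

text \<open>Compare a minimal set \<open>T1\<close> of edges of the orbit that produces the property with a maximal set \<open>T0\<close> that does not. All
edges of \<open>T1\<close> are critical for removal, and all edges outside \<open>T0\<close> are critical for addition, so it suffices that \<open>T1\<close> or the
complement of \<open>T0\<close> is large. By symmetry every translate of \<open>T1\<close> produces the property as well and hence meets the
complement of \<open>T0\<close>; as at most four translations carry a given edge to one that meets a given edge, there
are at least \<open>g / 4\<close> pairs of an edge of \<open>T1\<close> and an edge outside \<open>T0\<close>.\<close>

lemma orbit_critical_edges:
  assumes P: "graph_property P" "strongly_monotone P"
    and Y: "Y \<subseteq> pairs V" "invariant Y" "\<not> P ({1..d}, Y)"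
    and f: "f \<in> pairs V" "P ({1..d}, Y \<union> orb f)" and fY: "f \<notin> Y" and h: "4 * h\<^sup>2 \<le> g" "0 < h"
  obtains F K where "Y \<subseteq> F" "F \<subseteq> Y \<union> orb f" "K \<subseteq> orb f" "critical_edges P d F K" "h \<le> card K"
proof -
  let ?O = "orb f"
  have pV: "pairs V \<subseteq> pairs {1..d}" by (rule pairs_mono[OF V])
  have O: "?O \<subseteq> pairs V" by (rule orb_pairs[OF f(1)])
  have disj: "?O \<inter> Y = {}" by (rule orb_disjoint[OF Y(2) fY])
  have finO: "finite ?O" by (simp add: orb_def)
  have sub: "Y \<union> T \<subseteq> pairs {1..d}" if "T \<subseteq> ?O" for T using that O Y pV by blast
  let ?A = "{T. T \<subseteq> ?O \<and> P ({1..d}, Y \<union> T)}"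
  have "finite ?A" "?A \<noteq> {}" using finO f by auto
  then obtain T1 where T1: "T1 \<in> ?A" and min: "\<And>T. T \<in> ?A \<Longrightarrow> T \<subseteq> T1 \<Longrightarrow> T1 = T"
    using finite_has_minimal[of ?A] by (metis (no_types, lifting))
  let ?B = "{T. T \<subseteq> ?O \<and> \<not> P ({1..d}, Y \<union> T)}"
  have "{} \<in> ?B" using Y by simp
  then have "finite ?B" "?B \<noteq> {}" using finO by (simp, blast)
  then obtain T0 where T0: "T0 \<in> ?B" and max: "\<And>T. T \<in> ?B \<Longrightarrow> T0 \<subseteq> T \<Longrightarrow> T0 = T"
    using finite_has_maximal[of ?B] by (metis (no_types, lifting))
  let ?S = "?O - T0"
  consider "h \<le> card T1" | "h \<le> card ?S" | "card T1 < h" "card ?S < h" by linarith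
  then show ?thesis
  proof cases
    case 1
    have "critical_edges P d (Y \<union> T1) T1"
    proof -
      have "\<not> P ({1..d}, toggle (Y \<union> T1) e)" if "e \<in> T1" for e
      proof -
        have "toggle (Y \<union> T1) e = Y \<union> (T1 - {e})" using that disj T1 by (auto simp: toggle_def)
        moreover have "T1 - {e} \<notin> ?A" using min[of "T1 - {e}"] that by auto
        ultimately show ?thesis using T1 by auto
      qed
      then show ?thesis using T1 sub[of T1] by (auto simp: critical_edges_def)
    qed
    then show ?thesis using that[of "Y \<union> T1" T1] T1 1 by auto
  next
    case 2
    have "critical_edges P d (Y \<union> T0) ?S"
    proof -
      have "P ({1..d}, toggle (Y \<union> T0) e)" if "e \<in> ?S" for e
      proof -
        have "toggle (Y \<union> T0) e = Y \<union> (insert e T0)" using that disj T0 by (auto simp: toggle_def)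
        moreover have "insert e T0 \<notin> ?B" using max[of "insert e T0"] that by auto
        ultimately show ?thesis using T0 that by auto
      qed
      then show ?thesis using T0 sub[of T0] sub[of ?S] by (auto simp: critical_edges_def)
    qed
    then show ?thesis using that[of "Y \<union> T0" ?S] T0 2 by auto
  next
    case 3
    have "\<exists>s\<in>?S. \<exists>a\<in>T1. \<rho> i ` a = s" if "i < g" for i
    proof (rule ccontr)
      assume no: "\<not> ?thesis"
      have imO: "(`) (\<rho> i) ` T1 \<subseteq> ?O" using T1 orb_invariant by auto
      have "(`) (\<rho> i) ` T1 \<subseteq> T0" using no imO by blast
      moreover have "(`) (\<rho> i) ` Y \<subseteq> Y" using Y(2) by (auto simp: invariant_def)
      ultimately have s: "(`) (\<rho> i) ` (Y \<union> T1) \<subseteq> Y \<union> T0" by blast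
      have "P ({1..d}, (`) (\<rho> i) ` (Y \<union> T1))"
        using property_relabel[OF P(1) bij sub[of T1]] T1 by blast
      then have "P ({1..d}, Y \<union> T0)"
        using property_edges_mono[OF P(2) s sub[of T0]] T0 by blast
      then show False using T0 by blast
    qed
    then have "{..<g} \<subseteq> (\<Union>(s, a)\<in>?S \<times> T1. {i. i < g \<and> \<rho> i ` a \<inter> s \<noteq> {}})"
    proof (intro subsetI)
      fix i assume "i \<in> {..<g}" and ex: "\<And>i. i < g \<Longrightarrow> \<exists>s\<in>?S. \<exists>a\<in>T1. \<rho> i ` a = s"
      then have ig: "i < g" by simp
      obtain s a where sa: "s \<in> ?S" "a \<in> T1" "\<rho> i ` a = s" using ex[OF ig] by blast
      have "s \<in> pairs V" using sa O by blast
      then have "\<rho> i ` a \<inter> s \<noteq> {}" using sa by (auto simp: pairs_def)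
      then show "i \<in> (\<Union>(s, a)\<in>?S \<times> T1. {i. i < g \<and> \<rho> i ` a \<inter> s \<noteq> {}})"
        using sa(1,2) ig by (intro UN_I[of "(s, a)"]) auto
    qed
    moreover have fin: "finite (?S \<times> T1)" using finO T1 finite_subset by auto
    ultimately have "card {..<g} \<le> card (\<Union>(s, a)\<in>?S \<times> T1. {i. i < g \<and> \<rho> i ` a \<inter> s \<noteq> {}})"
      by (intro card_mono) auto
    also have "\<dots> \<le> (\<Sum>(s, a)\<in>?S \<times> T1. card {i. i < g \<and> \<rho> i ` a \<inter> s \<noteq> {}})"
      using card_UN_le[OF fin, of "\<lambda>(s, a). {i. i < g \<and> \<rho> i ` a \<inter> s \<noteq> {}}"] by (simp add: case_prod_beta)
    also have "\<dots> \<le> (\<Sum>(s, a)\<in>?S \<times> T1. 4)"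
    proof (rule sum_mono, clarify)
      fix s a assume "s \<in> ?O" "a \<in> T1"
      then have "s \<in> pairs V" "a \<in> pairs V" using T1 O by auto
      then show "card {i. i < g \<and> \<rho> i ` a \<inter> s \<noteq> {}} \<le> 4" using few_translations by blast
    qed
    also have "\<dots> = 4 * (card ?S * card T1)" by (simp add: case_prod_beta card_cartesian_product)
    also have "\<dots> < 4 * (h * h)" using 3 by (intro mult_strict_left_mono mult_strict_mono') auto
    finally have False using h(1) by (simp add: power2_eq_square)
    then show ?thesis ..
  qed
qed

text \<open>Orbits are the smallest invariant sets of edges, so adding any of them to a maximal invariant graph without the
property produces the property.\<close>

lemma maximal_invariant_null:
  assumes X: "X \<subseteq> X'" "X' \<subseteq> pairs V" "invariant X" "invariant X'" "\<not> P ({1..d}, X)" "P ({1..d}, X')"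
  obtains Y f where "X \<subseteq> Y" "Y \<subseteq> X'" "invariant Y" "\<not> P ({1..d}, Y)" "f \<in> X'" "f \<notin> Y" "P ({1..d}, Y \<union> orb f)"
proof -
  have "finite X'" using X(2) V finite_pairs finite_subset by (metis finite_atLeastAtMost)
  let ?A = "{Y. X \<subseteq> Y \<and> Y \<subseteq> X' \<and> invariant Y \<and> \<not> P ({1..d}, Y)}"
  have "finite ?A" by (rule finite_subset[of _ "Pow X'"]) (use \<open>finite X'\<close> in auto)
  moreover have "?A \<noteq> {}" using X by auto
  ultimately obtain Y where Y: "Y \<in> ?A" and max: "\<And>Z. Z \<in> ?A \<Longrightarrow> Y \<subseteq> Z \<Longrightarrow> Y = Z"
    using finite_has_maximal[of ?A] by (metis (no_types, lifting))
  have "\<not> X' \<subseteq> Y"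
  proof
    assume "X' \<subseteq> Y"
    then have "Y = X'" using Y by auto
    then show False using Y X(6) by simp
  qed
  then obtain f where f: "f \<in> X'" "f \<notin> Y" by blast
  have "invariant (Y \<union> orb f)" using Y orb_invariant by (auto simp: invariant_def)
  moreover have "Y \<union> orb f \<subseteq> X'" using Y orb_subset[OF X(4) f(1)] by auto
  moreover have "Y \<noteq> Y \<union> orb f" using f orb_self by auto
  ultimately have "P ({1..d}, Y \<union> orb f)" using max[of "Y \<union> orb f"] Y by auto
  then show ?thesis using that[of Y f] Y f by auto
qed

end

section \<open>Filling the complete graph in stages\<close>

text \<open>The vertices \<open>1, \<dots>, r * g\<close> fall into \<open>r\<close> classes of size \<open>g\<close>, the residue classes modulo \<open>r\<close>. The shift by \<open>r\<close> permutes
every class cyclically.\<close>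

definition cls :: "nat \<Rightarrow> nat \<Rightarrow> nat" where
  "cls r v = (v - 1) mod r"

text \<open>The truncated subtraction moves the vertices to \<open>0, \<dots>, r * g - 1\<close>, where the shift is addition modulo \<open>r * g\<close>.\<close>

definition rot :: "nat \<Rightarrow> nat \<Rightarrow> nat \<Rightarrow> nat \<Rightarrow> nat" where
  "rot r g i v = (if v \<in> {1..r * g} then (v - 1 + r * i) mod (r * g) + 1 else v)"

lemma rot_mem: "0 < r \<Longrightarrow> 0 < g \<Longrightarrow> v \<in> {1..r * g} \<Longrightarrow> rot r g i v \<in> {1..r * g}"
  by (simp add: rot_def Suc_le_eq)

lemma rot_cls:
  assumes "v \<in> {1..r * g}" shows "cls r (rot r g i v) = cls r v"
proof -
  have "rot r g i v - 1 = (v - 1 + r * i) mod (r * g)" using assms by (simp add: rot_def)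
  then have "cls r (rot r g i v) = (v - 1 + r * i) mod (r * g) mod r" by (simp only: cls_def)
  also have "\<dots> = (v - 1 + r * i) mod r" by (rule mod_mod_cancel) simp
  finally show ?thesis by (simp only: cls_def mod_mult_self2)
qed

lemma rot_free_cyclic_action:
  assumes "0 < r" "0 < g" "r * g \<le> d"
  shows "free_cyclic_action d g {1..r * g} (rot r g)"
proof
  have rg: "0 < r * g" using assms by simp
  show add: "rot r g i (rot r g j v) = rot r g (i + j) v" for i j v
  proof (cases "v \<in> {1..r * g}")
    case True
    have m: "rot r g j v - 1 = (v - 1 + r * j) mod (r * g)" using True by (simp add: rot_def)
    have "rot r g i (rot r g j v) = (rot r g j v - 1 + r * i) mod (r * g) + 1"
      using rot_mem[OF assms(1,2) True, of j] by (simp only: rot_def[of r g i] if_True)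
    also have "\<dots> = (v - 1 + r * j + r * i) mod (r * g) + 1" unfolding m mod_add_left_eq ..
    also have "v - 1 + r * j + r * i = v - 1 + r * (i + j)" by (simp add: distrib_left)
    finally show ?thesis using True by (simp only: rot_def[of r g "i + j"] if_True)
  next
    case False
    then show ?thesis by (simp add: rot_def del: atLeastAtMost_iff)
  qed
  have full: "rot r g (i * g) v = v" for i v
  proof (cases "v \<in> {1..r * g}")
    case True
    have "(v - 1 + r * (i * g)) mod (r * g) = (v - 1 + r * g * i) mod (r * g)" by (simp only: mult_ac)
    also have "\<dots> = (v - 1) mod (r * g)" by (rule mod_mult_self2)
    also have "\<dots> = v - 1" using True by (intro mod_less) auto
    finally show ?thesis using True by (simp only: rot_def if_True) simp
  next
    case False
    then show ?thesis by (simp add: rot_def del: atLeastAtMost_iff)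
  qed
  show "rot r g g v = v" for v using full[of 1] by simp
  show "{1..r * g} \<subseteq> {1..d}" using assms by auto
  show inV: "rot r g i v \<in> {1..r * g}" if "v \<in> {1..r * g}" for i v by (rule rot_mem[OF assms(1,2) that])
  show "bij_betw (rot r g i) {1..d} {1..d}" for i
  proof (rule bij_betw_byWitness[where f' = "rot r g (i * (g - 1))"])
    have mem: "rot r g k ` {1..d} \<subseteq> {1..d}" for k
    proof
      fix w assume "w \<in> rot r g k ` {1..d}"
      then obtain v where v: "v \<in> {1..d}" "w = rot r g k v" by auto
      show "w \<in> {1..d}"
      proof (cases "v \<in> {1..r * g}")
        case True
        then show ?thesis using inV[OF True, of k] v assms(3) by auto
      next
        case False
        then have "w = v" using v by (simp add: rot_def del: atLeastAtMost_iff)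
        then show ?thesis using v by simp
      qed
    qed
    show "rot r g i ` {1..d} \<subseteq> {1..d}" "rot r g (i * (g - 1)) ` {1..d} \<subseteq> {1..d}" by (rule mem)+
    have "i * (g - 1) + i = i * g" "i + i * (g - 1) = i * g"
      using assms(2) by (auto simp: right_diff_distrib')
    then show "\<forall>a\<in>{1..d}. rot r g (i * (g - 1)) (rot r g i a) = a"
      "\<forall>a'\<in>{1..d}. rot r g i (rot r g (i * (g - 1)) a') = a'" by (simp_all only: add full) simp_all
  qed
  show "i = j" if v: "v \<in> {1..r * g}" and ij: "i < g" "j < g" and eq: "rot r g i v = rot r g j v" for v i j
  proof -
    have key: "k = l" if kl: "k \<le> l" "l < g" "rot r g k v = rot r g l v" for k l
    proof -
      have "(v - 1 + r * l) mod (r * g) = (v - 1 + r * k) mod (r * g)"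
        using v kl(3) by (simp only: rot_def if_True)
      then have "r * g dvd (v - 1 + r * l) - (v - 1 + r * k)"
        using kl(1) by (subst (asm) mod_eq_dvd_iff_nat) auto
      then have "r * g dvd r * (l - k)" by (simp add: right_diff_distrib')
      then have "g dvd l - k" using assms(1) by simp
      then show ?thesis using kl by (auto dest: dvd_imp_le)
    qed
    show ?thesis using key[of i j] key[of j i] ij eq by (metis nle_le)
  qed
qed (use assms in auto)

lemma card_cls_le: "card {v \<in> {1..r * g}. cls r v = a} \<le> g"
proof (cases "r = 0")
  case False
  have "inj_on (\<lambda>v. (v - 1) div r) {v \<in> {1..r * g}. cls r v = a}"
  proof (rule inj_onI)
    fix v w assume v: "v \<in> {v \<in> {1..r * g}. cls r v = a}" and w: "w \<in> {v \<in> {1..r * g}. cls r v = a}"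
      and eq: "(v - 1) div r = (w - 1) div r"
    have "v - 1 = w - 1"
    proof -
      have "(v - 1) mod r = (w - 1) mod r" using v w by (simp add: cls_def)
      then show ?thesis using eq by (metis div_mult_mod_eq)
    qed
    then show "v = w" using v w by auto
  qed
  moreover have "(\<lambda>v. (v - 1) div r) ` {v \<in> {1..r * g}. cls r v = a} \<subseteq> {..<g}"
    using False by (auto simp: div_less_iff_less_mult mult.commute)
  ultimately show ?thesis using card_inj_on_le[of _ _ "{..<g}"] by fastforce
qed simp

text \<open>As \<open>a\<close> runs from \<open>0\<close> to \<open>b + 1\<close>, the vertices of class \<open>b\<close> are joined to one lower class after the other and
finally to each other, which completes the graph on the classes up to \<open>b\<close>.\<close>

definition stage :: "nat \<Rightarrow> nat \<Rightarrow> nat \<Rightarrow> nat \<Rightarrow> nat set set" where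
  "stage r g b a = {e \<in> pairs {1..r * g}. (\<forall>v\<in>e. cls r v < b) \<or> (\<forall>v\<in>e. cls r v \<le> b) \<and> (\<exists>v\<in>e. cls r v < a)}"

lemma pairs_nonempty: "e \<in> pairs A \<Longrightarrow> e \<noteq> {}"
  by (auto simp: pairs_def)

lemma stage_start: "stage r g 0 0 = {}"
  by (auto simp: stage_def dest: pairs_nonempty)

lemma stage_full: "stage r g b (Suc b) = stage r g (Suc b) 0"
  by (force simp: stage_def less_Suc_eq_le dest: pairs_nonempty)

lemma stage_complete: "stage r g b 0 = pairs {v \<in> {1..r * g}. cls r v < b}"
  by (auto simp: stage_def pairs_def)

lemma stage_end: "0 < r \<Longrightarrow> stage r g r 0 = pairs {1..r * g}"
  by (auto simp: stage_def cls_def)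

lemma stage_mono: "stage r g b a \<subseteq> stage r g b (Suc a)"
  unfolding stage_def using less_SucI by blast

lemma stage_invariant:
  assumes "free_cyclic_action d g {1..r * g} (rot r g)"
  shows "free_cyclic_action.invariant (rot r g) (stage r g b a)"
proof -
  interpret free_cyclic_action d g "{1..r * g}" "rot r g" by (rule assms)
  have "rot r g i ` e \<in> stage r g b a" if e: "e \<in> stage r g b a" for i e
  proof -
    have ep: "e \<in> pairs {1..r * g}" using e by (simp add: stage_def)
    have "cls r (rot r g i v) = cls r v" if "v \<in> e" for v
      using ep that by (intro rot_cls) (auto simp: pairs_def)
    then show ?thesis using e rho_pairs[OF ep] by (auto simp: stage_def)
  qed
  then show ?thesis by (simp add: invariant_def)
qed

text \<open>One step of the filling adds edges between the classes \<open>a\<close> and \<open>b\<close> only. These two classes are the periphery; the core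
consists of the other classes below \<open>b\<close>. A vertex of class \<open>a < b\<close> is joined to the whole core already, and a vertex
of class \<open>b\<close> to the classes below \<open>a\<close>.\<close>

lemma stage_core_periphery:
  fixes r g b a :: nat
  defines "C \<equiv> {v \<in> {1..r * g}. cls r v < b \<and> cls r v \<noteq> a}"
    and "S \<equiv> {v \<in> {1..r * g}. cls r v = a \<or> cls r v = b}"
  defines "J \<equiv> \<lambda>s. {u \<in> C. cls r s < b \<or> cls r u < a}"
  assumes a: "a \<le> b" and F: "stage r g b a \<subseteq> F" "F \<subseteq> stage r g b (Suc a)"
  shows "F = core_graph C S J \<union> (F \<inter> pairs S)"
    and "stage r g b (Suc a) - stage r g b a \<subseteq> pairs S"
proof -
  have two: "\<exists>x y. e = {x, y} \<and> x \<noteq> y" if "e \<in> pairs A" for e A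
    using that by (auto simp: pairs_def card_2_iff)
  show "stage r g b (Suc a) - stage r g b a \<subseteq> pairs S"
  proof
    fix e assume e: "e \<in> stage r g b (Suc a) - stage r g b a"
    then have ep: "e \<in> pairs {1..r * g}" by (simp add: stage_def)
    obtain x y where xy: "e = {x, y}" "x \<noteq> y" using two[OF ep] by blast
    have "x \<in> S \<and> y \<in> S" using e xy a unfolding S_def stage_def pairs_def by auto
    then show "e \<in> pairs S" using xy by (simp add: pairs_def)
  qed
  show "F = core_graph C S J \<union> (F \<inter> pairs S)"
  proof
    show "F \<subseteq> core_graph C S J \<union> (F \<inter> pairs S)"
    proof
      fix e assume eF: "e \<in> F"
      then have e: "e \<in> stage r g b (Suc a)" using F by auto
      then have ep: "e \<in> pairs {1..r * g}" by (simp add: stage_def)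
      obtain x y where xy: "e = {x, y}" "x \<noteq> y" using two[OF ep] by blast
      have mem: "x \<in> {1..r * g}" "y \<in> {1..r * g}" using ep xy by (auto simp: pairs_def)
      have le: "cls r x \<le> b" "cls r y \<le> b" using e xy by (auto simp: stage_def)
      have CS: "v \<in> C \<or> v \<in> S" if "v \<in> {1..r * g}" "cls r v \<le> b" for v
        using that by (auto simp: C_def S_def)
      have mixed: "u \<in> J s" if "u \<in> C" "s \<in> S" "e = {s, u}" for u s
        using that e by (auto simp: J_def C_def S_def stage_def)
      consider "x \<in> C" "y \<in> C" | "x \<in> S" "y \<in> S" | "x \<in> C" "y \<in> S" | "x \<in> S" "y \<in> C"
        using CS mem le by blast
      then show "e \<in> core_graph C S J \<union> (F \<inter> pairs S)"
      proof cases
        case 1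
        then show ?thesis using xy by (auto simp: core_graph_def pairs_def)
      next
        case 2
        then show ?thesis using xy eF by (auto simp: pairs_def)
      next
        case 3
        have "e = {y, x}" using xy by auto
        then show ?thesis using mixed[OF 3] 3 by (auto simp: core_graph_def)
      next
        case 4
        then show ?thesis using mixed[OF 4(2,1) xy(1)] xy by (auto simp: core_graph_def)
      qed
    qed
    have "pairs C \<subseteq> stage r g b a" by (auto simp: C_def stage_def pairs_def)
    moreover have "{s, u} \<in> stage r g b a" if "s \<in> S" "u \<in> J s" for s u
      using that a by (auto simp: S_def J_def C_def stage_def pairs_def card_insert_if)
    ultimately show "core_graph C S J \<union> (F \<inter> pairs S) \<subseteq> F"
      using F by (auto simp: core_graph_def)
  qed
qed

text \<open>The case of a bounded number of blocks: follow the filling of the complete graph to the step where the property appears.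
The constants are chosen one after the other: the number \<open>h\<close> of critical edges and the covariance bound \<open>\<eta>\<close> so that the
chi-square distance is at most \<open>\<epsilon>\<^sup>2\<close>, then the order \<open>g\<close> of the group that provides \<open>h\<close> critical edges, then the size
\<open>R0\<close> of the core that makes the covariances small, and \<open>d\<close> last.\<close>

lemma risk_few_blocks:
  fixes \<epsilon> L :: real
  assumes \<epsilon>: "0 < \<epsilon>" and L: "0 \<le> L"
  obtains d0 :: nat and t0 :: real where "0 < t0"
    "\<And>d n P m \<theta>. d0 \<le> d \<Longrightarrow> graph_property P \<Longrightarrow> strongly_monotone P \<Longrightarrow> null_graphs P d \<noteq> {} \<Longrightarrow>
       2 * m \<le> d \<Longrightarrow> P ({1..d}, pairs {1..m}) \<Longrightarrow> 0 \<le> \<theta> \<Longrightarrow> tanh \<theta> \<le> t0 \<Longrightarrow> real n * (tanh \<theta>)\<^sup>2 \<le> L \<Longrightarrow>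
       ennreal (1 - \<epsilon>) \<le> minimax_risk n d P \<theta>"
proof -
  \<comment> \<open>the summand 1 keeps \<open>\<Lambda>\<close> positive when \<open>L = 0\<close>\<close>
  define \<Lambda> where "\<Lambda> = 4 * L * exp (8 * L) + 1"
  have \<Lambda>: "0 < \<Lambda>" using L by (simp add: \<Lambda>_def add_nonneg_pos)
  define h where "h = nat \<lceil>16 * \<Lambda> / \<epsilon>\<^sup>2\<rceil> + 1"
  have h: "0 < h" "16 * \<Lambda> / \<epsilon>\<^sup>2 \<le> real h" unfolding h_def by (simp, linarith)
  define \<eta> where "\<eta> = \<epsilon>\<^sup>2 / (2 * \<Lambda>)"
  have \<eta>: "0 < \<eta>" using \<epsilon> \<Lambda> by (simp add: \<eta>_def)
  have budget: "sqrt (4 * L * exp (8 * L) * (8 / real k + \<eta>)) \<le> \<epsilon>" if "h \<le> k" for k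
  proof -
    have k: "0 < real k" "16 * \<Lambda> / \<epsilon>\<^sup>2 \<le> real k" using h that by linarith+
    have "16 * \<Lambda> \<le> real k * \<epsilon>\<^sup>2" using k(2) \<epsilon> by (simp add: pos_divide_le_eq)
    then have "\<Lambda> * (8 / real k) \<le> \<epsilon>\<^sup>2 / 2" using k(1) by (simp add: pos_divide_le_eq mult.commute)
    moreover have "\<Lambda> * \<eta> = \<epsilon>\<^sup>2 / 2" using \<Lambda> by (simp add: \<eta>_def)
    ultimately have "\<Lambda> * (8 / real k + \<eta>) \<le> \<epsilon>\<^sup>2" by (simp add: ring_distribs)
    moreover have "4 * L * exp (8 * L) * (8 / real k + \<eta>) \<le> \<Lambda> * (8 / real k + \<eta>)"
      using \<eta> by (intro mult_right_mono) (auto simp: \<Lambda>_def)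
    ultimately have "sqrt (4 * L * exp (8 * L) * (8 / real k + \<eta>)) \<le> sqrt (\<epsilon>\<^sup>2)"
      by (intro real_sqrt_le_mono) linarith
    then show ?thesis using \<epsilon> by simp
  qed
  define g where "g = 4 * h\<^sup>2"
  have gh: "0 < g" "4 * h\<^sup>2 \<le> g" using h(1) by (auto simp: g_def)
  obtain R0 \<theta>0 where \<theta>0: "0 < \<theta>0" and core:
    "\<And>d C S J \<theta> D s1 s2 s3 s4. core_periphery d C S J \<theta> \<Longrightarrow> R0 \<le> card C \<Longrightarrow> \<theta> \<le> \<theta>0 \<Longrightarrow> card S \<le> 2 * g \<Longrightarrow>
       D \<subseteq> pairs S \<Longrightarrow> {s1, s2, s3, s4} \<subseteq> S \<Longrightarrow> distinct [s1, s2, s3, s4] \<Longrightarrow>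
       \<bar>gexp d \<theta> (core_graph C S J \<union> D) (\<lambda>x. (x s1 * x s2) * (x s3 * x s4))
         - gexp d \<theta> (core_graph C S J \<union> D) (\<lambda>x. x s1 * x s2) * gexp d \<theta> (core_graph C S J \<union> D) (\<lambda>x. x s3 * x s4)\<bar> \<le> \<eta>"
    by (rule core_covariance_small[OF \<eta>, of "2 * g"]) blast
  define s0 where "s0 = R0 + 2 * g"
  have s0: "1 \<le> s0" using gh by (simp add: s0_def)
  have "((\<lambda>N::real. 3 * N powr (- 1/100)) \<longlongrightarrow> 0) at_top" by real_asymp
  then have "eventually (\<lambda>N::real. 3 * N powr (- 1/100) < \<epsilon>) at_top" using \<epsilon> by (rule order_tendstoD(2))
  then obtain N1 :: real where N1: "\<And>N. N1 \<le> N \<Longrightarrow> 3 * N powr (- 1/100) < \<epsilon>"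
    unfolding eventually_at_top_linorder by auto
  define N0 where "N0 = nat \<lceil>max N1 (exp L)\<rceil>"
  have N0: "N1 \<le> real N0" "exp L \<le> real N0" unfolding N0_def by linarith+
  define d0 where "d0 = max (2 * g) (s0 * N0)"
  define t0 where "t0 = min (1/2) (tanh \<theta>0)"
  show ?thesis
  proof (rule that[of t0 d0])
    show "0 < t0" using \<theta>0 by (simp add: t0_def)
    fix d n P m \<theta>
    assume d: "d0 \<le> d" and P: "graph_property P" "strongly_monotone P" and null: "null_graphs P d \<noteq> {}"
      and m: "2 * m \<le> d" and Pm: "P ({1..d}, pairs {1..m})" and \<theta>: "0 \<le> \<theta>" and t: "tanh \<theta> \<le> t0"
      and nt: "real n * (tanh \<theta>)\<^sup>2 \<le> L"
    have \<theta>\<theta>0: "\<theta> \<le> \<theta>0" and t2: "tanh \<theta> \<le> 1/2" using t by (auto simp: t0_def)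
    have d': "2 * g \<le> d" "s0 * N0 \<le> d" using d by (auto simp: d0_def)
    define r where "r = d div g"
    have rg: "r * g \<le> d" by (simp add: r_def)
    have r: "0 < r" using d' gh by (simp add: r_def div_greater_zero_iff)
    \<comment> \<open>fewer than \<open>g \<le> d / 2\<close> vertices lie outside all classes, so the classes contain \<open>m\<close> vertices\<close>
    have "d = r * g + d mod g" by (simp add: r_def)
    then have "d < r * g + g" using mod_less_divisor[OF gh(1), of d] by linarith
    then have mr: "m \<le> r * g" using m d' by linarith
    let ?V = "{1..r * g}"
    have act: "free_cyclic_action d g ?V (rot r g)" by (rule rot_free_cyclic_action[OF r gh(1) rg])
    interpret free_cyclic_action d g ?V "rot r g" by (rule act)
    have PV: "P ({1..d}, pairs ?V)"
      by (rule complete_property_transfer[OF P _ Pm V]) (use m mr in auto)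
    have P0: "\<not> P ({1..d}, stage r g 0 0)" unfolding stage_start by (rule empty_graph_null[OF P(2) null])
    \<comment> \<open>the class \<open>b\<close> during whose treatment the property appears, and then the step within it\<close>
    obtain b where b: "b < r" "\<not> P ({1..d}, stage r g b 0)" "P ({1..d}, stage r g (Suc b) 0)"
      using ex_least_nat_less[of "\<lambda>b. P ({1..d}, stage r g b 0)" r] PV P0 stage_end[OF r] by auto
    obtain a where a: "a < Suc b" "\<not> P ({1..d}, stage r g b a)" "P ({1..d}, stage r g b (Suc a))"
      using ex_least_nat_less[of "\<lambda>a. P ({1..d}, stage r g b a)" "Suc b"] b stage_full[of r g b] by auto
    have ab: "a \<le> b" using a(1) by simp
    let ?C = "{v \<in> ?V. cls r v < b \<and> cls r v \<noteq> a}" and ?S = "{v \<in> ?V. cls r v = a \<or> cls r v = b}"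
    let ?J = "\<lambda>s. {u \<in> ?C. cls r s < b \<or> cls r u < a}"
    have "?S = {v \<in> ?V. cls r v = a} \<union> {v \<in> ?V. cls r v = b}" by auto
    then have "card ?S \<le> card {v \<in> ?V. cls r v = a} + card {v \<in> ?V. cls r v = b}"
      by (simp add: card_Un_le)
    then have cS: "card ?S \<le> 2 * g" using card_cls_le[of r g a] card_cls_le[of r g b] by linarith
    show "ennreal (1 - \<epsilon>) \<le> minimax_risk n d P \<theta>"
    proof (cases "R0 \<le> card ?C")
      case False
      let ?A = "{v \<in> ?V. cls r v < Suc b}"
      have "?A = ?C \<union> ?S" using ab by auto
      then have cA: "card ?A \<le> s0" using card_Un_le[of ?C ?S] cS False by (simp add: s0_def)
      \<comment> \<open>a core below \<open>R0\<close>: the complete graph on the classes up to \<open>b\<close> has at most \<open>s0\<close> vertices\<close>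
      have N: "N0 \<le> d div s0" using d'(2) s0 by (simp add: less_eq_div_iff_mult_less_eq mult.commute)
      have sd: "s0 \<le> d"
      proof -
        have "0 < N0" using N0(2) by (metis exp_gt_zero less_le_trans of_nat_0_less_iff)
        then show ?thesis using d'(2) by (metis One_nat_def Suc_leI le_trans mult.right_neutral mult_le_mono2)
      qed
      have "exp L \<le> real (d div s0)" using N0(2) N by linarith
      then have "ln (exp L) \<le> ln (real (d div s0))" by (intro ln_mono) auto
      then have "real n * (tanh \<theta>)\<^sup>2 \<le> ln (real (d div s0))" using nt by simp
      moreover have "P ({1..d}, pairs ?A)" using b(3) unfolding stage_complete .
      moreover have "?A \<subseteq> {1..d}" using V by blast
      ultimately have "ennreal (1 - 3 * real (d div s0) powr (- 1/100)) \<le> minimax_risk n d P \<theta>"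
        using cA s0 sd \<theta> by (intro risk_complete_blocks[OF P null, of ?A])
      moreover have "3 * real (d div s0) powr (- 1/100) < \<epsilon>" using N1 N0(1) N by simp
      ultimately show ?thesis by (meson diff_left_mono ennreal_leI less_imp_le order_trans)
    next
      case True
      obtain Y f where Y: "stage r g b a \<subseteq> Y" "Y \<subseteq> stage r g b (Suc a)" "invariant Y" "\<not> P ({1..d}, Y)"
        and f: "f \<in> stage r g b (Suc a)" "f \<notin> Y" "P ({1..d}, Y \<union> orb f)"
      proof (rule maximal_invariant_null[of "stage r g b a" "stage r g b (Suc a)" P])
        show "stage r g b (Suc a) \<subseteq> pairs ?V" by (auto simp: stage_def)
        show "invariant (stage r g b a)" "invariant (stage r g b (Suc a))" by (rule stage_invariant[OF act])+
      qed (use stage_mono a in auto)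
      have fp: "f \<in> pairs ?V" using f by (simp add: stage_def)
      have Yp: "Y \<subseteq> pairs ?V" using Y by (auto simp: stage_def)
      obtain F K where F: "Y \<subseteq> F" "F \<subseteq> Y \<union> orb f" and K: "K \<subseteq> orb f" and crit: "critical_edges P d F K"
        and hK: "h \<le> card K"
        by (rule orbit_critical_edges[OF P Yp Y(3,4) fp f(3,2) gh(2) h(1)])
      have orbX: "orb f \<subseteq> stage r g b (Suc a)" by (rule orb_subset[OF stage_invariant[OF act] f(1)])
      have FX: "stage r g b a \<subseteq> F" "F \<subseteq> stage r g b (Suc a)" using F Y orbX by auto
      have KS: "K \<subseteq> pairs ?S"
      proof -
        have "orb f \<inter> Y = {}" by (rule orb_disjoint[OF Y(3) f(2)])
        then have "K \<subseteq> stage r g b (Suc a) - stage r g b a" using K orbX Y(1) by blast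
        then show ?thesis using stage_core_periphery(2)[OF ab FX] by blast
      qed
      have Feq: "F = core_graph ?C ?S ?J \<union> (F \<inter> pairs ?S)" by (rule stage_core_periphery(1)[OF ab FX])
      have cp: "core_periphery d ?C ?S ?J \<theta>"
      proof
        show "?C \<subseteq> {1..d}" "?S \<subseteq> {1..d}" using V by blast+
      qed (use \<theta> ab in auto)
      have cov: "\<bar>gexp d \<theta> F (\<lambda>x. chi e x * chi f x) - gexp d \<theta> F (chi e) * gexp d \<theta> F (chi f)\<bar> \<le> \<eta>"
        if ef: "e \<in> K" "f \<in> K" "e \<inter> f = {}" for e f
      proof -
        have p: "e \<in> pairs ?S" "f \<in> pairs ?S" using ef KS by auto
        obtain s1 s2 where e: "e = {s1, s2}" "s1 \<noteq> s2" using p(1) by (auto simp: pairs_def card_2_iff)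
        obtain s3 s4 where f: "f = {s3, s4}" "s3 \<noteq> s4" using p(2) by (auto simp: pairs_def card_2_iff)
        have S4: "{s1, s2, s3, s4} \<subseteq> ?S" using p e f unfolding pairs_def by blast
        have dist: "distinct [s1, s2, s3, s4]" using e f ef(3) by auto
        have chis: "chi e x = x s1 * x s2" "chi f x = x s3 * x s4" for x :: "nat \<Rightarrow> real"
          using e f by simp_all
        show ?thesis
          using core[OF cp True \<theta>\<theta>0 cS Int_lower2 S4 dist, of F] unfolding chis Feq[symmetric] .
      qed
      have finK: "finite K" by (rule finite_subset[OF K]) (simp add: orb_def)
      have "ennreal (1 - sqrt (4 * L * exp (8 * L) * (8 / real (card K) + \<eta>))) \<le> minimax_risk n d P \<theta>"
      proof (rule risk_small_covariances[OF crit finK _ \<theta> t2 nt _ cov])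
        show "0 < card K" using h(1) hK by linarith
        show "card {f' \<in> K. e \<inter> f' \<noteq> {}} \<le> 4" if "e \<in> K" for e by (rule orbit_neighbours[OF fp K that])
      qed (use \<eta> in auto)
      then show ?thesis using budget[OF hK] by (meson diff_left_mono ennreal_leI order_trans)
    qed
  qed
qed

section \<open>The minimax risk in the limit\<close>

lemma critical_edge_complete:
  assumes "strongly_monotone P" "critical_edge P m E e" "m \<le> d"
  shows "P ({1..d}, pairs {1..m})" "2 \<le> m"
proof -
  have "simple_graph ({1..m}, insert e E)" "P ({1..m}, insert e E)"
    using assms(2) by (auto simp: critical_edge_def simple_graph_def)
  moreover have "simple_graph ({1..d}, pairs {1..m})"
    using assms(3) by (auto simp: simple_graph_def pairs_def)
  moreover have "subgraph ({1..m}, insert e E) ({1..d}, pairs {1..m})"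
    using assms(2,3) by (auto simp: critical_edge_def simple_graph_def subgraph_def pairs_def)
  ultimately show "P ({1..d}, pairs {1..m})" using assms(1) unfolding strongly_monotone_def by (metis le_boolD)
  have "card e \<le> card {1..m}" using assms(2) by (intro card_mono) (auto simp: critical_edge_def)
  then show "2 \<le> m" using assms(2) by (simp add: critical_edge_def)
qed

text \<open>For given \<open>\<epsilon>\<close>, a number of blocks beyond a threshold \<open>N1\<close> is enough for the first construction. Below it, \<open>n * t\<^sup>2\<close> is
bounded by \<open>L = ln (max 1 N1)\<close>, so that \<open>t\<close> tends to 0 and the second construction applies to all large \<open>n\<close>.\<close>

lemma minimax_risk_liminf:
  assumes ts: "testing_setting d P m E e \<theta>"
    and N: "\<And>n. 1 \<le> n \<Longrightarrow> 2 \<le> d n div m n"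
    and nt: "\<And>n. 1 \<le> n \<Longrightarrow> real n * (tanh (\<theta> n))\<^sup>2 \<le> ln (real (d n div m n))"
  shows "liminf (\<lambda>n. minimax_risk n (d n) (P n) (\<theta> n)) = 1"
proof (rule antisym)
  let ?R = "\<lambda>n. minimax_risk n (d n) (P n) (\<theta> n)"
  have set: "graph_property (P n)" "strongly_monotone (P n)" "null_graphs (P n) (d n) \<noteq> {}"
    "critical_edge (P n) (m n) (E n) (e n)" "0 \<le> \<theta> n" if "1 \<le> n" for n
    using ts that by (auto simp: testing_setting_def)
  have "eventually (\<lambda>n. ?R n \<le> 1) sequentially"
    using eventually_ge_at_top[of 1] by eventually_elim (rule minimax_risk_le_1[OF set(3)])
  then have "limsup ?R \<le> 1" by (rule Limsup_bounded)
  moreover have "liminf ?R \<le> limsup ?R" by (rule Liminf_le_Limsup) simp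
  ultimately show "liminf ?R \<le> 1" by (rule order_trans[rotated])
  show "1 \<le> liminf ?R"
  proof (rule ennreal_le_epsilon)
    fix \<epsilon> :: real assume \<epsilon>: "0 < \<epsilon>"
    have "((\<lambda>N::real. 3 * N powr (- 1/100)) \<longlongrightarrow> 0) at_top" by real_asymp
    then have "eventually (\<lambda>N::real. 3 * N powr (- 1/100) < \<epsilon>) at_top" using \<epsilon> by (rule order_tendstoD(2))
    then obtain N1 :: real where N1: "\<And>N. N1 \<le> N \<Longrightarrow> 3 * N powr (- 1/100) < \<epsilon>"
      unfolding eventually_at_top_linorder by auto
    define L where "L = ln (max 1 N1)"
    have L: "0 \<le> L" by (simp add: L_def)
    obtain d0 t0 where t0: "0 < t0" and few:
      "\<And>d n P m \<theta>. d0 \<le> d \<Longrightarrow> graph_property P \<Longrightarrow> strongly_monotone P \<Longrightarrow> null_graphs P d \<noteq> {} \<Longrightarrow>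
       2 * m \<le> d \<Longrightarrow> P ({1..d}, pairs {1..m}) \<Longrightarrow> 0 \<le> \<theta> \<Longrightarrow> tanh \<theta> \<le> t0 \<Longrightarrow> real n * (tanh \<theta>)\<^sup>2 \<le> L \<Longrightarrow>
       ennreal (1 - \<epsilon>) \<le> minimax_risk n d P \<theta>"
      by (rule risk_few_blocks[OF \<epsilon> L]) blast
    have "filterlim d at_top sequentially" using ts by (simp add: testing_setting_def)
    then have "eventually (\<lambda>n. d0 \<le> d n) sequentially" by (simp add: filterlim_at_top)
    moreover have "eventually (\<lambda>n. L / t0\<^sup>2 \<le> real n) sequentially"
      using filterlim_real_sequentially by (simp add: filterlim_at_top)
    ultimately have "eventually (\<lambda>n. ennreal (1 - \<epsilon>) \<le> ?R n) sequentially"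
      using eventually_ge_at_top[of 1]
    proof eventually_elim
      case (elim n)
      note n = elim(3)
      have mN: "m n * 2 \<le> d n"
      proof -
        have "m n * 2 \<le> m n * (d n div m n)" using N[OF n] by (rule mult_le_mono2)
        also have "\<dots> \<le> d n" by (rule times_div_less_eq_dividend)
        finally show ?thesis .
      qed
      have Pm: "P n ({1..d n}, pairs {1..m n})" "2 \<le> m n"
        using critical_edge_complete[OF set(2,4)[OF n]] mN by auto
      show "ennreal (1 - \<epsilon>) \<le> ?R n"
      proof (cases "N1 \<le> real (d n div m n)")
        case True
        have "ennreal (1 - 3 * real (d n div m n) powr (- 1/100)) \<le> ?R n"
          using Pm mN nt[OF n] set(5)[OF n]
          by (intro risk_complete_blocks[OF set(1,2,3)[OF n], of "{1..m n}"]) auto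
        then show ?thesis using N1[OF True] by (meson diff_left_mono ennreal_leI less_imp_le order_trans)
      next
        case False
        have "ln (real (d n div m n)) \<le> L" unfolding L_def using False N[OF n] by (intro ln_mono) auto
        then have ntL: "real n * (tanh (\<theta> n))\<^sup>2 \<le> L" using nt[OF n] by linarith
        also have "\<dots> \<le> real n * t0\<^sup>2" using elim(2) t0 by (simp add: pos_divide_le_eq)
        finally have "(tanh (\<theta> n))\<^sup>2 \<le> t0\<^sup>2" using n by simp
        then have "tanh (\<theta> n) \<le> t0" using t0 by (rule power2_le_imp_le[OF _ less_imp_le])
        then show ?thesis using few[OF elim(1) set(1,2,3)[OF n] _ Pm(1) set(5)[OF n] _ ntL] mN by simp
      qed
    qed
    then have "ennreal (1 - \<epsilon>) \<le> liminf ?R" by (rule Liminf_bounded)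
    then have "ennreal (1 - \<epsilon>) + ennreal \<epsilon> \<le> liminf ?R + ennreal \<epsilon>" by (rule add_right_mono)
    moreover have "1 \<le> ennreal (1 - \<epsilon>) + ennreal \<epsilon>"
    proof (cases "\<epsilon> \<le> 1")
      case True
      then show ?thesis using \<epsilon> by (simp flip: ennreal_plus)
    next
      case False
      then have "ennreal 1 \<le> ennreal \<epsilon>" by (intro ennreal_leI) linarith
      then have "1 \<le> ennreal \<epsilon>" by (simp only: ennreal_1)
      then show ?thesis by (simp add: add_increasing)
    qed
    ultimately show "1 \<le> liminf ?R + ennreal \<epsilon>" by (rule order_trans[rotated])
  qed
qed

theorem proposition2p7:
  "(\<forall>d P m E e \<theta>. testing_setting d P m E e \<theta> \<longrightarrow>
      (\<forall>n\<ge>1. ln (real (d n div m n)) \<le> real n) \<longrightarrow>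
      (\<forall>n\<ge>1. ereal (\<theta> n) < atanh_ext (sqrt (ln (real (d n div m n)) / real n))) \<longrightarrow>
      liminf (\<lambda>n. minimax_risk n (d n) (P n) (\<theta> n)) = 1) \<and>
   (\<exists>C>0. \<forall>d P m E e \<theta>. testing_setting d P m E e \<theta> \<longrightarrow>
      (\<forall>n\<ge>1. ln (real (d n div m n)) \<ge> C * real n) \<longrightarrow>
      liminf (\<lambda>n. minimax_risk n (d n) (P n) (\<theta> n)) = 1)"
proof (intro conjI)
  show "\<forall>d P m E e \<theta>. testing_setting d P m E e \<theta> \<longrightarrow>
      (\<forall>n\<ge>1. ln (real (d n div m n)) \<le> real n) \<longrightarrow>
      (\<forall>n\<ge>1. ereal (\<theta> n) < atanh_ext (sqrt (ln (real (d n div m n)) / real n))) \<longrightarrow>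
      liminf (\<lambda>n. minimax_risk n (d n) (P n) (\<theta> n)) = 1"
  proof (intro allI impI)
    fix d P m E e and \<theta> :: "nat \<Rightarrow> real"
    assume ts: "testing_setting d P m E e \<theta>"
      and le: "\<forall>n\<ge>1. ln (real (d n div m n)) \<le> real n"
      and th: "\<forall>n\<ge>1. ereal (\<theta> n) < atanh_ext (sqrt (ln (real (d n div m n)) / real n))"
    show "liminf (\<lambda>n. minimax_risk n (d n) (P n) (\<theta> n)) = 1"
    proof (rule minimax_risk_liminf[OF ts])
      fix n :: nat assume n: "1 \<le> n"
      have \<theta>0: "0 \<le> \<theta> n" using ts n by (simp add: testing_setting_def)
      let ?N = "real (d n div m n)" and ?x = "sqrt (ln (real (d n div m n)) / real n)"
      have thn: "ereal (\<theta> n) < atanh_ext ?x" using th n by blast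
      show N: "2 \<le> d n div m n"
      proof (rule ccontr)
        assume "\<not> 2 \<le> d n div m n"
        then have "d n div m n = 0 \<or> d n div m n = 1" by linarith
        then have "ln ?N = 0" by auto
        then show False using thn \<theta>0 by (simp add: atanh_ext_def)
      qed
      then have ln0: "0 < ln ?N" by simp
      have x: "0 < ?x" "?x \<le> 1" using ln0 n le by (auto simp: divide_le_eq_1)
      have "tanh (\<theta> n) \<le> ?x"
      proof (cases "?x = 1")
        case True
        then show ?thesis using tanh_real_lt_1[of "\<theta> n"] by linarith
      next
        case False
        then have "\<theta> n < artanh ?x" using thn unfolding atanh_ext_def if_not_P[OF False] by simp
        then have "tanh (\<theta> n) < tanh (artanh ?x)" by simp
        moreover have "tanh (artanh y) = y" if "0 < y" "y < 1" for y :: real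
        proof -
          define z where "z = ln ((1 + y) / (1 - y)) / 2"
          have "exp (- (2 * z)) = (1 - y) / (1 + y)" using that by (simp add: z_def exp_minus)
          moreover have "tanh z = (1 - exp (- (2 * z))) / (1 + exp (- (2 * z)))"
            by (rule tanh_real_altdef[of z, simplified])
          moreover have "(1 - (1 - y) / (1 + y)) / (1 + (1 - y) / (1 + y)) = y"
          proof -
            have "1 - (1 - y) / (1 + y) = 2 * y / (1 + y)" "1 + (1 - y) / (1 + y) = 2 / (1 + y)"
              using that by (simp_all add: field_simps)
            then show ?thesis using that by simp
          qed
          ultimately have "tanh z = y" by (simp only:)
          then show ?thesis by (simp add: artanh_def z_def)
        qed
        moreover have "?x < 1" using x False by linarith
        ultimately show ?thesis using x(1) by (metis less_imp_le)
      qed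
      then have "(tanh (\<theta> n))\<^sup>2 \<le> ?x\<^sup>2" using \<theta>0 by (intro power_mono) auto
      also have "?x\<^sup>2 = ln ?N / real n" using ln0 by simp
      finally show "real n * (tanh (\<theta> n))\<^sup>2 \<le> ln ?N" using n by (simp add: pos_le_divide_eq mult.commute)
    qed
  qed
  show "\<exists>C>0. \<forall>d P m E e \<theta>. testing_setting d P m E e \<theta> \<longrightarrow>
      (\<forall>n\<ge>1. ln (real (d n div m n)) \<ge> C * real n) \<longrightarrow>
      liminf (\<lambda>n. minimax_risk n (d n) (P n) (\<theta> n)) = 1"
  proof (intro exI[of _ 1] conjI allI impI)
    fix d P m E e and \<theta> :: "nat \<Rightarrow> real"
    assume ts: "testing_setting d P m E e \<theta>"
      and ge: "\<forall>n\<ge>1. ln (real (d n div m n)) \<ge> 1 * real n"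
    show "liminf (\<lambda>n. minimax_risk n (d n) (P n) (\<theta> n)) = 1"
    proof (rule minimax_risk_liminf[OF ts])
      fix n :: nat assume n: "1 \<le> n"
      have \<theta>0: "0 \<le> \<theta> n" using ts n by (simp add: testing_setting_def)
      let ?N = "real (d n div m n)"
      have lnN: "real n \<le> ln ?N" using ge n by simp
      show "2 \<le> d n div m n"
      proof (rule ccontr)
        assume "\<not> 2 \<le> d n div m n"
        then have "d n div m n = 0 \<or> d n div m n = 1" by linarith
        then have "ln ?N = 0" by auto
        then show False using lnN n by simp
      qed
      have "(tanh (\<theta> n))\<^sup>2 \<le> 1"
        using tanh_abs_le_1[of "\<theta> n"] by (simp add: abs_square_le_1)
      then have "real n * (tanh (\<theta> n))\<^sup>2 \<le> real n * 1" by (intro mult_left_mono) auto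
      then show "real n * (tanh (\<theta> n))\<^sup>2 \<le> ln ?N" using lnN by simp
    qed
  qed simp
qed

end
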